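(* Let $m,n\geq1$ be integers. For all integers $r\geq0$, $$C_{r,m}^n=\mathfrak L_{g_n,m}^n+r-n,$$ where $g_n$ is the function (depending on $r$ and $m$) defined in the context. As a result, $$C_{r,m}^n=C^1_{C_{r,m}^{n-1},\,m}\quad\text{for } n\geq2,$$ and so, in particular, $C_{r,2}^n=2^nr$.
   Context: Notation. $\mathbb N=\{0,1,2,\dots\}$, $\mathfrak n=\{1,\dots,n\}$. For $\xi=(u_1,\dots,u_m)\in\mathbb N^m$, $\deg\xi=u_1+\cdots+u_m$; $\deg(\xi,i)=\deg\xi$ for $(\xi,i)\in\mathbb N^m\times\mathfrak n$. $\Gamma(r)=\{\alpha\in\mathbb N^m\times\mathfrak n:\deg\alpha\leq r\}$. ${\bf k}\in\mathbb N^m$ is the tuple with $1$ in the $k$-th entry and zeros elsewhere. $(\xi,i)\leq(\tau,j)$ iff $i=j$ and $\xi\leq\tau$ in the product order. An antichain sequence of $\mathbb N^m\times\mathfrak n$ is a finite sequence of pairwise $\leq$-incomparable elements. The number $C_{r,m}^n$. $\mathrm{LUB}(\eta,\tau)$ is the entrywise maximum of $\eta,\tau\in\mathbb N^m$. For an antichain (sequence) $\bar\alpha$, $\gamma(\bar\alpha)=\{(\mathrm{LUB}(\eta,\tau),i):\eta\neq\tau,\ (\eta,i),(\tau,i)\in\bar\alpha\text{ for some }i\}$ and $\Gamma_{\bar\alpha}(p)=\{\alpha\in\bar\alpha:\alpha\in\Gamma(p)\}$. $D_{r,\bar\alpha}$ is the smallest integer $p\geq r$ such that: for every $(\tau,l)\in\gamma(\Gamma_{\bar\alpha}(p))\setminus\Gamma(p)$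 and $1\leq i<j\leq m$ such that $(\tau-{\bf i},l)\geq\beta_1$ and $(\tau-{\bf j},l)\geq\beta_2$ for some $\beta_1,\beta_2\in\Gamma_{\bar\alpha}(p)$, there exists a sequence $(\eta_1,l),\dots,(\eta_s,l)$ in $\Gamma_{\bar\alpha}(p)$ and indices $k_1,\dots,k_s\in\{1,\dots,m\}$ with $k_1=i$, $k_s=j$, $\eta_\ell\leq\tau-{\bf k}_\ell$ for all $\ell$ (where ${\bf k}_\ell$ has $1$ in entry $k_\ell$ and zeros elsewhere), and $\deg\mathrm{LUB}(\eta_\ell,\eta_{\ell+1})\leq p$ for $\ell=1,\dots,s-1$. Then $C_{r,m}^n=\max\{D_{r,\bar\alpha}:\bar\alpha\text{ an antichain sequence of }\mathbb N^m\times\mathfrak n\}$. Antichain lengths. For a nondecreasing function $f:\mathbb N_{>0}\to\mathbb N$, $\mathfrak L_{f,m}^n$ is the maximal length $k$ of an antichain sequence $\alpha_1,\dots,\alpha_k$ of $\mathbb N^m\times\mathfrak n$ with $\deg\alpha_i\leq f(i)$ for $i=1,\dots,k$ (this is finite). The functions $g_n$. Put $r_1=r$, $g_1(1)=r$ and $g_1(i)=i+r-2$ for $i\geq2$. For $n>1$, recursively, $r_n=\mathfrak L_{g_{n-1},m}^{n-1}+r-(n-1)$ and $$g_n(i)=\begin{cases}g_{n-1}(i)&\text{if }i\leq\mathfrak L_{g_{n-1},m}^{n-1},\\ r_n&\text{if }i=\mathfrak L_{g_{n-1},m}^{n-1}+1,\\ i+r_n-\mathfrak L_{g_{n-1},m}^{n-1}-2&\text{if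 }i\geq\mathfrak L_{g_{n-1},m}^{n-1}+2.\end{cases}$$ *)

theory Defs
  imports Main
begin

(* N^m consists of the functions on nat that vanish outside the index set {1..m}.
   On these the library order on functions is the product order, and sup is the
   entrywise maximum. An element of N^m x {1..n} is a pair (xi, i). *)

definition NN :: "nat \<Rightarrow> (nat \<Rightarrow> nat) set" where
  "NN m = {\<xi>. \<forall>k. k \<notin> {1..m} \<longrightarrow> \<xi> k = 0}"

definition NNn :: "nat \<Rightarrow> nat \<Rightarrow> ((nat \<Rightarrow> nat) \<times> nat) set" where
  "NNn m n = NN m \<times> {1..n}"

definition vdeg :: "nat \<Rightarrow> (nat \<Rightarrow> nat) \<Rightarrow> nat" where
  "vdeg m \<xi> = (\<Sum>k=1..m. \<xi> k)"

definition pdeg :: "nat \<Rightarrow> (nat \<Rightarrow> nat) \<times> nat \<Rightarrow> nat" where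
  "pdeg m \<alpha> = vdeg m (fst \<alpha>)"

definition Gam :: "nat \<Rightarrow> nat \<Rightarrow> nat \<Rightarrow> ((nat \<Rightarrow> nat) \<times> nat) set" where
  "Gam m n p = {\<alpha> \<in> NNn m n. pdeg m \<alpha> \<le> p}"

definition unit_vec :: "nat \<Rightarrow> nat \<Rightarrow> nat" where
  "unit_vec k = (\<lambda>x. if x = k then 1 else 0)"

(* eta \<le> tau - k, with the difference taken in Z^m: if tau has entry 0 at k, then
   tau - k is not in N^m and no eta in N^m lies below it. *)
definition below_diff :: "(nat \<Rightarrow> nat) \<Rightarrow> (nat \<Rightarrow> nat) \<Rightarrow> nat \<Rightarrow> bool" where
  "below_diff \<eta> \<tau> k \<longleftrightarrow> (\<forall>x. int (\<eta> x) \<le> int (\<tau> x) - int (unit_vec k x))"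

definition ple :: "(nat \<Rightarrow> nat) \<times> nat \<Rightarrow> (nat \<Rightarrow> nat) \<times> nat \<Rightarrow> bool" where
  "ple \<alpha> \<beta> \<longleftrightarrow> snd \<alpha> = snd \<beta> \<and> fst \<alpha> \<le> fst \<beta>"

definition antichain_seq :: "nat \<Rightarrow> nat \<Rightarrow> ((nat \<Rightarrow> nat) \<times> nat) list \<Rightarrow> bool" where
  "antichain_seq m n \<alpha>s \<longleftrightarrow> set \<alpha>s \<subseteq> NNn m n \<and>
     sorted_wrt (\<lambda>\<alpha> \<beta>. \<not> ple \<alpha> \<beta> \<and> \<not> ple \<beta> \<alpha>) \<alpha>s"

definition lubs :: "((nat \<Rightarrow> nat) \<times> nat) set \<Rightarrow> ((nat \<Rightarrow> nat) \<times> nat) set" where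
  "lubs A = {(sup \<eta> \<tau>, i) | \<eta> \<tau> i. \<eta> \<noteq> \<tau> \<and> (\<eta>, i) \<in> A \<and> (\<tau>, i) \<in> A}"

definition Gam_seq ::
    "nat \<Rightarrow> nat \<Rightarrow> ((nat \<Rightarrow> nat) \<times> nat) list \<Rightarrow> nat \<Rightarrow> ((nat \<Rightarrow> nat) \<times> nat) set" where
  "Gam_seq m n \<alpha>s p = {\<alpha> \<in> set \<alpha>s. \<alpha> \<in> Gam m n p}"

definition D_cond :: "nat \<Rightarrow> nat \<Rightarrow> ((nat \<Rightarrow> nat) \<times> nat) list \<Rightarrow> nat \<Rightarrow> bool" where
  "D_cond m n \<alpha>s p \<longleftrightarrow>
     (\<forall>\<tau> l i j.
        (\<tau>, l) \<in> lubs (Gam_seq m n \<alpha>s p) - Gam m n p \<and> 1 \<le> i \<and> i < j \<and> j \<le> m \<and>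
        (\<exists>\<beta>1. (\<beta>1, l) \<in> Gam_seq m n \<alpha>s p \<and> below_diff \<beta>1 \<tau> i) \<and>
        (\<exists>\<beta>2. (\<beta>2, l) \<in> Gam_seq m n \<alpha>s p \<and> below_diff \<beta>2 \<tau> j)
      \<longrightarrow> (\<exists>(s::nat) (\<eta> :: nat \<Rightarrow> nat \<Rightarrow> nat) (k :: nat \<Rightarrow> nat).
             1 \<le> s \<and>
             (\<forall>q\<in>{1..s}. (\<eta> q, l) \<in> Gam_seq m n \<alpha>s p \<and> k q \<in> {1..m} \<and>
                below_diff (\<eta> q) \<tau> (k q)) \<and>
             k 1 = i \<and> k s = j \<and>
             (\<forall>q\<in>{1..<s}. vdeg m (sup (\<eta> q) (\<eta> (q + 1))) \<le> p)))"

definition D_num :: "nat \<Rightarrow> nat \<Rightarrow> nat \<Rightarrow> ((nat \<Rightarrow> nat) \<times> nat) list \<Rightarrow> nat" where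
  "D_num r m n \<alpha>s = (LEAST p. r \<le> p \<and> D_cond m n \<alpha>s p)"

definition C_num :: "nat \<Rightarrow> nat \<Rightarrow> nat \<Rightarrow> nat" where
  "C_num r m n = Max {D_num r m n \<alpha>s | \<alpha>s. antichain_seq m n \<alpha>s}"

(* Sequences are indexed from 1, lists from 0; the value f 0 is never used. *)
definition L_num :: "(nat \<Rightarrow> nat) \<Rightarrow> nat \<Rightarrow> nat \<Rightarrow> nat" where
  "L_num f m n = Max {length \<alpha>s | \<alpha>s. antichain_seq m n \<alpha>s \<and>
     (\<forall>i\<in>{1..length \<alpha>s}. pdeg m (\<alpha>s ! (i - 1)) \<le> f i)}"

(* g_fun r m n is g_n for n \<ge> 1; the case n = 0 is a dummy. In the recursive case, L and rn
   are L_{g_n,m}^n and r_{n+1}. The subtraction in rn does not truncate: the sequence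
   (0,1), ..., (0,n) of elements of degree 0 shows L \<ge> n. *)
fun g_fun :: "nat \<Rightarrow> nat \<Rightarrow> nat \<Rightarrow> nat \<Rightarrow> nat" where
  "g_fun r m 0 = (\<lambda>i. 0)"
| "g_fun r m (Suc 0) = (\<lambda>i. if i \<le> 1 then r else i + r - 2)"
| "g_fun r m (Suc (Suc n')) =
     (let n = Suc n';
          g = g_fun r m n;
          L = L_num g m n;
          rn = L + r - n
      in (\<lambda>i. if i \<le> L then g i
              else if i = L + 1 then rn
              else i + rn - L - 2))"

end

theory Submission
  imports Defs
begin

text \<open>Let \<open>I\<close> be the ideal generated by the elements of degree at most \<open>p\<close> of an antichain in one
  component. Passing from degree \<open>p - 1\<close> to \<open>p\<close>, it grows at least by Macaulay's bound. If it grows exactly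
  by this bound, then no element of degree \<open>p\<close> is new and, moreover, for every \<open>\<tau>\<close> the monomials of
  degree \<open>p - 1\<close> in \<open>I\<close> below \<open>\<tau>\<close> are connected by steps that exchange one variable, which yields the
  path required in degree \<open>p\<close>. Hence a failure of the condition in degree \<open>p\<close> costs at least one more
  monomial than the minimal growth, exactly as a new element of degree \<open>p\<close> of an antichain does; the
  first failure in a component costs two, which is what the repeated value \<open>r_n\<close> of \<open>g_n\<close> accounts for.
  Both maxima are thus bounded by the same numerical race, in which it is optimal to fill the components
  one after the other by lexicographic segments. The lexicographic antichain attains both bounds: it has
  a new element in every degree, and such an element forces a failure. The degree in which component
  \<open>j + 1\<close> is started depends only on the one in which component \<open>j\<close> was started, whence the
  recursion; for two variables this degree is doubled.\<close>

section \<open>Numerical Macaulay bounds\<close>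

text \<open>The formula \<open>L + r - n\<close> is a count. The extremal antichain has one element
  in each of the degrees from \<open>r\<close> to \<open>C - 1\<close> and a second one in the
  \<open>n\<close> degrees where a component is started, so its length is \<open>C - r + n\<close>.
  The pairs are forced: a failure needs the least upper bound of two distinct elements, so a
  component with a single generator never fails. Once a component is full in some degree, it can
  neither fail nor receive an element in a later degree.

  The connectivity statement needs the equality case of Macaulay's bound for the given ideal itself.
  Compressing a set to a lexicographic segment would yield the bound but lose the set. Sets are
  therefore cut by their last variable and the pieces estimated separately, which shifts the work to
  the numerical inequality \<open>shad_slice\<close>; its maximum leaves two possible structures in
  the case of equality.\<close>

fun nmon :: "nat \<Rightarrow> nat \<Rightarrow> nat" where
  "nmon m 0 = 1"
| "nmon 0 (Suc q) = 0"
| "nmon (Suc m) (Suc q) = nmon (Suc m) q + nmon m (Suc q)"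

text \<open>The recursion follows the lexicographic order with the last variable largest: the first
  \<open>nmon (Suc m) q\<close> monomials of degree \<open>Suc q\<close> are the multiples of that variable. On its domain
  \<open>a \<le> nmon m q\<close> the value does not depend on \<open>q\<close>, whereas \<open>coshad\<close>, the growth of the complement
  (Macaulay's \<open>k\<close> to the power \<open>\<langle>q\<rangle>\<close>), does not depend on \<open>m\<close>.\<close>

fun shad :: "nat \<Rightarrow> nat \<Rightarrow> nat \<Rightarrow> nat" where
  "shad 0 q a = 0"
| "shad (Suc m) 0 a = (if a = 0 then 0 else Suc m)"
| "shad (Suc m) (Suc q) a =
     (if a \<le> nmon (Suc m) q then shad (Suc m) q a
      else nmon (Suc m) (Suc q) + shad m (Suc q) (a - nmon (Suc m) q))"

definition coshad :: "nat \<Rightarrow> nat \<Rightarrow> nat \<Rightarrow> nat" where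
  "coshad m q k = nmon m (Suc q) - shad m q (nmon m q - k)"

lemma nmon_Suc_one: "nmon m (Suc 0) = m"
  by (induction m) auto

lemma nmon_one: "nmon (Suc 0) q = 1"
  by (induction q) auto

lemma nmon_pos: "0 < nmon (Suc m) q"
  by (induction q) auto

lemma nmon_mono: "q \<le> q' \<Longrightarrow> nmon (Suc m) q \<le> nmon (Suc m) q'"
  by (rule lift_Suc_mono_le[of "nmon (Suc m)"]) auto

lemma nmon_mono_left: "m \<le> m' \<Longrightarrow> nmon m (Suc q) \<le> nmon m' (Suc q)"
  by (rule lift_Suc_mono_le[of "\<lambda>m. nmon m (Suc q)"]) auto

lemma shad_0 [simp]: "shad m q 0 = 0"
  by (induction m q "0::nat" rule: shad.induct) auto

lemma shad_nmon: "shad m q (nmon m q) = nmon m (Suc q)"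
proof (induction m arbitrary: q)
  case (Suc m)
  show ?case
  proof (induction q)
    case 0
    then show ?case by (simp add: nmon_Suc_one)
  next
    case (Suc q)
    show ?case
    proof (cases "nmon m (Suc q) = 0")
      case True
      then have "m = 0" using nmon_pos[of "m - 1" "Suc q"] by (cases m) auto
      then show ?thesis using Suc by (simp add: nmon_one)
    next
      case False
      then show ?thesis using \<open>\<And>q. shad m q (nmon m q) = nmon m (Suc q)\<close> by simp
    qed
  qed
qed auto

lemma shad_Suc_indep: "a \<le> nmon m q \<Longrightarrow> shad m (Suc q) a = shad m q a"
  by (cases m) auto

lemma shad_indep_le:
  assumes "q \<le> q'" "a \<le> nmon m q"
  shows "shad m q' a = shad m q a"
proof (cases m)
  case (Suc k)
  show ?thesis using assms(1)
  proof (induction rule: dec_induct)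
    case (step i)
    then have "a \<le> nmon m i" using assms(2) nmon_mono[of q i k] Suc by simp
    then show ?case using step shad_Suc_indep by simp
  qed simp
qed simp

lemma shad_indep:
  assumes "a \<le> nmon m q" "a \<le> nmon m q'"
  shows "shad m q a = shad m q' a"
  using shad_indep_le[of q q' a m] shad_indep_le[of q' q a m] assms by (cases "q \<le> q'") auto

lemma shad_above:
  assumes "nmon (Suc m) q \<le> a"
  shows "shad (Suc m) (Suc q) a = nmon (Suc m) (Suc q) + shad m (Suc q) (a - nmon (Suc m) q)"
  using assms shad_nmon[of "Suc m" q] by (cases "a = nmon (Suc m) q") auto

lemma shad_1: "1 \<le> nmon m q \<Longrightarrow> shad m q 1 = m"
proof (induction m q "1::nat" rule: shad.induct)
  case (3 m q)
  then show ?case using nmon_pos[of m q] by simp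
qed auto

lemma shad_Suc_gt: "a < nmon (Suc m) q \<Longrightarrow> shad (Suc m) q a < shad (Suc m) q (Suc a)"
proof (induction m arbitrary: q a)
  case 0
  then have "a = 0" by (simp add: nmon_one)
  then show ?case using shad_1[of "Suc 0" q] by (simp add: nmon_one)
next
  case (Suc m)
  show ?case using Suc.prems
  proof (induction q)
    case (Suc q)
    consider "Suc a \<le> nmon (Suc (Suc m)) q" | "nmon (Suc (Suc m)) q \<le> a" by linarith
    then show ?case
    proof cases
      case 1
      then show ?thesis using Suc.IH by simp
    next
      case 2
      then have "a - nmon (Suc (Suc m)) q < nmon (Suc m) (Suc q)" using Suc.prems by simp
      from \<open>\<And>q a. a < nmon (Suc m) q \<Longrightarrow> _\<close>[OF this] 2 show ?thesis
        by (simp only: shad_above[OF 2] shad_above[OF le_SucI[OF 2]] Suc_diff_le)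
    qed
  qed auto
qed

lemma shad_add_le:
  assumes "a + d \<le> nmon (Suc m) q"
  shows "shad (Suc m) q a + d \<le> shad (Suc m) q (a + d)"
  using assms
proof (induction d)
  case (Suc d)
  then show ?case using shad_Suc_gt[of "a + d" m q] by simp
qed simp

lemma shad_mono: "a \<le> b \<Longrightarrow> b \<le> nmon m q \<Longrightarrow> shad m q a \<le> shad m q b"
  using shad_add_le[of a "b - a" "m - 1" q] by (cases m) auto

lemma shad_Suc_le_add: "a < nmon m q \<Longrightarrow> shad m q (Suc a) \<le> shad m q a + m"
proof (induction m arbitrary: q a)
  case (Suc m)
  show ?case using Suc.prems
  proof (induction q)
    case (Suc q)
    consider "Suc a \<le> nmon (Suc m) q" | "nmon (Suc m) q \<le> a" by linarith
    then show ?case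
    proof cases
      case 1
      then show ?thesis using Suc.IH by simp
    next
      case 2
      then have "a - nmon (Suc m) q < nmon m (Suc q)" using Suc.prems by simp
      from \<open>\<And>q a. a < nmon m q \<Longrightarrow> _\<close>[OF this] 2 show ?thesis
        by (simp only: shad_above[OF 2] shad_above[OF le_SucI[OF 2]] Suc_diff_le)
    qed
  qed auto
qed simp

text \<open>The first monomial contributes all of its multiples; each later one in the lexicographic
  order shares at least one with its predecessors. This strictness is what
  \<open>fresh_overlap\<close> exploits.\<close>

lemma shad_Suc_less_add:
  assumes "1 \<le> a" "a < nmon (Suc m) q"
  shows "shad (Suc m) q (Suc a) \<le> shad (Suc m) q a + m"
  using assms
proof (induction q)
  case (Suc q)
  consider "Suc a \<le> nmon (Suc m) q" | "nmon (Suc m) q \<le> a" by linarith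
  then show ?case
  proof cases
    case 1
    then show ?thesis using Suc by simp
  next
    case 2
    then have "a - nmon (Suc m) q < nmon m (Suc q)" using Suc.prems by simp
    from shad_Suc_le_add[OF this] 2 show ?thesis
      by (simp only: shad_above[OF 2] shad_above[OF le_SucI[OF 2]] Suc_diff_le)
  qed
qed auto

declare shad.simps(3) [simp del]

lemma shad_le: "a \<le> nmon m q \<Longrightarrow> shad m q a \<le> nmon m (Suc q)"
  using shad_mono[of a "nmon m q" m q] shad_nmon[of m q] by simp

lemma shad_plus_coshad:
  assumes "a + k = nmon m q"
  shows "shad m q a + coshad m q k = nmon m (Suc q)"
proof -
  have "nmon m q - k = a" using assms by simp
  then show ?thesis using shad_le[of a m q] assms by (simp add: coshad_def)
qed

lemma coshad_0 [simp]: "coshad m q 0 = 0"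
  using shad_nmon[of m q] by (simp add: coshad_def)

lemma coshad_nmon: "coshad m q (nmon m q) = nmon m (Suc q)"
  by (simp add: coshad_def)

text \<open>For such \<open>k\<close> the last \<open>k\<close> monomials in the order do not
  contain the last variable; a further variable only lengthens the initial segment before
  them.\<close>

lemma coshad_indep_Suc:
  assumes "k \<le> nmon m (Suc q)"
  shows "coshad (Suc m) (Suc q) k = coshad m (Suc q) k"
proof -
  let ?b = "nmon m (Suc q) - k"
  have "shad (Suc m) (Suc q) (nmon (Suc m) q + ?b) + coshad (Suc m) (Suc q) k
        = nmon (Suc m) (Suc (Suc q))"
    by (rule shad_plus_coshad) (use assms in simp)
  moreover have "shad m (Suc q) ?b + coshad m (Suc q) k = nmon m (Suc (Suc q))"
    by (rule shad_plus_coshad) (use assms in simp)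
  ultimately show ?thesis
    by (subst (asm) shad_above) simp_all
qed

lemma coshad_above:
  assumes "nmon m (Suc q) \<le> k" "k \<le> nmon (Suc m) (Suc q)"
  shows "coshad (Suc m) (Suc q) k = nmon m (Suc (Suc q)) + coshad (Suc m) q (k - nmon m (Suc q))"
proof -
  let ?b = "nmon (Suc m) (Suc q) - k"
  have "shad (Suc m) (Suc q) ?b + coshad (Suc m) (Suc q) k = nmon (Suc m) (Suc (Suc q))"
    by (rule shad_plus_coshad) (use assms in simp)
  moreover have "shad (Suc m) q ?b + coshad (Suc m) q (k - nmon m (Suc q)) = nmon (Suc m) (Suc q)"
    by (rule shad_plus_coshad) (use assms in simp)
  moreover have "shad (Suc m) (Suc q) ?b = shad (Suc m) q ?b"
    by (rule shad_Suc_indep) (use assms in simp)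
  ultimately show ?thesis by simp
qed

lemma coshad_indep_le:
  assumes "m \<le> m'" "k \<le> nmon m (Suc q)"
  shows "coshad m' (Suc q) k = coshad m (Suc q) k"
  using assms(1)
proof (induction rule: dec_induct)
  case (step i)
  then have "k \<le> nmon i (Suc q)" using assms(2) nmon_mono_left[of m i q] by simp
  then show ?case using step coshad_indep_Suc by simp
qed simp

lemma coshad_indep:
  assumes "k \<le> nmon m (Suc q)" "k \<le> nmon m' (Suc q)"
  shows "coshad m (Suc q) k = coshad m' (Suc q) k"
  using coshad_indep_le[of m m' k q] coshad_indep_le[of m' m k q] assms by (cases "m \<le> m'") auto

section \<open>Subadditivity of minimal growth and its dual for complements\<close>

definition shad_subadd :: "nat \<Rightarrow> nat \<Rightarrow> bool" where
  "shad_subadd m q \<longleftrightarrow> (\<forall>a b. a + b \<le> nmon m q \<longrightarrow> shad m q (a + b) \<le> shad m q a + shad m q b)"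

definition coshad_superadd :: "nat \<Rightarrow> nat \<Rightarrow> bool" where
  "coshad_superadd m q \<longleftrightarrow>
     (\<forall>a b. a + b \<le> nmon m q \<longrightarrow> coshad m q a + coshad m q b \<le> coshad m q (a + b))"

lemma shad_subaddD:
  "shad_subadd m q \<Longrightarrow> a + b \<le> nmon m q \<Longrightarrow> shad m q (a + b) \<le> shad m q a + shad m q b"
  by (simp add: shad_subadd_def)

lemma coshad_superaddD:
  "coshad_superadd m q \<Longrightarrow> a + b \<le> nmon m q \<Longrightarrow>
    coshad m q a + coshad m q b \<le> coshad m q (a + b)"
  by (simp add: coshad_superadd_def)

text \<open>Subadditivity cuts \<open>c\<close> at the place \<open>p\<close> where the recursion
  for \<open>Suc m\<close> variables cuts it. The first piece fills a whole degree there, and the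
  second one is treated alike on both sides.\<close>

lemma shad_le_shad_Suc:
  assumes "shad_subadd m q" "c \<le> nmon m q" "c \<le> nmon (Suc m) q'"
  shows "shad m q c \<le> shad (Suc m) q' c"
  using assms(2,3)
proof (induction q' arbitrary: c)
  case 0
  then have "c = 0 \<or> c = 1" by auto
  then show ?case using 0 shad_1[of m q] by auto
next
  case (Suc q')
  show ?case
  proof (cases "c \<le> nmon (Suc m) q'")
    case True
    then show ?thesis using Suc by (simp add: shad_Suc_indep)
  next
    case False
    define p where "p = nmon (Suc m) q'"
    have pc: "p \<le> c" using False by (simp add: p_def)
    have "shad m q (p + (c - p)) \<le> shad m q p + shad m q (c - p)"
      by (rule shad_subaddD[OF assms(1)]) (use Suc.prems pc in \<open>auto\<close>)
    moreover have "shad m q p \<le> shad (Suc m) q' p"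
      using Suc pc by (simp add: p_def)
    moreover have "shad (Suc m) q' p = nmon (Suc m) (Suc q')"
      by (simp only: p_def shad_nmon)
    moreover have "shad m q (c - p) = shad m (Suc q') (c - p)"
      by (rule shad_indep) (use Suc.prems pc in \<open>auto simp: p_def\<close>)
    ultimately show ?thesis
      using pc by (subst shad_above) (simp_all add: p_def)
  qed
qed

text \<open>Dual to \<open>shad_le_shad_Suc\<close>: superadditivity cuts \<open>k\<close> at
  \<open>N\<close>, the number of monomials without the last variable, and the induction runs over
  the number of variables.\<close>

lemma coshad_Suc_le_coshad:
  assumes "coshad_superadd (Suc m) q" "k \<le> nmon (Suc m) q" "k \<le> nmon m' (Suc q)"
  shows "coshad m' (Suc q) k \<le> coshad (Suc m) q k"
  using assms(2,3)
proof (induction m' arbitrary: k)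
  case (Suc m')
  show ?case
  proof (cases "k \<le> nmon m' (Suc q)")
    case True
    then show ?thesis using Suc coshad_indep_Suc by simp
  next
    case False
    define N where "N = nmon m' (Suc q)"
    have Nk: "N \<le> k" using False by (simp add: N_def)
    have "coshad (Suc m) q N + coshad (Suc m) q (k - N) \<le> coshad (Suc m) q (N + (k - N))"
      by (rule coshad_superaddD[OF assms(1)]) (use Suc.prems Nk in \<open>auto\<close>)
    moreover have "coshad m' (Suc q) N \<le> coshad (Suc m) q N"
      using Suc Nk by (simp add: N_def)
    moreover have "coshad m' (Suc q) N = nmon m' (Suc (Suc q))"
      by (simp only: N_def coshad_nmon)
    moreover have "coshad (Suc m') q (k - N) \<le> coshad (Suc m) q (k - N)"
    proof (cases q)
      case 0
      then have "m' = 0" using False Suc.prems by (simp add: nmon_Suc_one)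
      moreover have "k - N = 1" using 0 False Suc.prems \<open>m' = 0\<close> by (simp add: N_def)
      ultimately show ?thesis using 0 by (simp add: coshad_def nmon_Suc_one)
    next
      case (Suc q0)
      have "k - N \<le> nmon (Suc m') (Suc q0)" "k - N \<le> nmon (Suc m) (Suc q0)"
        using Suc.prems Nk Suc by (auto simp: N_def)
      then show ?thesis using coshad_indep[of "k - N" "Suc m'" q0 "Suc m"] Suc by (simp del: nmon.simps)
    qed
    moreover have "coshad (Suc m') (Suc q) k
        = nmon m' (Suc (Suc q)) + coshad (Suc m') q (k - N)"
      unfolding N_def by (rule coshad_above) (use Nk Suc.prems in \<open>auto simp: N_def\<close>)
    ultimately show ?thesis using Nk by simp
  qed
qed simp

lemma coshad_superadd_step:
  assumes "coshad_superadd m (Suc q)" "coshad_superadd (Suc m) q" "shad_subadd m (Suc q)"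
  shows "coshad_superadd (Suc m) (Suc q)"
proof -
  define N where "N = nmon m (Suc q)"
  have *: "coshad (Suc m) (Suc q) a + coshad (Suc m) (Suc q) b \<le> coshad (Suc m) (Suc q) (a + b)"
    if ab: "a + b \<le> nmon (Suc m) (Suc q)" and "b \<le> a" for a b
  proof -
    consider "a + b \<le> N" | "N < a" | "N < a + b" "a \<le> N" by linarith
    then show ?thesis
    proof cases
      case 1
      have "coshad m (Suc q) a + coshad m (Suc q) b \<le> coshad m (Suc q) (a + b)"
        by (rule coshad_superaddD[OF assms(1)]) (use 1 in \<open>simp add: N_def\<close>)
      then show ?thesis using 1 by (simp add: coshad_indep_Suc N_def)
    next
      case 2
      have "coshad (Suc m) q (a - N) + coshad (Suc m) q b \<le> coshad (Suc m) q ((a - N) + b)"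
        by (rule coshad_superaddD[OF assms(2)]) (use ab 2 in \<open>auto simp: N_def\<close>)
      moreover have "coshad (Suc m) (Suc q) b \<le> coshad (Suc m) q b"
        by (rule coshad_Suc_le_coshad[OF assms(2)]) (use ab 2 in \<open>auto simp: N_def\<close>)
      moreover have "coshad (Suc m) (Suc q) a = nmon m (Suc (Suc q)) + coshad (Suc m) q (a - N)"
        unfolding N_def by (rule coshad_above) (use 2 ab in \<open>auto simp: N_def\<close>)
      moreover have "coshad (Suc m) (Suc q) (a + b)
          = nmon m (Suc (Suc q)) + coshad (Suc m) q (a + b - N)"
        unfolding N_def by (rule coshad_above) (use 2 ab in \<open>auto simp: N_def\<close>)
      moreover have "(a - N) + b = a + b - N" using 2 by simp
      ultimately show ?thesis by simp
    next
      \<comment> \<open>Neither count exceeds \<open>N\<close>, but the sum does. The complements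
        \<open>N - a\<close> and \<open>N - b\<close> add up to the complement of
        \<open>a + b - N\<close>, and subadditivity of \<open>shad\<close> applies to them.\<close>
      case 3
      let ?R = "nmon m (Suc (Suc q))"
      have bN: "b \<le> N" using 3 that by simp
      have sa: "shad m (Suc q) (N - a) + coshad m (Suc q) a = ?R"
        by (rule shad_plus_coshad) (use 3 in \<open>simp add: N_def\<close>)
      have sb: "shad m (Suc q) (N - b) + coshad m (Suc q) b = ?R"
        by (rule shad_plus_coshad) (use bN in \<open>simp add: N_def\<close>)
      have sab: "shad m (Suc q) ((N - a) + (N - b)) + coshad m (Suc q) (a + b - N) = ?R"
        by (rule shad_plus_coshad) (use 3 bN in \<open>simp add: N_def\<close>)
      have "shad m (Suc q) ((N - a) + (N - b)) \<le> shad m (Suc q) (N - a) + shad m (Suc q) (N - b)"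
        by (rule shad_subaddD[OF assms(3)]) (use 3 bN in \<open>auto simp: N_def\<close>)
      moreover have "coshad m (Suc q) (a + b - N) \<le> coshad (Suc m) q (a + b - N)"
        by (rule coshad_Suc_le_coshad[OF assms(2)]) (use 3 ab bN in \<open>auto simp: N_def\<close>)
      moreover have "coshad (Suc m) (Suc q) (a + b) = ?R + coshad (Suc m) q (a + b - N)"
        unfolding N_def by (rule coshad_above) (use 3 ab in \<open>auto simp: N_def\<close>)
      moreover have "coshad (Suc m) (Suc q) a = coshad m (Suc q) a"
        "coshad (Suc m) (Suc q) b = coshad m (Suc q) b"
        using 3 bN coshad_indep_Suc by (auto simp: N_def)
      ultimately show ?thesis using sa sb sab by linarith
    qed
  qed
  show ?thesis unfolding coshad_superadd_def
  proof (intro allI impI)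
    fix a b assume "a + b \<le> nmon (Suc m) (Suc q)"
    then show "coshad (Suc m) (Suc q) a + coshad (Suc m) (Suc q) b \<le> coshad (Suc m) (Suc q) (a + b)"
      using *[of a b] *[of b a] by (cases "b \<le> a") (auto simp: add.commute)
  qed
qed

lemma shad_subadd_step:
  assumes "shad_subadd m (Suc q)" "shad_subadd (Suc m) q" "coshad_superadd (Suc m) q"
  shows "shad_subadd (Suc m) (Suc q)"
proof -
  define p where "p = nmon (Suc m) q"
  have *: "shad (Suc m) (Suc q) (a + b) \<le> shad (Suc m) (Suc q) a + shad (Suc m) (Suc q) b"
    if ab: "a + b \<le> nmon (Suc m) (Suc q)" and "b \<le> a" for a b
  proof -
    let ?R = "nmon (Suc m) (Suc q)"
    consider "a + b \<le> p" | "p < a" | "p < a + b" "a \<le> p" by linarith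
    then show ?thesis
    proof cases
      case 1
      have "shad (Suc m) q (a + b) \<le> shad (Suc m) q a + shad (Suc m) q b"
        by (rule shad_subaddD[OF assms(2)]) (use 1 in \<open>simp add: p_def\<close>)
      then show ?thesis using 1 by (simp add: shad_Suc_indep p_def)
    next
      case 2
      have "shad m (Suc q) ((a - p) + b) \<le> shad m (Suc q) (a - p) + shad m (Suc q) b"
        by (rule shad_subaddD[OF assms(1)]) (use ab 2 in \<open>auto simp: p_def\<close>)
      moreover have "shad m (Suc q) b \<le> shad (Suc m) (Suc q) b"
        by (rule shad_le_shad_Suc[OF assms(1)]) (use ab 2 in \<open>auto simp: p_def\<close>)
      moreover have "shad (Suc m) (Suc q) a = ?R + shad m (Suc q) (a - p)"
        unfolding p_def by (rule shad_above) (use 2 in \<open>simp add: p_def\<close>)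
      moreover have "shad (Suc m) (Suc q) (a + b) = ?R + shad m (Suc q) (a + b - p)"
        unfolding p_def by (rule shad_above) (use 2 in \<open>simp add: p_def\<close>)
      moreover have "(a - p) + b = a + b - p" using 2 by simp
      ultimately show ?thesis by simp
    next
      case 3
      have bp: "b \<le> p" using 3 that by simp
      have sa: "shad (Suc m) q a + coshad (Suc m) q (p - a) = ?R"
        by (rule shad_plus_coshad) (use 3 in \<open>simp add: p_def\<close>)
      have sb: "shad (Suc m) q b + coshad (Suc m) q (p - b) = ?R"
        by (rule shad_plus_coshad) (use bp in \<open>simp add: p_def\<close>)
      have sab: "shad (Suc m) q (a + b - p) + coshad (Suc m) q ((p - a) + (p - b)) = ?R"
        by (rule shad_plus_coshad) (use 3 bp in \<open>simp add: p_def\<close>)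
      have "coshad (Suc m) q (p - a) + coshad (Suc m) q (p - b)
          \<le> coshad (Suc m) q ((p - a) + (p - b))"
        by (rule coshad_superaddD[OF assms(3)]) (use 3 bp in \<open>auto simp: p_def\<close>)
      moreover have "shad m (Suc q) (a + b - p) \<le> shad (Suc m) q (a + b - p)"
        by (rule shad_le_shad_Suc[OF assms(1)]) (use 3 ab bp in \<open>auto simp: p_def\<close>)
      moreover have "shad (Suc m) (Suc q) (a + b) = ?R + shad m (Suc q) (a + b - p)"
        unfolding p_def by (rule shad_above) (use 3 in \<open>simp add: p_def\<close>)
      moreover have "shad (Suc m) (Suc q) a = shad (Suc m) q a"
        "shad (Suc m) (Suc q) b = shad (Suc m) q b"
        using 3 bp by (auto simp: p_def shad_Suc_indep)
      ultimately show ?thesis using sa sb sab by linarith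
    qed
  qed
  show ?thesis unfolding shad_subadd_def
  proof (intro allI impI)
    fix a b assume "a + b \<le> nmon (Suc m) (Suc q)"
    then show "shad (Suc m) (Suc q) (a + b) \<le> shad (Suc m) (Suc q) a + shad (Suc m) (Suc q) b"
      using *[of a b] *[of b a] by (cases "b \<le> a") (auto simp: add.commute)
  qed
qed

text \<open>Neither inequality can be proved alone: passing to complements in the full set of monomials
  turns the critical case of one into an instance of the other with smaller parameters.\<close>

lemma shad_subadd_coshad_superadd: "shad_subadd m q \<and> coshad_superadd m q"
proof (induction m arbitrary: q)
  case 0
  show ?case by (auto simp: shad_subadd_def coshad_superadd_def coshad_def)
next
  case (Suc m)
  show ?case
  proof (induction q)
    case 0
    show ?case
      unfolding shad_subadd_def coshad_superadd_def
      by (auto simp: le_Suc_eq add_is_1)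
  next
    case (Suc q)
    then show ?case
      using \<open>\<And>q. shad_subadd m q \<and> coshad_superadd m q\<close>
      by (blast intro: shad_subadd_step coshad_superadd_step)
  qed
qed

lemma shad_add: "a + b \<le> nmon m q \<Longrightarrow> shad m q (a + b) \<le> shad m q a + shad m q b"
  using shad_subadd_coshad_superadd unfolding shad_subadd_def by blast

text \<open>Superadditivity of \<open>coshad\<close> read for the complements: when two counts
  together reach a full degree, completing one of them and keeping the rest \<open>c\<close> does
  not increase the growth.\<close>

lemma shad_add_overflow:
  assumes "a \<le> nmon m q" "b \<le> nmon m q" "a + b = nmon m q + c"
  shows "nmon m (Suc q) + shad m q c \<le> shad m q a + shad m q b"
proof -
  let ?P = "nmon m q"
  have "shad m q a + coshad m q (?P - a) = nmon m (Suc q)"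
    "shad m q b + coshad m q (?P - b) = nmon m (Suc q)"
    "shad m q c + coshad m q ((?P - a) + (?P - b)) = nmon m (Suc q)"
    using assms by (auto intro!: shad_plus_coshad)
  moreover have "coshad m q (?P - a) + coshad m q (?P - b) \<le> coshad m q ((?P - a) + (?P - b))"
    using coshad_superaddD[of m q "?P - a" "?P - b"] shad_subadd_coshad_superadd[of m q] assms by simp
  ultimately show ?thesis by linarith
qed

text \<open>Here \<open>a0\<close> and \<open>a1\<close> are the numbers of elements of a set of monomials without and with the last
  variable; the two arguments of the maximum are lower bounds for the size of the same part of the
  shadow, and it matters for the equality case that only one of them has to be attained.\<close>

lemma shad_slice:
  assumes "a0 + a1 \<le> nmon (Suc m) q" "a0 \<le> nmon m q0"
  shows "shad (Suc m) q (a0 + a1) \<le> max (shad (Suc m) q a1) (a0 + a1) + shad m q0 a0"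
  using assms
proof (induction m arbitrary: q q0 a0 a1)
  case 0
  then have "a0 + a1 \<le> 1" by (simp add: nmon_one)
  then have "shad (Suc 0) q (a0 + a1) = a0 + a1"
    using shad_1[of "Suc 0" q] by (cases "a0 + a1") (auto simp: nmon_one)
  then show ?case by simp
next
  case (Suc m)
  note IHm = Suc.IH
  let ?m = "Suc m"
  show ?case using Suc.prems
  proof (induction q arbitrary: q0)
    case 0
    then have "a0 + a1 = 0 \<or> a0 = 0 \<and> a1 = 1 \<or> a0 = 1 \<and> a1 = 0" by auto
    then show ?case using 0 shad_1[of ?m q0] by auto
  next
    case (Suc q)
    define p where "p = nmon (Suc ?m) q"
    define p' where "p' = nmon ?m (Suc q)"
    define p1 where "p1 = nmon ?m q"
    define a where "a = a0 + a1"
    have P: "nmon (Suc ?m) (Suc q) = p + p'" by (simp add: p_def p'_def)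
    have aP: "a \<le> p + p'" using Suc.prems P by (simp add: a_def)
    show ?case
    proof (cases "a \<le> p")
      case True
      then show ?thesis using Suc by (simp add: p_def a_def shad_Suc_indep)
    next
      case False
      define c where "c = a - p"
      have ac: "a = p + c" using False by (simp add: c_def)
      have cp': "c \<le> p'" using aP ac by simp
      have sa: "shad (Suc ?m) (Suc q) a = p + p' + shad ?m (Suc q) c"
        using shad_above[of ?m q a] False P by (simp add: c_def p_def)
      \<comment> \<open>The optimal segment of size \<open>a\<close> contains all \<open>p\<close>
        multiples of the last variable. In \<open>big1\<close> the given split has room for them as
        well, in \<open>big0\<close> the other part is at least a full slice; only in
        \<open>mid\<close> do both parts have gaps.\<close>
      consider (big1) "p \<le> a1" | (big0) "p' \<le> a0" | (mid) "a1 < p" "a0 < p'" by linarith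
      then show ?thesis
      proof cases
        case big1
        have "shad (Suc ?m) (Suc q) a1 = p + p' + shad ?m (Suc q) (a1 - p)"
          using shad_above[of ?m q a1] big1 P by (simp add: p_def)
        moreover have "shad ?m (Suc q) ((a1 - p) + a0) \<le> shad ?m (Suc q) (a1 - p) + shad ?m (Suc q) a0"
          by (rule shad_add) (use big1 cp' ac in \<open>simp add: a_def p'_def\<close>)
        moreover have "(a1 - p) + a0 = c" using big1 ac by (simp add: a_def)
        moreover have "shad ?m (Suc q) a0 = shad ?m q0 a0"
          by (rule shad_indep) (use Suc.prems big1 cp' ac in \<open>auto simp: a_def p'_def\<close>)
        ultimately show ?thesis using sa by (simp add: a_def max_def)
      next
        case big0
        have full: "shad (Suc ?m) (Suc q) (p + p') = p + p' + nmon ?m (Suc (Suc q))"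
          using shad_nmon[of "Suc ?m" "Suc q"] P by simp
        \<comment> \<open>Completing the segment adds at least one shadow element per monomial, so
          its growth beyond \<open>a\<close> is at most that of the full degree.\<close>
        have "shad (Suc ?m) (Suc q) a + (p + p' - a) \<le> shad (Suc ?m) (Suc q) (a + (p + p' - a))"
          by (rule shad_add_le) (use aP P in simp)
        then have "shad (Suc ?m) (Suc q) a \<le> a + nmon ?m (Suc (Suc q))"
          using aP full by (simp del: nmon.simps)
        moreover have "nmon ?m (Suc (Suc q)) = shad ?m q0 p'"
          using shad_indep[of p' ?m "Suc q" q0] shad_nmon[of ?m "Suc q"] big0 Suc.prems
          by (simp only: p'_def)
        moreover have "shad ?m q0 p' \<le> shad ?m q0 a0"
          by (rule shad_mono) (use big0 Suc.prems in auto)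
        ultimately show ?thesis unfolding a_def by linarith
      next
        case mid
        have p'eq: "p' = p1 + nmon m (Suc q)" by (simp add: p'_def p1_def)
        have s0: "shad ?m q0 a0 = shad ?m (Suc q) a0"
          by (rule shad_indep) (use Suc.prems mid in \<open>auto simp: p'_def\<close>)
        show ?thesis
        proof (cases "a0 \<le> p1")
          case True
          have "0 < q"
          proof (rule ccontr)
            assume "\<not> 0 < q"
            then have "p = 1" "p1 = 1" by (auto simp: p_def p1_def)
            then show False using mid True ac False by (simp add: a_def)
          qed
          then obtain q' where q: "q = Suc q'" by (cases q) auto
          define p2 where "p2 = nmon (Suc ?m) q'"
          have peq: "p = p2 + p1" by (simp add: p_def p1_def p2_def q)
          define c1 where "c1 = a1 - p2"
          have a1: "a1 = p2 + c1" using ac True peq by (simp add: c1_def a_def)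
          have sum: "c1 + a0 = p1 + c" using ac a1 peq by (simp add: a_def)
          have c1p: "c1 \<le> p1" using mid peq a1 by simp
          have cp1: "c \<le> p1" using sum True c1p by simp
          have "nmon ?m (Suc q) + shad ?m q c \<le> shad ?m q c1 + shad ?m q a0"
            by (rule shad_add_overflow) (use True c1p sum in \<open>auto simp: p1_def\<close>)
          moreover have "shad ?m (Suc q) c = shad ?m q c" "shad ?m (Suc q) a0 = shad ?m q a0"
            using cp1 True by (auto intro!: shad_Suc_indep simp: p1_def)
          moreover have "shad (Suc ?m) (Suc q) a1 = p + shad ?m q c1"
          proof -
            have "shad (Suc ?m) (Suc q) a1 = shad (Suc ?m) q a1"
              by (rule shad_Suc_indep) (use mid in \<open>simp add: p_def\<close>)
            also have "\<dots> = p + shad ?m q c1"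
              unfolding q p_def c1_def p2_def by (rule shad_above) (simp add: a1 p2_def)
            finally show ?thesis .
          qed
          ultimately show ?thesis using sa s0 unfolding a_def p'_def by linarith
        next
          case a0p: False
          define d0 where "d0 = a0 - p1"
          have a0: "a0 = p1 + d0" using a0p by (simp add: d0_def)
          have d0le: "d0 \<le> nmon m (Suc q)" using a0 mid p'eq by simp
          have sa0: "shad ?m (Suc q) a0 = p' + shad m (Suc q) d0"
            unfolding p'_def d0_def p1_def by (rule shad_above) (simp add: a0 p1_def)
          show ?thesis
          proof (cases "d0 \<le> c")
            case True
            \<comment> \<open>The same inequality in one variable less, with \<open>c\<close> cut
              into \<open>d0\<close> and \<open>c - d0\<close>. Its maximum carries over:
              \<open>c\<close> becomes \<open>p + c = a\<close>, and the growth of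
              \<open>c - d0\<close> becomes that of \<open>a1 = p2 + (c - d0)\<close>.\<close>
            have IH: "shad ?m (Suc q) (d0 + (c - d0))
                \<le> max (shad ?m (Suc q) (c - d0)) (d0 + (c - d0)) + shad m (Suc q) d0"
              by (rule IHm) (use True cp' d0le in \<open>auto simp: p'_def\<close>)
            show ?thesis
            proof (cases "shad ?m (Suc q) (c - d0) \<le> c")
              case le: True
              then have "shad ?m (Suc q) c \<le> c + shad m (Suc q) d0" using IH True by simp
              then show ?thesis using sa s0 sa0 ac unfolding a_def by linarith
            next
              case nle: False
              then have less: "c - d0 > 0" by (cases "c - d0 = 0") auto
              have "0 < q"
              proof (rule ccontr)
                assume "\<not> 0 < q"
                then have "p = 1" "p1 = 1" by (auto simp: p_def p1_def)
                then show False using less ac a0 mid by (simp add: a_def)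
              qed
              then obtain q' where q: "q = Suc q'" by (cases q) auto
              define p2 where "p2 = nmon (Suc ?m) q'"
              have peq: "p = p2 + p1" by (simp add: p_def p1_def p2_def q)
              have a1: "a1 = p2 + (c - d0)" using ac a0 peq True by (simp add: a_def)
              have "shad (Suc ?m) (Suc q) a1 = shad (Suc ?m) q a1"
                by (rule shad_Suc_indep) (use mid in \<open>simp add: p_def\<close>)
              also have "\<dots> = p + shad ?m q (a1 - p2)"
                unfolding q p_def p2_def by (rule shad_above) (simp add: a1 p2_def)
              also have "\<dots> = p + shad ?m (Suc q) (c - d0)"
                using a1 shad_indep[of "c - d0" ?m q "Suc q"] mid peq by (simp add: p1_def)
              finally show ?thesis using sa s0 sa0 IH nle True unfolding a_def by (simp add: max_def)
            qed
          next
            case False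
            have IH: "shad ?m (Suc q) (c + 0) \<le> max (shad ?m (Suc q) 0) (c + 0) + shad m (Suc q) c"
              by (rule IHm) (use False d0le cp' in \<open>auto simp: p'_def\<close>)
            moreover have "shad m (Suc q) c \<le> shad m (Suc q) d0"
              by (rule shad_mono) (use False d0le in auto)
            ultimately have "shad ?m (Suc q) c \<le> c + shad m (Suc q) d0" by simp
            then show ?thesis using sa s0 sa0 ac unfolding a_def by linarith
          qed
        qed
      qed
    qed
  qed
qed

section \<open>Shadows of sets of monomials and the equality case of Macaulay's theorem\<close>

definition inc :: "nat \<Rightarrow> (nat \<Rightarrow> nat) \<Rightarrow> nat \<Rightarrow> nat" where
  "inc k \<xi> = \<xi>(k := Suc (\<xi> k))"

definition mons :: "nat \<Rightarrow> nat \<Rightarrow> (nat \<Rightarrow> nat) set" where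
  "mons m q = {\<xi> \<in> NN m. vdeg m \<xi> = q}"

definition shadow :: "nat \<Rightarrow> (nat \<Rightarrow> nat) set \<Rightarrow> (nat \<Rightarrow> nat) set" where
  "shadow m A = (\<Union>k\<in>{1..m}. inc k ` A)"

lemma inc_apply: "inc k \<xi> j = (if j = k then Suc (\<xi> j) else \<xi> j)"
  by (simp add: inc_def)

lemma inc_commute: "inc a (inc b \<xi>) = inc b (inc a \<xi>)"
  by (auto simp: inc_def fun_eq_iff)

lemma inj_inc: "inj (inc k)"
proof (rule injI, rule ext)
  fix \<xi> \<eta> :: "nat \<Rightarrow> nat" and j
  assume "inc k \<xi> = inc k \<eta>"
  then have "inc k \<xi> j = inc k \<eta> j" by simp
  then show "\<xi> j = \<eta> j" by (simp add: inc_apply split: if_splits)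
qed

lemma inc_inject [simp]: "inc k \<xi> = inc k \<eta> \<longleftrightarrow> \<xi> = \<eta>"
  by (rule inj_eq[OF inj_inc])

lemma le_inc: "\<xi> \<le> inc k \<xi>"
  by (simp add: le_fun_def inc_apply)

lemma inc_mono: "\<xi> \<le> \<eta> \<Longrightarrow> inc k \<xi> \<le> inc k \<eta>"
  by (simp add: le_fun_def inc_apply)

lemma ex_inc: "0 < \<xi> k \<Longrightarrow> \<exists>\<eta>. \<xi> = inc k \<eta>"
  by (rule exI[of _ "\<xi>(k := \<xi> k - 1)"]) (auto simp: inc_def)

lemma inc_le: "\<xi> \<le> \<tau> \<Longrightarrow> \<xi> k < \<tau> k \<Longrightarrow> inc k \<xi> \<le> \<tau>"
  by (simp add: le_fun_def inc_apply)

lemma inc_le_inc_iff [simp]: "inc k \<xi> \<le> inc k \<tau> \<longleftrightarrow> \<xi> \<le> \<tau>"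
  by (auto simp: le_fun_def inc_apply)

lemma le_inc_cancel: "\<xi> \<le> inc k \<tau> \<Longrightarrow> \<xi> k = 0 \<Longrightarrow> \<xi> \<le> \<tau>"
  unfolding le_fun_def inc_apply by (metis le0)

lemma vdeg_Suc: "vdeg (Suc m) \<xi> = vdeg m \<xi> + \<xi> (Suc m)"
  by (simp add: vdeg_def)

lemma vdeg_inc: "k \<in> {1..m} \<Longrightarrow> vdeg m (inc k \<xi>) = Suc (vdeg m \<xi>)"
proof -
  assume k: "k \<in> {1..m}"
  have "vdeg m (inc k \<xi>) = (\<Sum>j=1..m. \<xi> j + (if j = k then 1 else 0))"
    unfolding vdeg_def by (rule sum.cong) (auto simp: inc_apply)
  then show ?thesis using k by (simp add: sum.distrib vdeg_def)
qed

lemma vdeg_mono: "\<xi> \<le> \<eta> \<Longrightarrow> vdeg m \<xi> \<le> vdeg m \<eta>"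
  unfolding vdeg_def by (rule sum_mono) (simp add: le_fun_def)

lemma NN_ext: "\<xi> \<in> NN m \<Longrightarrow> \<eta> \<in> NN m \<Longrightarrow> (\<And>k. k \<in> {1..m} \<Longrightarrow> \<xi> k = \<eta> k) \<Longrightarrow> \<xi> = \<eta>"
proof (rule ext)
  fix k
  assume "\<xi> \<in> NN m" "\<eta> \<in> NN m" "\<And>k. k \<in> {1..m} \<Longrightarrow> \<xi> k = \<eta> k"
  then show "\<xi> k = \<eta> k" by (cases "k \<in> {1..m}") (auto simp: NN_def)
qed

lemma NN_inc: "k \<in> {1..m} \<Longrightarrow> inc k \<xi> \<in> NN m \<longleftrightarrow> \<xi> \<in> NN m"
  by (auto simp: NN_def inc_apply)

lemma NN_Suc_iff: "\<xi> \<in> NN m \<longleftrightarrow> \<xi> \<in> NN (Suc m) \<and> \<xi> (Suc m) = 0"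
proof -
  have "k \<notin> {1..m} \<longleftrightarrow> k \<notin> {1..Suc m} \<or> k = Suc m" for k by auto
  then show ?thesis unfolding NN_def by blast
qed

lemma NN_le: "\<xi> \<le> \<eta> \<Longrightarrow> \<eta> \<in> NN m \<Longrightarrow> \<xi> \<in> NN m"
proof -
  assume "\<xi> \<le> \<eta>" "\<eta> \<in> NN m"
  moreover from this(1) have "\<xi> k \<le> \<eta> k" for k by (simp add: le_fun_def)
  ultimately show ?thesis by (auto simp: NN_def) (metis le_zero_eq)+
qed

lemma vdeg_eq_imp_eq:
  assumes "\<xi> \<le> \<eta>" "\<eta> \<in> NN m" "vdeg m \<eta> \<le> vdeg m \<xi>"
  shows "\<xi> = \<eta>"
proof (rule NN_ext[OF NN_le[OF assms(1,2)] assms(2)])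
  fix k assume k: "k \<in> {1..m}"
  show "\<xi> k = \<eta> k"
  proof (rule ccontr)
    assume "\<xi> k \<noteq> \<eta> k"
    moreover have "\<xi> k \<le> \<eta> k" using assms(1) by (simp add: le_fun_def)
    ultimately have "inc k \<xi> \<le> \<eta>" by (intro inc_le[OF assms(1)]) simp
    then show False using vdeg_mono[of "inc k \<xi>" \<eta> m] vdeg_inc[OF k] assms(3) by simp
  qed
qed

lemma mons_eqI: "\<xi> \<le> \<eta> \<Longrightarrow> \<xi> \<in> mons m q \<Longrightarrow> \<eta> \<in> mons m q \<Longrightarrow> \<xi> = \<eta>"
  by (rule vdeg_eq_imp_eq) (auto simp: mons_def)

lemma inc_in_mons: "k \<in> {1..m} \<Longrightarrow> inc k \<xi> \<in> mons m (Suc q) \<longleftrightarrow> \<xi> \<in> mons m q"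
  by (auto simp: mons_def NN_inc vdeg_inc)

lemma mons_0: "mons m 0 = {\<lambda>_. 0}"
proof -
  have "(\<lambda>_. 0) \<in> NN m" "vdeg m (\<lambda>_. 0) = 0" by (simp_all add: NN_def vdeg_def)
  moreover have "\<xi> = (\<lambda>_. 0)" if "\<xi> \<in> NN m" "vdeg m \<xi> = 0" for \<xi>
    by (rule sym, rule vdeg_eq_imp_eq[OF _ that(1)]) (simp_all add: le_fun_def that(2))
  ultimately show ?thesis unfolding mons_def by blast
qed

lemma mons_left_0: "mons 0 (Suc q) = {}"
  by (simp add: mons_def vdeg_def)

lemma mons_left_Suc: "\<xi> \<in> mons m q \<longleftrightarrow> \<xi> \<in> mons (Suc m) q \<and> \<xi> (Suc m) = 0"
  unfolding mons_def by (auto simp: NN_Suc_iff[of _ m] vdeg_Suc)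

lemma mons_Suc: "mons (Suc m) (Suc q) = inc (Suc m) ` mons (Suc m) q \<union> mons m (Suc q)"
  using ex_inc[of _ "Suc m"] inc_in_mons[of "Suc m" "Suc m" _ q]
  by (auto simp: mons_left_Suc[of _ m]) blast

lemma inc_neq_slice: "\<xi> \<in> mons m q \<Longrightarrow> \<xi> \<noteq> inc (Suc m) \<eta>"
  by (auto simp: mons_left_Suc[of _ m] inc_apply)

lemma finite_mons [simp]: "finite (mons m q)"
proof (induction m arbitrary: q)
  case 0
  then show ?case by (cases q) (auto simp: mons_0 mons_left_0)
next
  case (Suc m)
  show ?case
  proof (induction q)
    case (Suc q)
    then show ?case using \<open>\<And>q. finite (mons m q)\<close> by (simp add: mons_Suc)
  qed (simp add: mons_0)
qed

lemma card_slices: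
  assumes "X \<subseteq> mons m q"
  shows "finite Y \<Longrightarrow> card (inc (Suc m) ` Y \<union> X) = card Y + card X"
proof -
  assume "finite Y"
  moreover have "inc (Suc m) ` Y \<inter> X = {}" using assms inc_neq_slice by fastforce
  ultimately show ?thesis
    using finite_subset[OF assms] by (simp add: card_Un_disjoint card_image inj_on_def)
qed

lemma card_mons: "card (mons m q) = nmon m q"
proof (induction m arbitrary: q)
  case 0
  then show ?case by (cases q) (auto simp: mons_0 mons_left_0)
next
  case (Suc m)
  show ?case
  proof (induction q)
    case (Suc q)
    then show ?case using \<open>\<And>q. card (mons m q) = nmon m q\<close>
      by (simp add: mons_Suc card_slices[OF order.refl])
  qed (simp add: mons_0)
qed

lemma card_le_nmon: "A \<subseteq> mons m q \<Longrightarrow> card A \<le> nmon m q"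
  using card_mono[of "mons m q" A] by (simp add: card_mons)

lemma shadow_subset: "A \<subseteq> mons m q \<Longrightarrow> shadow m A \<subseteq> mons m (Suc q)"
  by (auto simp: shadow_def inc_in_mons)

lemma finite_shadow: "finite A \<Longrightarrow> finite (shadow m A)"
  by (simp add: shadow_def)

lemma shadow_Un: "shadow m (A \<union> B) = shadow m A \<union> shadow m B"
  by (auto simp: shadow_def)

lemma shadow_empty [simp]: "shadow m {} = {}"
  by (simp add: shadow_def)

lemma shadow_image_inc: "shadow m (inc k ` A) = inc k ` shadow m A"
  by (simp add: shadow_def image_UN image_image inc_commute[of _ k])

lemma shadow_Suc: "shadow (Suc m) A = inc (Suc m) ` A \<union> shadow m A"
  by (simp add: shadow_def atLeastAtMostSuc_conv)

lemma shadow_slices: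
  "shadow (Suc m) (inc (Suc m) ` A1 \<union> A0) = inc (Suc m) ` (shadow (Suc m) A1 \<union> A0) \<union> shadow m A0"
  unfolding shadow_Un shadow_image_inc shadow_Suc[of m A0] by auto

lemma shadow_mons: "shadow (Suc m) (mons (Suc m) q) = mons (Suc m) (Suc q)"
proof
  show "mons (Suc m) (Suc q) \<subseteq> shadow (Suc m) (mons (Suc m) q)"
  proof
    fix \<xi> assume xi: "\<xi> \<in> mons (Suc m) (Suc q)"
    then have "(\<Sum>k=1..Suc m. \<xi> k) \<noteq> 0" by (simp add: mons_def vdeg_def del: sum.cl_ivl_Suc)
    then obtain k where k: "k \<in> {1..Suc m}" "0 < \<xi> k"
      by (rule sum.not_neutral_contains_not_neutral) blast
    then obtain \<eta> where "\<xi> = inc k \<eta>" using ex_inc by blast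
    then show "\<xi> \<in> shadow (Suc m) (mons (Suc m) q)"
      using k xi inc_in_mons[OF k(1)] by (auto simp: shadow_def)
  qed
qed (rule shadow_subset, simp)

section \<open>Slicing by the last variable, and Macaulay's bound\<close>

definition slice0 :: "nat \<Rightarrow> (nat \<Rightarrow> nat) set \<Rightarrow> (nat \<Rightarrow> nat) set" where
  "slice0 m A = {\<xi> \<in> A. \<xi> (Suc m) = 0}"

definition slice1 :: "nat \<Rightarrow> (nat \<Rightarrow> nat) set \<Rightarrow> (nat \<Rightarrow> nat) set" where
  "slice1 m A = {\<xi>. inc (Suc m) \<xi> \<in> A}"

lemma slices:
  assumes "A \<subseteq> mons (Suc m) (Suc q)"
  shows "A = inc (Suc m) ` slice1 m A \<union> slice0 m A"
    and "slice1 m A \<subseteq> mons (Suc m) q" and "slice0 m A \<subseteq> mons m (Suc q)"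
proof -
  show "A = inc (Suc m) ` slice1 m A \<union> slice0 m A"
    using ex_inc[of _ "Suc m"] unfolding slice1_def slice0_def by (auto simp: image_iff)
  show "slice1 m A \<subseteq> mons (Suc m) q"
    using assms inc_in_mons[of "Suc m" "Suc m" _ q] by (auto simp: slice1_def)
  show "slice0 m A \<subseteq> mons m (Suc q)"
    using assms by (auto simp: slice0_def mons_left_Suc[of _ m])
qed

lemma card_shadow_slices:
  assumes "A \<subseteq> mons (Suc m) (Suc q)"
  shows "card A = card (slice1 m A) + card (slice0 m A)"
    and "card (shadow (Suc m) A)
      = card (shadow (Suc m) (slice1 m A) \<union> slice0 m A) + card (shadow m (slice0 m A))"
proof -
  note sl = slices[OF assms]
  have fin: "finite (slice1 m A)" "finite (slice0 m A)"
    using sl(2,3) finite_subset by (blast intro: finite_mons)+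
  show "card A = card (slice1 m A) + card (slice0 m A)"
    by (subst sl(1)) (rule card_slices[OF sl(3) fin(1)])
  show "card (shadow (Suc m) A)
      = card (shadow (Suc m) (slice1 m A) \<union> slice0 m A) + card (shadow m (slice0 m A))"
    by (subst sl(1), subst shadow_slices)
       (rule card_slices[OF shadow_subset[OF sl(3)]], simp add: fin finite_shadow)
qed

text \<open>The union is the part of the shadow of \<open>A\<close> divisible by the last variable,
  after division. It contains \<open>A\<close> because multiplying \<open>slice1\<close> by that
  variable is one of the shadow operations. The two lower bounds match the arguments of the maximum
  in \<open>shad_slice\<close>.\<close>

lemma card_shadow_slice_ge:
  assumes "A \<subseteq> mons (Suc m) (Suc q)"
  shows "card (shadow (Suc m) (slice1 m A)) \<le> card (shadow (Suc m) (slice1 m A) \<union> slice0 m A)"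
    and "card A \<le> card (shadow (Suc m) (slice1 m A) \<union> slice0 m A)"
    and "A \<subseteq> shadow (Suc m) (slice1 m A) \<union> slice0 m A"
    and "finite (shadow (Suc m) (slice1 m A) \<union> slice0 m A)"
proof -
  note sl = slices[OF assms]
  show fin: "finite (shadow (Suc m) (slice1 m A) \<union> slice0 m A)"
    using sl(2,3) finite_subset by (blast intro: finite_mons finite_shadow)
  have "inc (Suc m) ` slice1 m A \<subseteq> shadow (Suc m) (slice1 m A)" by (simp add: shadow_Suc)
  then show "A \<subseteq> shadow (Suc m) (slice1 m A) \<union> slice0 m A" using sl(1) by blast
  then show "card A \<le> card (shadow (Suc m) (slice1 m A) \<union> slice0 m A)"
    by (rule card_mono[OF fin])
  show "card (shadow (Suc m) (slice1 m A)) \<le> card (shadow (Suc m) (slice1 m A) \<union> slice0 m A)"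
    by (rule card_mono[OF fin]) simp
qed

text \<open>The slices are bounded by induction, on the degree for \<open>slice1\<close> and on the
  number of variables for \<open>slice0\<close>; \<open>shad_slice\<close> combines the two
  bounds.\<close>

theorem macaulay: "A \<subseteq> mons m q \<Longrightarrow> shad m q (card A) \<le> card (shadow m A)"
proof (induction m arbitrary: q A)
  case (Suc m)
  show ?case using Suc.prems
  proof (induction q arbitrary: A)
    case 0
    then have "A = {} \<or> A = {\<lambda>_. 0}" by (auto simp: mons_0)
    moreover have "card (shadow (Suc m) {\<lambda>_. 0}) = Suc m"
    proof -
      have "shadow (Suc m) {\<lambda>_. 0} = mons (Suc m) (Suc 0)"
        using shadow_mons[of m 0] by (simp add: mons_0)
      then show ?thesis by (simp add: card_mons nmon_Suc_one del: nmon.simps)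
    qed
    ultimately show ?case by auto
  next
    case (Suc q)
    note sl = slices[OF Suc.prems]
    note cs = card_shadow_slices[OF Suc.prems]
    have "shad (Suc m) (Suc q) (card A)
      \<le> max (shad (Suc m) (Suc q) (card (slice1 m A))) (card A) + shad m (Suc q) (card (slice0 m A))"
      using shad_slice[of "card (slice0 m A)" "card (slice1 m A)" m "Suc q" "Suc q"]
        cs(1) card_le_nmon[OF Suc.prems] card_le_nmon[OF sl(3)]
      by (simp add: add.commute)
    moreover have "shad (Suc m) (Suc q) (card (slice1 m A)) \<le> card (shadow (Suc m) (slice1 m A))"
      using Suc.IH[OF sl(2)] shad_Suc_indep[OF card_le_nmon[OF sl(2)]] by simp
    moreover have "shad m (Suc q) (card (slice0 m A)) \<le> card (shadow m (slice0 m A))"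
      using \<open>\<And>q A. A \<subseteq> mons m q \<Longrightarrow> _\<close>[OF sl(3)] .
    ultimately show ?case using cs card_shadow_slice_ge(1,2)[OF Suc.prems] by linarith
  qed
qed simp

definition macaulay_tight :: "nat \<Rightarrow> nat \<Rightarrow> (nat \<Rightarrow> nat) set \<Rightarrow> bool" where
  "macaulay_tight m q A \<longleftrightarrow> A \<subseteq> mons m q \<and> card (shadow m A) \<le> shad m q (card A)"

text \<open>Equality forces the part without the last variable to be tight. For the other part there are
  two cases, according to which argument of the maximum in \<open>shad_slice\<close> is attained.\<close>

lemma macaulay_tight_slices:
  assumes "macaulay_tight (Suc m) (Suc q) A"
  shows "macaulay_tight m (Suc q) (slice0 m A)"
    and "shadow (Suc m) (slice1 m A) \<subseteq> A \<or>
      macaulay_tight (Suc m) q (slice1 m A) \<and> slice0 m A \<subseteq> shadow (Suc m) (slice1 m A)"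
proof -
  have A: "A \<subseteq> mons (Suc m) (Suc q)" "card (shadow (Suc m) A) \<le> shad (Suc m) (Suc q) (card A)"
    using assms by (auto simp: macaulay_tight_def)
  note sl = slices[OF A(1)]
  note cs = card_shadow_slices[OF A(1)]
  note ge = card_shadow_slice_ge[OF A(1)]
  let ?U = "shadow (Suc m) (slice1 m A) \<union> slice0 m A"
  have *: "shad (Suc m) (Suc q) (card A)
      \<le> max (shad (Suc m) q (card (slice1 m A))) (card A) + shad m (Suc q) (card (slice0 m A))"
    using shad_slice[of "card (slice0 m A)" "card (slice1 m A)" m "Suc q" "Suc q"]
      cs(1) card_le_nmon[OF A(1)] card_le_nmon[OF sl(3)] shad_Suc_indep[OF card_le_nmon[OF sl(2)]]
    by (simp add: add.commute)
  have m1: "shad (Suc m) q (card (slice1 m A)) \<le> card (shadow (Suc m) (slice1 m A))"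
    by (rule macaulay[OF sl(2)])
  have m0: "shad m (Suc q) (card (slice0 m A)) \<le> card (shadow m (slice0 m A))"
    by (rule macaulay[OF sl(3)])
  show "macaulay_tight m (Suc q) (slice0 m A)"
    using sl(3) * A(2) cs(2) ge(1,2) m1 by (simp add: macaulay_tight_def)
  have "card ?U \<le> shad (Suc m) q (card (slice1 m A)) \<or> card ?U \<le> card A"
    using * A(2) cs(2) m0 by linarith
  then show "shadow (Suc m) (slice1 m A) \<subseteq> A \<or>
      macaulay_tight (Suc m) q (slice1 m A) \<and> slice0 m A \<subseteq> shadow (Suc m) (slice1 m A)"
  proof
    assume "card ?U \<le> card A"
    then have "A = ?U" by (rule card_seteq[OF ge(4,3)])
    then show ?thesis by blast
  next
    assume le: "card ?U \<le> shad (Suc m) q (card (slice1 m A))"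
    have "shadow (Suc m) (slice1 m A) = ?U"
      by (rule card_seteq[OF ge(4)]) (use le m1 in auto)
    moreover have "macaulay_tight (Suc m) q (slice1 m A)"
      using sl(2) le ge(1) by (simp add: macaulay_tight_def)
    ultimately show ?thesis by blast
  qed
qed

section \<open>Connectedness of sets of minimal growth\<close>

definition adj :: "(nat \<Rightarrow> nat) \<Rightarrow> (nat \<Rightarrow> nat) \<Rightarrow> bool" where
  "adj \<sigma> \<rho> \<longleftrightarrow> (\<exists>\<xi> a b. \<sigma> = inc a \<xi> \<and> \<rho> = inc b \<xi>)"

definition adj_within :: "(nat \<Rightarrow> nat) set \<Rightarrow> (nat \<Rightarrow> nat) \<Rightarrow> (nat \<Rightarrow> nat) \<Rightarrow> (nat \<Rightarrow> nat) \<Rightarrow> bool" where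
  "adj_within A \<tau> \<sigma> \<rho> \<longleftrightarrow> adj \<sigma> \<rho> \<and> {\<sigma>, \<rho>} \<subseteq> A \<and> \<sigma> \<le> \<tau> \<and> \<rho> \<le> \<tau>"

lemma adj_within_sym: "(adj_within A \<tau>)\<^sup>*\<^sup>* \<sigma> \<rho> \<Longrightarrow> (adj_within A \<tau>)\<^sup>*\<^sup>* \<rho> \<sigma>"
proof (rule sympD[OF symp_rtranclp])
  show "symp (adj_within A \<tau>)"
    by (rule sympI) (auto simp: adj_within_def adj_def)
qed

lemma adj_within_mono: "A \<subseteq> B \<Longrightarrow> (adj_within A \<tau>)\<^sup>*\<^sup>* \<sigma> \<rho> \<Longrightarrow> (adj_within B \<tau>)\<^sup>*\<^sup>* \<sigma> \<rho>"
  by (rule rtranclp_mono[THEN predicate2D]) (auto simp: adj_within_def)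

lemma adj_within_inc:
  assumes "(adj_within A \<tau>)\<^sup>*\<^sup>* \<sigma> \<rho>" "inc k ` A \<subseteq> B" "inc k \<tau> \<le> \<tau>'"
  shows "(adj_within B \<tau>')\<^sup>*\<^sup>* (inc k \<sigma>) (inc k \<rho>)"
  using assms(1)
proof (induction rule: rtranclp_induct)
  case (step \<rho> \<zeta>)
  have "adj_within B \<tau>' (inc k \<rho>) (inc k \<zeta>)"
    unfolding adj_within_def
  proof (intro conjI)
    show "adj (inc k \<rho>) (inc k \<zeta>)"
      using step.hyps(2) unfolding adj_within_def adj_def by (metis inc_commute)
    show "{inc k \<rho>, inc k \<zeta>} \<subseteq> B" using step.hyps(2) assms(2) by (auto simp: adj_within_def)
    show "inc k \<rho> \<le> \<tau>'" "inc k \<zeta> \<le> \<tau>'"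
      using step.hyps(2) by (auto simp: adj_within_def intro: order.trans[OF inc_mono assms(3)])
  qed
  then show ?case using step.IH by simp
qed simp

text \<open>The combinatorial substitute for Gotzmann's persistence theorem: an ideal of minimal growth
  from degree \<open>q\<close> to \<open>q + 1\<close> has no minimal syzygies above degree \<open>q + 1\<close>.\<close>

theorem macaulay_tight_connected:
  assumes "macaulay_tight m q A" "\<sigma> \<in> A" "\<rho> \<in> A" "\<sigma> \<le> \<tau>" "\<rho> \<le> \<tau>"
  shows "(adj_within A \<tau>)\<^sup>*\<^sup>* \<sigma> \<rho>"
  using assms
proof (induction m arbitrary: q A \<sigma> \<rho> \<tau>)
  case 0
  then have "\<sigma> \<in> mons 0 q" "\<rho> \<in> mons 0 q" by (auto simp: macaulay_tight_def)
  then have "\<sigma> = \<rho>" by (cases q) (auto simp: mons_0 mons_left_0)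
  then show ?case by simp
next
  case (Suc m)
  note IHm = Suc.IH
  show ?case using Suc.prems
  proof (induction q arbitrary: A \<sigma> \<rho> \<tau>)
    case 0
    then have "\<sigma> = \<rho>" by (auto simp: macaulay_tight_def mons_0)
    then show ?case by simp
  next
    case (Suc q)
    let ?v = "Suc m"
    have A: "A \<subseteq> mons (Suc m) (Suc q)" using Suc.prems by (simp add: macaulay_tight_def)
    note sl = slices[OF A]
    note tight = macaulay_tight_slices[OF Suc.prems(1)]
    have conn0: "(adj_within A \<tau>)\<^sup>*\<^sup>* \<sigma> \<rho>"
      if "\<sigma> \<in> A" "\<rho> \<in> A" "\<sigma> ?v = 0" "\<rho> ?v = 0" "\<sigma> \<le> \<tau>" "\<rho> \<le> \<tau>" for \<sigma> \<rho>
    proof -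
      have "(adj_within (slice0 m A) \<tau>)\<^sup>*\<^sup>* \<sigma> \<rho>"
        by (rule IHm[OF tight(1)]) (use that in \<open>auto simp: slice0_def\<close>)
      then show ?thesis by (rule adj_within_mono[rotated]) (auto simp: slice0_def)
    qed
    from tight(2) show ?case
    proof
      assume sub: "shadow (Suc m) (slice1 m A) \<subseteq> A"
      \<comment> \<open>The last variable is exchanged for others until it is used up or no other
        variable has room below \<open>\<tau>\<close>. Each exchange stays in \<open>A\<close>
        because the shadow of \<open>slice1\<close> does.\<close>
      have descend: "\<exists>\<beta>\<in>A. \<beta> \<le> \<tau> \<and> (adj_within A \<tau>)\<^sup>*\<^sup>* \<alpha> \<beta> \<and>
          (\<beta> ?v = 0 \<or> (\<forall>k\<in>{1..m}. \<beta> k = \<tau> k))" if "\<alpha> \<in> A" "\<alpha> \<le> \<tau>" for \<alpha>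
        using that
      proof (induction "\<alpha> ?v" arbitrary: \<alpha>)
        case 0
        then show ?case by (metis rtranclp.rtrancl_refl)
      next
        case (Suc n)
        show ?case
        proof (cases "\<forall>k\<in>{1..m}. \<alpha> k = \<tau> k")
          case True
          then show ?thesis using Suc.prems by (metis rtranclp.rtrancl_refl)
        next
          case False
          then obtain b where b: "b \<in> {1..m}" "\<alpha> b < \<tau> b"
            using Suc.prems(2) by (metis le_fun_def le_neq_implies_less)
          obtain \<xi> where xi: "\<alpha> = inc ?v \<xi>" using ex_inc[of \<alpha> ?v] Suc.hyps(2) by auto
          have le: "inc b \<xi> \<le> \<tau>"
            by (rule inc_le) (use order.trans[OF le_inc, of ?v \<xi> \<tau>] Suc.prems(2) b xi in \<open>auto simp: inc_apply\<close>)
          have mem: "inc b \<xi> \<in> A"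
            by (rule subsetD[OF sub]) (use Suc.prems(1) b xi in \<open>auto simp: shadow_def slice1_def\<close>)
          have "inc b \<xi> ?v = n" using Suc.hyps(2) xi b by (auto simp: inc_apply)
          from Suc.hyps(1)[OF this[symmetric] mem le] obtain \<beta> where \<beta>:
            "\<beta> \<in> A" "\<beta> \<le> \<tau>" "(adj_within A \<tau>)\<^sup>*\<^sup>* (inc b \<xi>) \<beta>"
            "\<beta> ?v = 0 \<or> (\<forall>k\<in>{1..m}. \<beta> k = \<tau> k)" by blast
          have "adj_within A \<tau> \<alpha> (inc b \<xi>)"
            using Suc.prems mem le xi by (auto simp: adj_within_def adj_def)
          then show ?thesis using \<beta> by (metis converse_rtranclp_into_rtranclp)
        qed
      qed
      obtain \<sigma>' where s: "\<sigma>' \<in> A" "\<sigma>' \<le> \<tau>" "(adj_within A \<tau>)\<^sup>*\<^sup>* \<sigma> \<sigma>'"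
        "\<sigma>' ?v = 0 \<or> (\<forall>k\<in>{1..m}. \<sigma>' k = \<tau> k)"
        using descend Suc.prems by blast
      obtain \<rho>' where r: "\<rho>' \<in> A" "\<rho>' \<le> \<tau>" "(adj_within A \<tau>)\<^sup>*\<^sup>* \<rho> \<rho>'"
        "\<rho>' ?v = 0 \<or> (\<forall>k\<in>{1..m}. \<rho>' k = \<tau> k)"
        using descend Suc.prems by blast
      have deg: "vdeg m \<sigma>' + \<sigma>' ?v = Suc q" "vdeg m \<rho>' + \<rho>' ?v = Suc q"
        using A s(1) r(1) by (auto simp: mons_def vdeg_Suc)
      have full: "vdeg m \<beta> = vdeg m \<tau>" if "\<forall>k\<in>{1..m}. \<beta> k = \<tau> k" for \<beta>
        using that by (auto simp: vdeg_def)
      have les: "vdeg m \<sigma>' \<le> vdeg m \<tau>" "vdeg m \<rho>' \<le> vdeg m \<tau>"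
        using s(2) r(2) vdeg_mono by auto
      \<comment> \<open>A saturated endpoint that still contains the last variable shows that
        \<open>\<tau>\<close> has degree below \<open>Suc q\<close> in the other variables. Then the
        other endpoint contains the last variable too, so both are saturated, and equal by
        degree.\<close>
      have "(\<sigma>' ?v = 0 \<and> \<rho>' ?v = 0) \<or> \<sigma>' = \<rho>'"
      proof (cases "\<sigma>' ?v = 0 \<and> \<rho>' ?v = 0")
        case False
        have fs: "\<forall>k\<in>{1..m}. \<sigma>' k = \<tau> k"
        proof (cases "\<sigma>' ?v = 0")
          case True
          then have "\<rho>' ?v \<noteq> 0" using False by simp
          then have "vdeg m \<rho>' = vdeg m \<tau>" using r(4) full[of \<rho>'] by simp
          then show ?thesis using True \<open>\<rho>' ?v \<noteq> 0\<close> deg les by linarith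
        qed (use s(4) in simp)
        have fr: "\<forall>k\<in>{1..m}. \<rho>' k = \<tau> k"
        proof (cases "\<rho>' ?v = 0")
          case True
          then have "\<sigma>' ?v \<noteq> 0" using False by simp
          then have "vdeg m \<sigma>' = vdeg m \<tau>" using s(4) full[of \<sigma>'] by simp
          then show ?thesis using True \<open>\<sigma>' ?v \<noteq> 0\<close> deg les by linarith
        qed (use r(4) in simp)
        then have "vdeg m \<sigma>' = vdeg m \<rho>'" using fs fr full[of \<sigma>'] full[of \<rho>'] by simp
        then have "\<sigma>' ?v = \<rho>' ?v" using deg by simp
        then have "\<sigma>' = \<rho>'"
          using fs fr A s(1) r(1) by (intro NN_ext[of _ "Suc m"]) (auto simp: mons_def le_Suc_eq)
        then show ?thesis ..
      qed simp
      then have "(adj_within A \<tau>)\<^sup>*\<^sup>* \<sigma>' \<rho>'" using conn0 s r by auto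
      then show ?thesis using s(3) adj_within_sym[OF r(3)] by (meson rtranclp_trans)
    next
      assume t1: "macaulay_tight (Suc m) q (slice1 m A) \<and>
        slice0 m A \<subseteq> shadow (Suc m) (slice1 m A)"
      show ?thesis
      proof (cases "\<tau> ?v")
        case 0
        then have "\<sigma> ?v = 0" "\<rho> ?v = 0" using Suc.prems(4,5) by (metis le_fun_def le_zero_eq)+
        then show ?thesis using conn0 Suc.prems by blast
      next
        case (Suc t)
        then obtain \<tau>' where \<tau>': "\<tau> = inc ?v \<tau>'" using ex_inc[of \<tau> ?v] by auto
        \<comment> \<open>A monomial of \<open>A\<close> without the last variable is now in the
          shadow of \<open>slice1\<close>, so one exchange makes it divisible by that variable. What
          remains is connectedness of \<open>slice1\<close>, one degree lower.\<close>
        have ascend: "\<exists>\<xi>\<in>slice1 m A. \<xi> \<le> \<tau>' \<and> (adj_within A \<tau>)\<^sup>*\<^sup>* \<alpha> (inc ?v \<xi>)"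
          if \<alpha>: "\<alpha> \<in> A" "\<alpha> \<le> \<tau>" for \<alpha>
        proof (cases "\<alpha> ?v = 0")
          case False
          then obtain \<xi> where "\<alpha> = inc ?v \<xi>" using ex_inc by blast
          moreover from this have "\<xi> \<le> \<tau>'"
            using \<alpha>(2) \<tau>' by simp
          ultimately show ?thesis using \<alpha> by (auto simp: slice1_def)
        next
          case True
          then have "\<alpha> \<in> shadow (Suc m) (slice1 m A)" using t1 \<alpha> by (auto simp: slice0_def)
          then obtain b \<xi> where b: "\<alpha> = inc b \<xi>" "\<xi> \<in> slice1 m A" by (auto simp: shadow_def)
          have le: "\<xi> \<le> \<tau>'"
            by (rule le_inc_cancel[where k = ?v])
               (use \<alpha>(2) \<tau>' True b(1) order.trans[OF le_inc, of b \<xi> \<tau>] in \<open>auto simp: inc_apply split: if_splits\<close>)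
          then have "adj_within A \<tau> \<alpha> (inc ?v \<xi>)"
            using \<alpha> b \<tau>' inc_mono[of \<xi> \<tau>' ?v] by (auto simp: adj_within_def adj_def slice1_def)
          then show ?thesis using b le by blast
        qed
        obtain \<xi> where xi: "\<xi> \<in> slice1 m A" "\<xi> \<le> \<tau>'" "(adj_within A \<tau>)\<^sup>*\<^sup>* \<sigma> (inc ?v \<xi>)"
          using ascend Suc.prems by blast
        obtain \<zeta> where ze: "\<zeta> \<in> slice1 m A" "\<zeta> \<le> \<tau>'" "(adj_within A \<tau>)\<^sup>*\<^sup>* \<rho> (inc ?v \<zeta>)"
          using ascend Suc.prems by blast
        have "(adj_within (slice1 m A) \<tau>')\<^sup>*\<^sup>* \<xi> \<zeta>"
          by (rule Suc.IH) (use t1 xi ze in auto)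
        then have "(adj_within A \<tau>)\<^sup>*\<^sup>* (inc ?v \<xi>) (inc ?v \<zeta>)"
          by (rule adj_within_inc) (auto simp: slice1_def \<tau>')
        then show ?thesis using xi(3) adj_within_sym[OF ze(3)] by (meson rtranclp_trans)
      qed
    qed
  qed
qed

section \<open>The connectivity condition and the growth of ideals\<close>

definition antichain :: "(nat \<Rightarrow> nat) set \<Rightarrow> bool" where
  "antichain E \<longleftrightarrow> (\<forall>\<eta>\<in>E. \<forall>\<zeta>\<in>E. \<eta> \<le> \<zeta> \<longrightarrow> \<eta> = \<zeta>)"

definition upset :: "nat \<Rightarrow> (nat \<Rightarrow> nat) set \<Rightarrow> nat \<Rightarrow> (nat \<Rightarrow> nat) set" where
  "upset m E q = {\<xi> \<in> mons m q. \<exists>\<eta>\<in>E. \<eta> \<le> \<xi>}"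

lemma upset_subset: "upset m E q \<subseteq> mons m q"
  by (auto simp: upset_def)

lemma finite_upset [simp]: "finite (upset m E q)"
  using upset_subset finite_subset finite_mons by metis

lemma shadow_upset: "shadow m (upset m E q) \<subseteq> upset m E (Suc q)"
  by (auto simp: shadow_def upset_def inc_in_mons intro: order.trans[OF _ le_inc])

lemma degree_part_subset_upset: "E \<subseteq> NN m \<Longrightarrow> {\<eta> \<in> E. vdeg m \<eta> = q} \<subseteq> upset m E q"
  by (auto simp: upset_def mons_def)

lemma card_degree_0_le: "E \<subseteq> NN m \<Longrightarrow> card {\<eta> \<in> E. vdeg m \<eta> = 0} \<le> card (upset m E 0)"
  by (rule card_mono[OF finite_upset degree_part_subset_upset])

lemma shadow_upset_disjoint:
  assumes "antichain E"
  shows "shadow m (upset m E q) \<inter> {\<eta> \<in> E. vdeg m \<eta> = Suc q} = {}"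
proof -
  have False if xi: "\<xi> \<in> upset m E q" "inc k \<xi> \<in> E" "k \<in> {1..m}" for k \<xi>
  proof -
    obtain \<eta> where eta: "\<eta> \<in> E" "\<eta> \<le> \<xi>" "vdeg m \<xi> = q"
      using xi(1) by (auto simp: upset_def mons_def)
    then have "\<eta> = inc k \<xi>"
      using assms xi(2) order.trans[OF eta(2) le_inc] unfolding antichain_def by blast
    then have "inc k \<xi> \<le> \<xi>" using eta by simp
    from vdeg_mono[OF this, of m] vdeg_inc[OF xi(3), of \<xi>] show False by simp
  qed
  then show ?thesis unfolding shadow_def by blast
qed

lemma card_upset_Suc:
  assumes "antichain E" "E \<subseteq> NN m"
  shows "card (shadow m (upset m E q)) + card {\<eta> \<in> E. vdeg m \<eta> = Suc q} \<le> card (upset m E (Suc q))"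
    and "shad m q (card (upset m E q)) + card {\<eta> \<in> E. vdeg m \<eta> = Suc q} \<le> card (upset m E (Suc q))"
proof -
  have sub: "{\<eta> \<in> E. vdeg m \<eta> = Suc q} \<subseteq> upset m E (Suc q)"
    by (rule degree_part_subset_upset[OF assms(2)])
  have "card (shadow m (upset m E q)) + card {\<eta> \<in> E. vdeg m \<eta> = Suc q}
      = card (shadow m (upset m E q) \<union> {\<eta> \<in> E. vdeg m \<eta> = Suc q})"
    by (rule card_Un_disjoint[symmetric])
       (use finite_subset[OF sub finite_upset] shadow_upset_disjoint[OF assms(1)] in
         \<open>auto intro: finite_shadow\<close>)
  also have "\<dots> \<le> card (upset m E (Suc q))"
    by (rule card_mono) (use sub shadow_upset in auto)
  finally show *: "card (shadow m (upset m E q)) + card {\<eta> \<in> E. vdeg m \<eta> = Suc q}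
      \<le> card (upset m E (Suc q))" .
  then show "shad m q (card (upset m E q)) + card {\<eta> \<in> E. vdeg m \<eta> = Suc q} \<le> card (upset m E (Suc q))"
    using macaulay[OF upset_subset, of m q E] by simp
qed

lemma ex_mons_between:
  assumes "\<eta> \<le> \<tau>" "\<tau> \<in> NN m" "vdeg m \<eta> \<le> q" "q \<le> vdeg m \<tau>"
  shows "\<exists>\<sigma>\<in>mons m q. \<eta> \<le> \<sigma> \<and> \<sigma> \<le> \<tau>"
  using assms
proof (induction "q - vdeg m \<eta>" arbitrary: \<eta>)
  case 0
  then show ?case using NN_le[OF 0(2,3)] by (auto simp: mons_def)
next
  case (Suc d)
  have "\<exists>k\<in>{1..m}. \<eta> k < \<tau> k"
  proof (rule ccontr)
    assume "\<not> ?thesis"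
    then have "vdeg m \<tau> \<le> vdeg m \<eta>" unfolding vdeg_def by (intro sum_mono) (simp add: not_less)
    then show False using Suc by simp
  qed
  then obtain k where k: "k \<in> {1..m}" "\<eta> k < \<tau> k" by blast
  have "\<exists>\<sigma>\<in>mons m q. inc k \<eta> \<le> \<sigma> \<and> \<sigma> \<le> \<tau>"
  proof (rule Suc.hyps(1))
    show "inc k \<eta> \<le> \<tau>" by (rule inc_le[OF Suc.prems(1) k(2)])
    show "d = q - vdeg m (inc k \<eta>)" "vdeg m (inc k \<eta>) \<le> q"
      using Suc.hyps(2) vdeg_inc[OF k(1), of \<eta>] by simp_all
  qed (rule Suc.prems)+
  then obtain \<sigma> where s: "\<sigma> \<in> mons m q" "inc k \<eta> \<le> \<sigma>" "\<sigma> \<le> \<tau>" by blast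
  have "\<eta> \<le> \<sigma>" by (rule order.trans[OF le_inc s(2)])
  then show ?case using s by blast
qed

lemma NN_support: "\<xi> \<in> NN m \<Longrightarrow> \<xi> k \<noteq> 0 \<Longrightarrow> k \<in> {1..m}"
  by (rule ccontr) (simp add: NN_def)

lemma NN_sup: "\<xi> \<in> NN m \<Longrightarrow> \<eta> \<in> NN m \<Longrightarrow> sup \<xi> \<eta> \<in> NN m"
  by (auto simp: NN_def)

lemma below_diff_iff: "below_diff \<eta> \<tau> k \<longleftrightarrow> inc k \<eta> \<le> \<tau>"
proof -
  have "int (\<eta> x) \<le> int (\<tau> x) - int (unit_vec k x) \<longleftrightarrow> inc k \<eta> x \<le> \<tau> x" for x
    by (auto simp: unit_vec_def inc_apply)
  then show ?thesis by (simp add: below_diff_def le_fun_def)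
qed

lemma adj_vdeg_sup:
  assumes "adj \<sigma> \<rho>" "\<sigma> \<in> mons m q" "\<rho> \<in> mons m q"
  shows "vdeg m (sup \<sigma> \<rho>) \<le> Suc q"
proof -
  obtain \<xi> a b where ab: "\<sigma> = inc a \<xi>" "\<rho> = inc b \<xi>" using assms(1) by (auto simp: adj_def)
  have "\<sigma> a \<noteq> 0" "\<rho> b \<noteq> 0" using ab by (auto simp: inc_apply)
  then have mem: "a \<in> {1..m}" "b \<in> {1..m}"
    using assms(2,3) NN_support by (auto simp only: mons_def mem_Collect_eq)
  have "sup \<sigma> \<rho> \<le> inc b \<sigma>"
    unfolding ab by (rule sup_least) (rule le_inc, rule inc_mono[OF le_inc])
  then have "vdeg m (sup \<sigma> \<rho>) \<le> vdeg m (inc b \<sigma>)" by (rule vdeg_mono)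
  then show ?thesis using vdeg_inc[OF mem(2), of \<sigma>] assms(2) by (simp add: mons_def)
qed

section \<open>Failures of the connectivity condition\<close>

definition component :: "((nat \<Rightarrow> nat) \<times> nat) list \<Rightarrow> nat \<Rightarrow> (nat \<Rightarrow> nat) set" where
  "component \<alpha>s l = {\<eta>. (\<eta>, l) \<in> set \<alpha>s}"

lemma antichain_seq_component:
  assumes "antichain_seq m n \<alpha>s"
  shows "component \<alpha>s l \<subseteq> NN m" "antichain (component \<alpha>s l)" "\<eta> \<in> component \<alpha>s l \<Longrightarrow> l \<in> {1..n}" "distinct \<alpha>s"
proof -
  have sub: "set \<alpha>s \<subseteq> NNn m n" and
    sw: "sorted_wrt (\<lambda>\<alpha> \<beta>. \<not> ple \<alpha> \<beta> \<and> \<not> ple \<beta> \<alpha>) \<alpha>s"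
    using assms by (auto simp: antichain_seq_def)
  show "component \<alpha>s l \<subseteq> NN m" "\<eta> \<in> component \<alpha>s l \<Longrightarrow> l \<in> {1..n}"
    using sub by (auto simp: component_def NNn_def)
  show "antichain (component \<alpha>s l)" unfolding antichain_def
  proof (intro ballI impI, rule ccontr)
    fix \<eta> \<zeta> assume *: "\<eta> \<in> component \<alpha>s l" "\<zeta> \<in> component \<alpha>s l" "\<eta> \<le> \<zeta>" "\<eta> \<noteq> \<zeta>"
    then obtain i j where ij: "i < length \<alpha>s" "j < length \<alpha>s" "\<alpha>s ! i = (\<eta>, l)" "\<alpha>s ! j = (\<zeta>, l)"
      by (auto simp: component_def in_set_conv_nth)
    then have "i < j \<or> j < i" using *(4) by (metis nat_neq_iff prod.inject)
    then show False
      using sorted_wrt_nth_less[OF sw, of i j] sorted_wrt_nth_less[OF sw, of j i] ij *(3)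
      by (auto simp: ple_def)
  qed
  have "irreflp (\<lambda>\<alpha> \<beta>. \<not> ple \<alpha> \<beta> \<and> \<not> ple \<beta> \<alpha>)" by (auto simp: irreflp_def ple_def)
  then show "distinct \<alpha>s"
    unfolding distinct_conv_nth
    using sorted_wrt_nth_less[OF sw] by (metis (no_types, lifting) nat_neq_iff order.refl ple_def)
qed

lemma mem_Gam_seq:
  assumes "antichain_seq m n \<alpha>s"
  shows "(\<eta>, l) \<in> Gam_seq m n \<alpha>s p \<longleftrightarrow> \<eta> \<in> component \<alpha>s l \<and> vdeg m \<eta> \<le> p"
  using assms by (auto simp: Gam_seq_def Gam_def component_def pdeg_def antichain_seq_def)

text \<open>In a chain of adjacent monomials of degree \<open>q\<close>, each is replaced by an
  element of \<open>E\<close> below it. Adjacent monomials have a least upper bound of degree at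
  most \<open>Suc q\<close>, and smaller elements only lower it.\<close>

lemma tight_path:
  assumes tight: "macaulay_tight m q (upset m E q)"
    and ij: "i \<in> {1..m}" "j \<in> {1..m}" and \<tau>: "\<tau> \<in> NN m" "Suc q < vdeg m \<tau>"
    and \<beta>1: "\<beta>1 \<in> E" "vdeg m \<beta>1 \<le> q" "inc i \<beta>1 \<le> \<tau>"
    and \<beta>2: "\<beta>2 \<in> E" "vdeg m \<beta>2 \<le> q" "inc j \<beta>2 \<le> \<tau>"
  obtains s \<eta> k where "1 \<le> (s::nat)"
    "\<forall>x\<in>{1..s}. \<eta> x \<in> E \<and> vdeg m (\<eta> x) \<le> q \<and> k x \<in> {1..m} \<and> inc (k x) (\<eta> x) \<le> \<tau>"
    "k 1 = i" "k s = j" "\<forall>x\<in>{1..<s}. vdeg m (sup (\<eta> x) (\<eta> (x + 1))) \<le> Suc q"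
proof -
  let ?A = "upset m E q"
  have start: "\<exists>\<sigma>\<in>?A. inc k \<sigma> \<le> \<tau>" if "\<beta> \<in> E" "vdeg m \<beta> \<le> q" "inc k \<beta> \<le> \<tau>" "k \<in> {1..m}" for \<beta> k
  proof -
    have "0 < \<tau> k" using that(3) by (metis inc_apply le_fun_def less_le_trans zero_less_Suc)
    then obtain \<tau>' where t: "\<tau> = inc k \<tau>'" using ex_inc by blast
    have "\<exists>\<sigma>\<in>mons m q. \<beta> \<le> \<sigma> \<and> \<sigma> \<le> \<tau>'"
      by (rule ex_mons_between)
         (use that t \<tau> NN_inc[OF that(4)] vdeg_inc[OF that(4)] in auto)
    then show ?thesis using that(1) t by (auto simp: upset_def)
  qed
  obtain \<sigma> where s: "\<sigma> \<in> ?A" "inc i \<sigma> \<le> \<tau>" using start[OF \<beta>1 ij(1)] by blast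
  obtain \<rho> where r: "\<rho> \<in> ?A" "inc j \<rho> \<le> \<tau>" using start[OF \<beta>2 ij(2)] by blast
  have le: "\<sigma> \<le> \<tau>" "\<rho> \<le> \<tau>" by (rule order.trans[OF le_inc s(2)], rule order.trans[OF le_inc r(2)])
  have "(adj_within ?A \<tau>)\<^sup>*\<^sup>* \<sigma> \<rho>" by (rule macaulay_tight_connected[OF tight s(1) r(1) le])
  then obtain N f where f: "f 0 = \<sigma>" "f N = \<rho>" "\<And>x. x < N \<Longrightarrow> adj_within ?A \<tau> (f x) (f (Suc x))"
    by (auto dest!: rtranclp_imp_relpowp simp: relpowp_fun_conv)
  have fA: "f x \<in> ?A \<and> f x \<le> \<tau>" if "x \<le> N" for x
    using that f(1,2) f(3)[of x] r(1) le(2) by (cases "x = N") (auto simp: adj_within_def)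
  have "\<forall>x. \<exists>h. x \<le> N \<longrightarrow> h \<in> E \<and> h \<le> f x"
    using fA by (auto simp: upset_def)
  then obtain h where h: "\<And>x. x \<le> N \<Longrightarrow> h x \<in> E \<and> h x \<le> f x" by metis
  have "\<exists>k. k \<in> {1..m} \<and> inc k (f x) \<le> \<tau>" if "x \<le> N" for x
  proof -
    have fx: "f x \<le> \<tau>" "vdeg m (f x) = q" using fA[OF that] by (auto simp: upset_def mons_def)
    have "\<exists>k\<in>{1..m}. f x k < \<tau> k"
    proof (rule ccontr)
      assume "\<not> ?thesis"
      then have "vdeg m \<tau> \<le> vdeg m (f x)" unfolding vdeg_def by (intro sum_mono) (simp add: not_less)
      then show False using fx \<tau> by simp
    qed
    then show ?thesis using inc_le[OF fx(1)] by blast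
  qed
  then obtain \<kappa> where \<kappa>: "\<And>x. x \<le> N \<Longrightarrow> \<kappa> x \<in> {1..m} \<and> inc (\<kappa> x) (f x) \<le> \<tau>" by metis
  \<comment> \<open>Positions count from 1, and position \<open>N + 2\<close> repeats the last
    monomial. Thus the first and the last position differ even for \<open>N = 0\<close> and can
    carry the two indices \<open>i\<close> and \<open>j\<close>.\<close>
  define g where "g x = min (x - 1) N" for x
  define k where "k x = (if x = 1 then i else if x = N + 2 then j else \<kappa> (g x))" for x
  have g: "g x \<le> N" for x by (simp add: g_def)
  have deg: "vdeg m (f x) = q" if "x \<le> N" for x
    using fA[OF that] by (simp add: upset_def mons_def)
  have below: "k x \<in> {1..m} \<and> inc (k x) (f (g x)) \<le> \<tau>" for x
    using \<kappa>[OF g, of x] ij s(2) r(2) f(1,2) by (auto simp: k_def g_def)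
  show thesis
  proof (rule that[of "N + 2" "\<lambda>x. h (g x)" k]; (intro conjI ballI)?)
    fix x assume "x \<in> {1..N + 2}"
    show "h (g x) \<in> E" "k x \<in> {1..m}" using h[OF g] below by auto
    show "vdeg m (h (g x)) \<le> q" using h[OF g, of x] deg[OF g, of x] vdeg_mono by metis
    show "inc (k x) (h (g x)) \<le> \<tau>"
      using h[OF g, of x] below[of x] inc_mono order.trans by blast
  next
    fix x assume x: "x \<in> {1..<N + 2}"
    have "vdeg m (sup (f (g x)) (f (g (x + 1)))) \<le> Suc q"
    proof (cases "x \<le> N")
      case True
      then have "adj_within ?A \<tau> (f (x - 1)) (f (Suc (x - 1)))"
        using x by (intro f(3)) auto
      then have "adj (f (x - 1)) (f (Suc (x - 1)))" "f (x - 1) \<in> mons m q" "f (Suc (x - 1)) \<in> mons m q"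
        using upset_subset by (auto simp: adj_within_def)
      moreover have "g x = x - 1" "g (x + 1) = Suc (x - 1)" using True x by (auto simp: g_def)
      ultimately show ?thesis using adj_vdeg_sup by simp
    next
      case False
      then have "g x = N" "g (x + 1) = N" using x by (auto simp: g_def)
      then show ?thesis using deg[of N] by simp
    qed
    moreover have "sup (h (g x)) (h (g (x + 1))) \<le> sup (f (g x)) (f (g (x + 1)))"
      using h[OF g] by (intro sup_mono) auto
    ultimately show "vdeg m (sup (h (g x)) (h (g (x + 1)))) \<le> Suc q"
      using vdeg_mono order.trans by blast
  qed (auto simp: k_def)
qed

text \<open>If the ideal of the failing component grew only by Macaulay's bound into degree
  \<open>p\<close>, no generator would have degree \<open>p\<close> and \<open>tight_path\<close>
  would supply the missing path. The two distinct elements come from the least upper bound; they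
  make the first failure of a component cost two.\<close>

lemma not_D_cond_growth:
  assumes seq: "antichain_seq m n \<alpha>s" and nD: "\<not> D_cond m n \<alpha>s p"
  shows "\<exists>l\<in>{1..n}. (\<exists>\<eta> \<zeta>. {\<eta>, \<zeta>} \<subseteq> component \<alpha>s l \<and> \<eta> \<noteq> \<zeta> \<and> vdeg m \<eta> \<le> p \<and> vdeg m \<zeta> \<le> p) \<and>
    (\<forall>q. p = Suc q \<longrightarrow> shad m q (card (upset m (component \<alpha>s l) q)) < card (upset m (component \<alpha>s l) p))"
proof -
  note mem = mem_Gam_seq[OF seq]
  obtain \<tau> l i j where \<tau>: "(\<tau>, l) \<in> lubs (Gam_seq m n \<alpha>s p) - Gam m n p"
    and ij: "1 \<le> i" "i < j" "j \<le> m"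
    and \<beta>: "\<exists>\<beta>1. (\<beta>1, l) \<in> Gam_seq m n \<alpha>s p \<and> below_diff \<beta>1 \<tau> i"
      "\<exists>\<beta>2. (\<beta>2, l) \<in> Gam_seq m n \<alpha>s p \<and> below_diff \<beta>2 \<tau> j"
    and nopath: "\<nexists>(s::nat) \<eta> k. 1 \<le> s \<and>
             (\<forall>q\<in>{1..s}. (\<eta> q, l) \<in> Gam_seq m n \<alpha>s p \<and> k q \<in> {1..m} \<and>
                below_diff (\<eta> q) \<tau> (k q)) \<and>
             k 1 = i \<and> k s = j \<and>
             (\<forall>q\<in>{1..<s}. vdeg m (sup (\<eta> q) (\<eta> (q + 1))) \<le> p)"
    using nD unfolding D_cond_def by blast
  let ?E = "component \<alpha>s l"
  note E = antichain_seq_component(1,2)[OF seq, of l]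
  obtain \<eta> \<zeta> where ez: "\<tau> = sup \<eta> \<zeta>" "\<eta> \<noteq> \<zeta>" "\<eta> \<in> ?E" "\<zeta> \<in> ?E" "vdeg m \<eta> \<le> p" "vdeg m \<zeta> \<le> p"
    using \<tau> unfolding lubs_def by (auto simp: mem)
  have l: "l \<in> {1..n}" using antichain_seq_component(3)[OF seq] ez(3) by blast
  have NN: "\<tau> \<in> NN m" using ez(1,3,4) E(1) NN_sup by blast
  have deg: "p < vdeg m \<tau>" using \<tau> NN l by (auto simp: Gam_def NNn_def pdeg_def)
  have "shad m q (card (upset m ?E q)) < card (upset m ?E p)" if p: "p = Suc q" for q
  proof (rule ccontr)
    assume "\<not> ?thesis"
    then have le: "card (upset m ?E (Suc q)) \<le> shad m q (card (upset m ?E q))" using p by simp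
    note ge = card_upset_Suc[OF E(2,1), of q]
    have "card {\<eta> \<in> ?E. vdeg m \<eta> = Suc q} = 0" using ge(2) le by simp
    moreover have "finite {\<eta> \<in> ?E. vdeg m \<eta> = Suc q}"
      by (rule finite_subset[OF degree_part_subset_upset[OF E(1)] finite_upset])
    ultimately have none: "vdeg m \<eta> \<noteq> Suc q" if "\<eta> \<in> ?E" for \<eta> using that by auto
    have tight: "macaulay_tight m q (upset m ?E q)"
      using ge(1) le upset_subset by (simp add: macaulay_tight_def)
    obtain \<beta>1 where b1: "\<beta>1 \<in> ?E" "vdeg m \<beta>1 \<le> p" "inc i \<beta>1 \<le> \<tau>"
      using \<beta>(1) by (auto simp: mem below_diff_iff)
    obtain \<beta>2 where b2: "\<beta>2 \<in> ?E" "vdeg m \<beta>2 \<le> p" "inc j \<beta>2 \<le> \<tau>"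
      using \<beta>(2) by (auto simp: mem below_diff_iff)
    have small: "vdeg m \<beta>1 \<le> q" "vdeg m \<beta>2 \<le> q"
      using none[OF b1(1)] none[OF b2(1)] b1(2) b2(2) p by auto
    have i: "i \<in> {1..m}" and j: "j \<in> {1..m}" using ij by auto
    obtain s \<eta>' k where path: "1 \<le> (s::nat)"
      "\<forall>x\<in>{1..s}. \<eta>' x \<in> ?E \<and> vdeg m (\<eta>' x) \<le> q \<and> k x \<in> {1..m} \<and> inc (k x) (\<eta>' x) \<le> \<tau>"
      "k 1 = i" "k s = j" "\<forall>x\<in>{1..<s}. vdeg m (sup (\<eta>' x) (\<eta>' (x + 1))) \<le> Suc q"
      by (rule tight_path[OF tight i j NN deg[unfolded p] b1(1) small(1) b1(3) b2(1) small(2) b2(3)])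
        (erule (4) that)
    have "(\<forall>x\<in>{1..s}. (\<eta>' x, l) \<in> Gam_seq m n \<alpha>s p \<and> k x \<in> {1..m} \<and> below_diff (\<eta>' x) \<tau> (k x))"
      using path(2) p by (auto simp: mem below_diff_iff)
    then show False using nopath path p by blast
  qed
  then show ?thesis using l ez by blast
qed

lemma D_condD:
  assumes "D_cond m n \<alpha>s p" "(\<tau>, l) \<in> lubs (Gam_seq m n \<alpha>s p) - Gam m n p"
    "1 \<le> i" "i < j" "j \<le> m"
    "(\<beta>1, l) \<in> Gam_seq m n \<alpha>s p" "below_diff \<beta>1 \<tau> i"
    "(\<beta>2, l) \<in> Gam_seq m n \<alpha>s p" "below_diff \<beta>2 \<tau> j"
  obtains s \<eta> k where "1 \<le> (s::nat)"
    "\<forall>q\<in>{1..s}. (\<eta> q, l) \<in> Gam_seq m n \<alpha>s p \<and> k q \<in> {1..m} \<and> below_diff (\<eta> q) \<tau> (k q)"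
    "k 1 = i" "k s = j" "\<forall>q\<in>{1..<s}. vdeg m (sup (\<eta> q) (\<eta> (q + 1))) \<le> p"
proof -
  have prem: "(\<tau>, l) \<in> lubs (Gam_seq m n \<alpha>s p) - Gam m n p \<and> 1 \<le> i \<and> i < j \<and> j \<le> m \<and>
      (\<exists>\<beta>1. (\<beta>1, l) \<in> Gam_seq m n \<alpha>s p \<and> below_diff \<beta>1 \<tau> i) \<and>
      (\<exists>\<beta>2. (\<beta>2, l) \<in> Gam_seq m n \<alpha>s p \<and> below_diff \<beta>2 \<tau> j)"
    using assms(2-) by blast
  obtain s \<eta> k where *: "1 \<le> (s::nat) \<and>
      (\<forall>q\<in>{1..s}. (\<eta> q, l) \<in> Gam_seq m n \<alpha>s p \<and> k q \<in> {1..m} \<and> below_diff (\<eta> q) \<tau> (k q)) \<and>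
      k 1 = i \<and> k s = j \<and> (\<forall>q\<in>{1..<s}. vdeg m (sup (\<eta> q) (\<eta> (q + 1))) \<le> p)"
    using assms(1)[unfolded D_cond_def, THEN spec, THEN spec, THEN spec, THEN spec, THEN mp, OF prem]
    by (elim exE) (rule that)
  from * show thesis by (elim conjE) (erule (4) that)
qed

text \<open>Since \<open>\<mu>\<close> is the only element of the antichain below \<open>\<tau> - a\<close>, where \<open>\<tau> = inc a \<mu>\<close>, and every
  element whose least upper bound with \<open>\<mu>\<close> has degree at most \<open>p\<close> equals \<open>\<mu>\<close>, no admissible path leaves \<open>\<mu>\<close>.\<close>

lemma not_D_condI:
  assumes seq: "antichain_seq m n \<alpha>s" and \<mu>: "\<mu> \<in> component \<alpha>s l" "vdeg m \<mu> = p"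
    and ab: "a \<in> {1..m}" "b \<in> {1..m}" "inc a \<mu> = inc b \<xi>" "\<mu> \<noteq> \<xi>"
    and \<beta>: "\<beta> \<in> component \<alpha>s l" "\<beta> \<le> \<xi>"
  shows "\<not> D_cond m n \<alpha>s p"
proof
  assume D: "D_cond m n \<alpha>s p"
  note mem = mem_Gam_seq[OF seq]
  note E = antichain_seq_component(1,2)[OF seq, of l]
  have anti: "\<eta> = \<zeta>" if "\<eta> \<in> component \<alpha>s l" "\<zeta> \<in> component \<alpha>s l" "\<eta> \<le> \<zeta>" for \<eta> \<zeta>
    using E(2) that unfolding antichain_def by blast
  define \<tau> where "\<tau> = inc a \<mu>"
  have muNN: "\<mu> \<in> NN m" using \<mu>(1) E(1) by blast
  have xi: "\<xi> \<in> NN m" "vdeg m \<xi> = p"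
    using ab muNN NN_inc[OF ab(1), of \<mu>] NN_inc[OF ab(2), of \<xi>] vdeg_inc[OF ab(1), of \<mu>]
      vdeg_inc[OF ab(2), of \<xi>] \<mu>(2) by auto
  have "a \<noteq> b" using ab(3,4) by auto
  have "\<beta> \<noteq> \<mu>" using vdeg_eq_imp_eq[of \<mu> \<xi> m] \<beta>(2) xi \<mu>(2) ab(4) by auto
  then have nle: "\<not> \<beta> \<le> \<mu>" using anti \<beta>(1) \<mu>(1) by blast
  have \<beta>\<tau>: "\<beta> \<le> \<tau>" using order.trans[OF \<beta>(2) le_inc] ab(3) by (simp add: \<tau>_def)
  \<comment> \<open>\<open>\<beta>\<close> lies below \<open>inc a \<mu>\<close> but not below
    \<open>\<mu>\<close>, so it must exceed \<open>\<mu>\<close> at \<open>a\<close>; this makes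
    \<open>\<tau>\<close> the least upper bound of the two.\<close>
  have "\<mu> a < \<beta> a"
  proof (rule ccontr)
    assume le: "\<not> \<mu> a < \<beta> a"
    have "\<beta> x \<le> inc a \<mu> x" for x using \<beta>\<tau> by (simp add: \<tau>_def le_fun_def)
    then have "\<beta> x \<le> \<mu> x" for x using le by (cases "x = a") (auto simp: inc_apply dest: meta_spec[of _ x])
    then show False using nle by (simp add: le_fun_def)
  qed
  have sup: "\<tau> = sup \<mu> \<beta>"
  proof (rule antisym)
    show "sup \<mu> \<beta> \<le> \<tau>" using \<beta>\<tau> le_inc by (simp add: \<tau>_def)
    show "\<tau> \<le> sup \<mu> \<beta>" unfolding \<tau>_def by (rule inc_le) (use \<open>\<mu> a < \<beta> a\<close> in \<open>simp_all add: sup_nat_def\<close>)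
  qed
  have deg: "vdeg m \<tau> = Suc p" unfolding \<tau>_def using vdeg_inc[OF ab(1)] \<mu>(2) by simp
  have bdeg: "vdeg m \<beta> \<le> p" using vdeg_mono[OF \<beta>(2), of m] xi by simp
  have lub: "(\<tau>, l) \<in> lubs (Gam_seq m n \<alpha>s p) - Gam m n p"
    using sup \<mu> \<beta>(1) bdeg \<open>\<beta> \<noteq> \<mu>\<close> deg unfolding lubs_def
    by (auto simp: mem Gam_def pdeg_def)
  have bd: "below_diff \<mu> \<tau> a" "below_diff \<beta> \<tau> b"
    using inc_mono[OF \<beta>(2), of b] ab(3) by (auto simp: below_diff_iff \<tau>_def)
  have Gam: "(\<mu>, l) \<in> Gam_seq m n \<alpha>s p" "(\<beta>, l) \<in> Gam_seq m n \<alpha>s p"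
    using \<mu> \<beta>(1) bdeg by (auto simp: mem)
  have at_a: "\<eta> = \<mu>" if "(\<eta>, l) \<in> Gam_seq m n \<alpha>s p" "below_diff \<eta> \<tau> a" for \<eta>
    using that anti \<mu>(1) by (auto simp: mem below_diff_iff \<tau>_def)
  have not_b: "\<not> below_diff \<mu> \<tau> b"
  proof
    assume "below_diff \<mu> \<tau> b"
    then have "inc b \<mu> b \<le> inc a \<mu> b" by (simp add: below_diff_iff \<tau>_def le_fun_def)
    then show False using \<open>a \<noteq> b\<close> by (simp add: inc_apply)
  qed
  have stuck: "\<eta> = \<mu>" if "(\<eta>, l) \<in> Gam_seq m n \<alpha>s p" "vdeg m (sup \<mu> \<eta>) \<le> p" for \<eta>
  proof -
    have "\<eta> \<in> component \<alpha>s l" using that by (simp add: mem)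
    moreover have "\<mu> = sup \<mu> \<eta>"
      by (rule vdeg_eq_imp_eq[of _ _ m])
         (use that(2) \<mu>(2) muNN \<open>\<eta> \<in> component \<alpha>s l\<close> E(1) NN_sup in auto)
    then have "\<eta> \<le> \<mu>" by (metis sup_ge2)
    ultimately show ?thesis using anti \<mu>(1) by blast
  qed
  have mem_ab: "1 \<le> a" "a \<le> m" "1 \<le> b" "b \<le> m" using ab(1,2) by auto
  \<comment> \<open>The condition orders its two indices: the path starts at \<open>\<mu>\<close> if
    \<open>a < b\<close> and ends there if \<open>b < a\<close>, where the induction runs
    backwards.\<close>
  consider "a < b" | "b < a" using \<open>a \<noteq> b\<close> by linarith
  then show False
  proof cases
    case 1
    obtain s \<eta> k where path: "1 \<le> (s::nat)"
      "\<forall>q\<in>{1..s}. (\<eta> q, l) \<in> Gam_seq m n \<alpha>s p \<and> k q \<in> {1..m} \<and> below_diff (\<eta> q) \<tau> (k q)"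
      "k 1 = a" "k s = b" "\<forall>q\<in>{1..<s}. vdeg m (sup (\<eta> q) (\<eta> (q + 1))) \<le> p"
      by (rule D_condD[OF D lub mem_ab(1) 1 mem_ab(4) Gam(1) bd(1) Gam(2) bd(2)]) (erule (4) that)
    have "x < s \<Longrightarrow> \<eta> (Suc x) = \<mu>" for x
    proof (induction x)
      case 0
      then show ?case using at_a[of "\<eta> 1"] path by force
    next
      case (Suc x)
      then show ?case using stuck[of "\<eta> (Suc (Suc x))"] path(2,5) by force
    qed
    from this[of "s - 1"] show False using path not_b by force
  next
    case 2
    obtain s \<eta> k where path: "1 \<le> (s::nat)"
      "\<forall>q\<in>{1..s}. (\<eta> q, l) \<in> Gam_seq m n \<alpha>s p \<and> k q \<in> {1..m} \<and> below_diff (\<eta> q) \<tau> (k q)"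
      "k 1 = b" "k s = a" "\<forall>q\<in>{1..<s}. vdeg m (sup (\<eta> q) (\<eta> (q + 1))) \<le> p"
      by (rule D_condD[OF D lub mem_ab(3) 2 mem_ab(2) Gam(2) bd(2) Gam(1) bd(1)]) (erule (4) that)
    have "x < s \<Longrightarrow> \<eta> (s - x) = \<mu>" for x
    proof (induction x)
      case 0
      then show ?case using at_a[of "\<eta> s"] path by force
    next
      case (Suc x)
      then have "vdeg m (sup (\<eta> (s - Suc x)) (\<eta> (s - Suc x + 1))) \<le> p" using path(5) by auto
      moreover have "s - Suc x + 1 = s - x" using Suc.prems by simp
      ultimately have "vdeg m (sup \<mu> (\<eta> (s - Suc x))) \<le> p" using Suc by (simp add: sup_commute)
      then show ?case using stuck path(2) Suc.prems by force
    qed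
    from this[of "s - 1"] show False using path not_b by force
  qed
qed

section \<open>Lexicographic antichains\<close>

fun lexset :: "nat \<Rightarrow> nat \<Rightarrow> nat \<Rightarrow> (nat \<Rightarrow> nat) set" where
  "lexset 0 q a = (if q = 0 \<and> 0 < a then {\<lambda>_. 0} else {})"
| "lexset (Suc m) 0 a = (if 0 < a then {\<lambda>_. 0} else {})"
| "lexset (Suc m) (Suc q) a =
     (if a \<le> nmon (Suc m) q then inc (Suc m) ` lexset (Suc m) q a
      else inc (Suc m) ` mons (Suc m) q \<union> lexset m (Suc q) (a - nmon (Suc m) q))"

lemma lexset_0 [simp]: "lexset m q 0 = {}"
  by (induction m q "0::nat" rule: lexset.induct) auto

lemma lexset_subset: "lexset m q a \<subseteq> mons m q"
proof (induction m q a rule: lexset.induct)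
  case (3 m q a)
  then show ?case by (auto simp: mons_Suc)
qed (auto simp: mons_0)

lemma finite_lexset [simp]: "finite (lexset m q a)"
  by (rule finite_subset[OF lexset_subset finite_mons])

lemma card_lexset: "a \<le> nmon m q \<Longrightarrow> card (lexset m q a) = a"
proof (induction m q a rule: lexset.induct)
  case (1 q a)
  then show ?case by (cases q) auto
next
  case (3 m q a)
  then show ?case
    by (auto simp: card_image inj_on_def card_slices[OF lexset_subset] card_mons)
qed auto

lemma lexset_full: "lexset m q (nmon m q) = mons m q"
  by (rule card_subset_eq) (simp_all add: lexset_subset card_lexset card_mons)

lemma lexset_mono: "a \<le> b \<Longrightarrow> lexset m q a \<subseteq> lexset m q b"
proof (induction m q a arbitrary: b rule: lexset.induct)
  case (3 m q a)
  show ?case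
  proof (cases "b \<le> nmon (Suc m) q")
    case True
    then show ?thesis using 3 by (simp add: image_mono)
  next
    case b: False
    show ?thesis
    proof (cases "a \<le> nmon (Suc m) q")
      case True
      then show ?thesis using b image_mono[OF lexset_subset[of "Suc m" q a], of "inc (Suc m)"]
        by (auto simp del: lexset.simps simp add: lexset.simps(3))
    next
      case False
      then have "lexset m (Suc q) (a - nmon (Suc m) q) \<subseteq> lexset m (Suc q) (b - nmon (Suc m) q)"
        using 3 by simp
      then show ?thesis using b False by auto
    qed
  qed
qed auto

text \<open>The recursions of \<open>lexset\<close> and \<open>shad\<close> mirror each other: once
  all multiples of the last variable are present, their shadow contains every multiple in the next
  degree, and the remaining slice only contributes its shadow in the other variables.\<close>

lemma shadow_lexset:
  "a \<le> nmon m q \<Longrightarrow> shadow m (lexset m q a) = lexset m (Suc q) (shad m q a)"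
proof (induction m q a rule: lexset.induct)
  case (1 q a)
  then show ?case by (simp add: shadow_def)
next
  case (2 m a)
  show ?case
  proof (cases "a = 0")
    case False
    then have "lexset (Suc m) 0 a = mons (Suc m) 0" "shad (Suc m) 0 a = nmon (Suc m) (Suc 0)"
      by (simp_all add: mons_0 nmon_Suc_one del: nmon.simps)
    then show ?thesis using shadow_mons[of m 0] lexset_full[of "Suc m" "Suc 0"]
      by (simp del: lexset.simps nmon.simps)
  qed simp
next
  case (3 m q a)
  let ?p = "nmon (Suc m) q"
  show ?case
  proof (cases "a \<le> ?p")
    case True
    have "shad (Suc m) q a \<le> nmon (Suc m) (Suc q)" by (rule shad_le[OF True])
    then show ?thesis
      using 3(1)[OF True True] True
      by (simp only: lexset.simps(3) shad.simps(3) if_True shadow_image_inc)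
  next
    case False
    have le: "a - ?p \<le> nmon m (Suc q)" using 3(3) by simp
    have sub: "lexset m (Suc q) (a - ?p) \<subseteq> mons (Suc m) (Suc q)"
      using lexset_subset[of m "Suc q"] by (auto simp: mons_Suc)
    have "shadow (Suc m) (lexset (Suc m) (Suc q) a)
        = inc (Suc m) ` (mons (Suc m) (Suc q) \<union> lexset m (Suc q) (a - ?p))
          \<union> shadow m (lexset m (Suc q) (a - ?p))"
      using False by (simp only: lexset.simps(3) if_False shadow_slices shadow_mons)
    also have "mons (Suc m) (Suc q) \<union> lexset m (Suc q) (a - ?p) = mons (Suc m) (Suc q)"
      using sub by blast
    also have "shadow m (lexset m (Suc q) (a - ?p)) = lexset m (Suc (Suc q)) (shad m (Suc q) (a - ?p))"
      using 3(2)[OF False le] .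
    also have "inc (Suc m) ` mons (Suc m) (Suc q) \<union> \<dots>
        = lexset (Suc m) (Suc (Suc q)) (nmon (Suc m) (Suc q) + shad m (Suc q) (a - ?p))"
    proof (cases "shad m (Suc q) (a - ?p) = 0")
      case True
      then show ?thesis
        using lexset_full[of "Suc m" "Suc q"] by (simp only: lexset.simps(3)[of m "Suc q"]) simp
    next
      case False
      then show ?thesis by (simp only: lexset.simps(3)[of m "Suc q"]) simp
    qed
    finally show ?thesis using False by (simp only: shad.simps(3) if_False)
  qed
qed

section \<open>Dickson's lemma\<close>

lemma nat_seq_mono_subseq:
  fixes s :: "nat \<Rightarrow> nat"
  shows "\<exists>f :: nat \<Rightarrow> nat. strict_mono f \<and> mono (\<lambda>i. s (f i))"
proof -
  \<comment> \<open>Tail minima: \<open>g n\<close> is a position from \<open>n\<close> on where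
    that tail takes its least value, and iterating \<open>g\<close> yields the subsequence.\<close>
  have "\<exists>i\<ge>n. \<forall>j\<ge>n. s i \<le> s j" for n
    using ex_has_least_nat[of "\<lambda>i. n \<le> i" n s] by blast
  then obtain g where g: "\<And>n. n \<le> g n" "\<And>n j. n \<le> j \<Longrightarrow> s (g n) \<le> s j" by metis
  define f where "f = rec_nat (g 0) (\<lambda>_ x. g (Suc x))"
  have f: "f (Suc i) = g (Suc (f i))" for i by (simp add: f_def)
  have less: "f i < f (Suc i)" for i using g(1)[of "Suc (f i)"] by (simp add: f)
  have fg: "\<exists>n\<le>f i. f i = g n" for i
  proof (cases i)
    case 0
    then show ?thesis by (intro exI[of _ 0]) (simp add: f_def)
  next
    case (Suc k)
    then show ?thesis using f[of k] g(1)[of "Suc (f k)"] by auto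
  qed
  have "s (f i) \<le> s (f (Suc i))" for i
  proof -
    obtain n where "n \<le> f i" "f i = g n" using fg by blast
    then show ?thesis using g(2)[of n "f (Suc i)"] less[of i] by simp
  qed
  then have "mono (\<lambda>i. s (f i))" by (simp add: mono_iff_le_Suc)
  moreover have "strict_mono f" using less by (simp add: strict_mono_Suc_iff)
  ultimately show ?thesis by blast
qed

lemma dickson:
  fixes u :: "nat \<Rightarrow> nat \<Rightarrow> nat"
  assumes "\<And>i. u i \<in> NN m"
  shows "\<exists>i j. i < j \<and> u i \<le> u j"
proof -
  have "\<exists>f :: nat \<Rightarrow> nat. strict_mono f \<and> (\<forall>k\<in>{1..m}. mono (\<lambda>i. u (f i) k))" for m
  proof (induction m)
    case 0
    show ?case by (rule exI[of _ "\<lambda>i. i"]) (simp add: strict_mono_def)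
  next
    case (Suc m)
    then obtain f :: "nat \<Rightarrow> nat" where f: "strict_mono f" "\<And>k. k \<in> {1..m} \<Longrightarrow> mono (\<lambda>i. u (f i) k)" by blast
    obtain h :: "nat \<Rightarrow> nat" where h: "strict_mono h" "mono (\<lambda>i. u (f (h i)) (Suc m))"
      using nat_seq_mono_subseq[of "\<lambda>i. u (f i) (Suc m)"] by blast
    have "mono (\<lambda>i. u (f (h i)) k)" if "k \<in> {1..Suc m}" for k
    proof (cases "k = Suc m")
      case False
      then have "mono (\<lambda>i. u (f i) k)" using that by (intro f(2)) auto
      then show ?thesis using strict_mono_mono[OF h(1)] by (simp add: mono_def)
    qed (use h in simp)
    moreover have "strict_mono (\<lambda>i. f (h i))" using f(1) h(1) by (simp add: strict_mono_def)
    ultimately show ?case by blast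
  qed
  then obtain f :: "nat \<Rightarrow> nat" where f: "strict_mono f" "\<forall>k\<in>{1..m}. mono (\<lambda>i. u (f i) k)" by blast
  have "u (f 0) k \<le> u (f 1) k" for k
  proof (cases "k \<in> {1..m}")
    case True
    then show ?thesis using f(2) by (simp add: mono_def)
  next
    case False
    then show ?thesis using assms[of "f 0"] by (simp add: NN_def)
  qed
  then have "u (f 0) \<le> u (f 1)" by (simp add: le_fun_def)
  moreover have "f 0 < f 1" using f(1) by (simp add: strict_mono_def)
  ultimately show ?thesis by blast
qed

text \<open>\<open>zrun m c i\<close> is the size, in degree \<open>c + i\<close>, of the ideal generated by two monomials of degree \<open>c\<close>
  and one new monomial in each of the degrees \<open>c + 1, ..., c + i\<close>, chosen lexicographically. Values
  beyond the first index where it reaches \<open>nmon m (c + i)\<close> are meaningless.\<close>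

primrec zrun :: "nat \<Rightarrow> nat \<Rightarrow> nat \<Rightarrow> nat" where
  "zrun m c 0 = 2"
| "zrun m c (Suc i) = Suc (shad m (c + i) (zrun m c i))"

definition zrun_open :: "nat \<Rightarrow> nat \<Rightarrow> nat \<Rightarrow> bool" where
  "zrun_open m c i \<longleftrightarrow> (\<forall>j<i. zrun m c j < nmon m (c + j))"

text \<open>The indices 0 and 1 both belong to degree \<open>c\<close>, and \<open>Suc i\<close>
  belongs to degree \<open>c + i\<close>. While \<open>zrun_open\<close> holds, the choice is from a
  singleton, namely the last monomial of the segment.\<close>

definition fresh :: "nat \<Rightarrow> nat \<Rightarrow> nat \<Rightarrow> nat \<Rightarrow> nat" where
  "fresh m c i = (case i of 0 \<Rightarrow> (SOME \<xi>. \<xi> \<in> lexset m c 1)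
    | Suc i \<Rightarrow> (SOME \<xi>. \<xi> \<in> lexset m (c + i) (zrun m c i) - lexset m (c + i) (zrun m c i - 1)))"

lemma nmon_ge_2: "2 \<le> m \<Longrightarrow> 1 \<le> c \<Longrightarrow> 2 \<le> nmon m c"
  using nmon_pos[of "m - 1" "c - 1"] nmon_pos[of "m - 2" c]
  by (cases m; cases c; cases "m - 1") auto

context
  fixes m c :: nat
  assumes m: "2 \<le> m" and c: "1 \<le> c"
begin

lemma zrun_open_le: "zrun_open m c i \<Longrightarrow> j \<le> i \<Longrightarrow> zrun_open m c j"
  by (simp add: zrun_open_def)

lemma zrun_ge_2: "zrun_open m c i \<Longrightarrow> 2 \<le> zrun m c i"
proof (induction i)
  case (Suc i)
  then have z: "2 \<le> zrun m c i" "zrun m c i < nmon m (c + i)"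
    by (auto simp: zrun_open_def)
  then have "shad m (c + i) 1 \<le> shad m (c + i) (zrun m c i)" by (intro shad_mono) auto
  then show ?case using shad_1[of m "c + i"] z m by simp
qed simp

lemma zrun_le: "zrun_open m c i \<Longrightarrow> zrun m c i \<le> nmon m (c + i)"
proof (induction i)
  case 0
  then show ?case using nmon_ge_2[OF m c] by simp
next
  case (Suc i)
  obtain m' where m': "m = Suc m'" using m by (cases m) auto
  have lt: "zrun m c i < nmon m (c + i)" using Suc.prems by (simp add: zrun_open_def)
  have "shad m (c + i) (zrun m c i) < shad m (c + i) (Suc (zrun m c i))"
    using shad_Suc_gt[of "zrun m c i" m' "c + i"] lt m' by simp
  also have "\<dots> \<le> nmon m (Suc (c + i))" by (rule shad_le) (use lt in simp)
  finally show ?case by simp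
qed

lemma lexset_fresh:
  assumes "zrun_open m c i"
  shows "lexset m (c + i) (zrun m c i) = insert (fresh m c (Suc i)) (lexset m (c + i) (zrun m c i - 1))"
    and "fresh m c (Suc i) \<notin> lexset m (c + i) (zrun m c i - 1)"
proof -
  let ?J = "lexset m (c + i) (zrun m c i)" and ?B = "lexset m (c + i) (zrun m c i - 1)"
  have sub: "?B \<subseteq> ?J" by (rule lexset_mono) simp
  have "card (?J - ?B) = card ?J - card ?B" by (rule card_Diff_subset[OF finite_lexset sub])
  also have "\<dots> = 1" using zrun_ge_2[OF assms] zrun_le[OF assms] by (simp add: card_lexset)
  finally obtain x where x: "?J - ?B = {x}" by (metis card_1_singletonE)
  then have "fresh m c (Suc i) = x" by (simp add: fresh_def)
  then show "?J = insert (fresh m c (Suc i)) ?B" "fresh m c (Suc i) \<notin> ?B" using x sub by auto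
qed

lemma lexset_fresh_0: "lexset m c 1 = {fresh m c 0}"
proof -
  have "card (lexset m c 1) = 1" using nmon_ge_2[OF m c] by (simp add: card_lexset)
  then obtain x where "lexset m c 1 = {x}" by (metis card_1_singletonE)
  then show ?thesis by (simp add: fresh_def)
qed

lemma lexset_fresh_Suc:
  assumes "zrun_open m c (Suc i)"
  shows "lexset m (c + Suc i) (zrun m c (Suc i) - 1) = shadow m (lexset m (c + i) (zrun m c i))"
proof -
  have "zrun_open m c i" by (rule zrun_open_le[OF assms]) simp
  from zrun_le[OF this] show ?thesis by (simp add: shadow_lexset)
qed

lemma fresh_degree:
  assumes "zrun_open m c (i - 1)"
  shows "fresh m c i \<in> mons m (c + (i - 1))"
proof (cases i)
  case 0
  then show ?thesis using lexset_fresh_0 lexset_subset[of m c 1] by auto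
next
  case (Suc k)
  then show ?thesis using lexset_fresh(1)[of k] assms lexset_subset[of m "c + k" "zrun m c k"] by auto
qed

text \<open>The segment without its last monomial is the shadow of the previous segment, and above
  the degrees of its generators an ideal is the shadow of its preceding part. Hence each fresh
  monomial lies outside the ideal of the earlier ones.\<close>

lemma lexset_eq_fresh_upset:
  assumes "zrun_open m c i"
  shows "lexset m (c + i) (zrun m c i - 1) = upset m (fresh m c ` {..i}) (c + i)"
  using assms
proof (induction i)
  case 0
  have "fresh m c 0 \<in> mons m c" using fresh_degree[of 0] by (simp add: zrun_open_def)
  then have "upset m {fresh m c 0} c = {fresh m c 0}"
    using mons_eqI by (auto simp: upset_def)
  then show ?case using lexset_fresh_0 by simp
next
  case (Suc i)
  have op: "zrun_open m c i" by (rule zrun_open_le[OF Suc.prems]) simp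
  let ?J = "lexset m (c + i) (zrun m c i)"
  have J: "?J = insert (fresh m c (Suc i)) (upset m (fresh m c ` {..i}) (c + i))"
    using lexset_fresh(1)[OF op] Suc.IH[OF op] by simp
  have fdeg: "fresh m c (Suc i) \<in> mons m (c + i)" using fresh_degree[of "Suc i"] op by simp
  have "?J = upset m (fresh m c ` {..Suc i}) (c + i)"
    unfolding J using fdeg mons_eqI[OF _ fdeg] by (auto simp: upset_def atMost_Suc)
  moreover have "shadow m (upset m (fresh m c ` {..Suc i}) (c + i))
      = upset m (fresh m c ` {..Suc i}) (c + Suc i)"
  proof
    show "shadow m (upset m (fresh m c ` {..Suc i}) (c + i)) \<subseteq> upset m (fresh m c ` {..Suc i}) (c + Suc i)"
      using shadow_upset by simp
    show "upset m (fresh m c ` {..Suc i}) (c + Suc i) \<subseteq> shadow m (upset m (fresh m c ` {..Suc i}) (c + i))"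
    proof
      fix \<xi> assume "\<xi> \<in> upset m (fresh m c ` {..Suc i}) (c + Suc i)"
      then obtain j where xi: "\<xi> \<in> mons m (Suc (c + i))" and j: "j \<le> Suc i" "fresh m c j \<le> \<xi>"
        by (auto simp: upset_def)
      have "zrun_open m c (j - 1)" by (rule zrun_open_le[OF op]) (use j in simp)
      from fresh_degree[OF this] have "vdeg m (fresh m c j) \<le> c + i" using j(1) by (auto simp: mons_def)
      then obtain \<sigma> where s: "\<sigma> \<in> mons m (c + i)" "fresh m c j \<le> \<sigma>" "\<sigma> \<le> \<xi>"
        using ex_mons_between[of "fresh m c j" \<xi> m "c + i"] j(2) xi by (auto simp: mons_def)
      have "\<exists>k\<in>{1..m}. \<sigma> k < \<xi> k"
      proof (rule ccontr)
        assume "\<not> ?thesis"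
        then have "vdeg m \<xi> \<le> vdeg m \<sigma>" unfolding vdeg_def by (intro sum_mono) (simp add: not_less)
        then show False using s(1) xi by (simp add: mons_def)
      qed
      then obtain k where k: "k \<in> {1..m}" "\<sigma> k < \<xi> k" by blast
      have "inc k \<sigma> = \<xi>"
        by (rule mons_eqI[of _ _ m "Suc (c + i)"])
           (use inc_le[OF s(3) k(2)] inc_in_mons[OF k(1)] s(1) xi in simp_all)
      moreover have "\<sigma> \<in> upset m (fresh m c ` {..Suc i}) (c + i)"
        unfolding upset_def using s(1,2) j(1) by blast
      ultimately show "\<xi> \<in> shadow m (upset m (fresh m c ` {..Suc i}) (c + i))"
        unfolding shadow_def using k(1) by blast
    qed
  qed
  ultimately show ?case using lexset_fresh_Suc[OF Suc.prems] by simp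
qed

lemma fresh_not_le:
  assumes "zrun_open m c i" "j \<le> i"
  shows "\<not> fresh m c j \<le> fresh m c (Suc i)"
proof
  assume "fresh m c j \<le> fresh m c (Suc i)"
  moreover have "fresh m c (Suc i) \<in> mons m (c + i)" using fresh_degree[of "Suc i"] assms by simp
  ultimately have "fresh m c (Suc i) \<in> upset m (fresh m c ` {..i}) (c + i)"
    unfolding upset_def using assms(2) by blast
  then show False using lexset_fresh(2) lexset_eq_fresh_upset assms(1) by simp
qed

lemma fresh_incomparable:
  assumes "zrun_open m c (j - 1)" "i < j"
  shows "\<not> fresh m c i \<le> fresh m c j" "\<not> fresh m c j \<le> fresh m c i"
proof -
  obtain j' where j': "j = Suc j'" using assms(2) by (cases j) auto
  show *: "\<not> fresh m c i \<le> fresh m c j" using fresh_not_le[of j' i] assms j' by simp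
  show "\<not> fresh m c j \<le> fresh m c i"
  proof
    assume le: "fresh m c j \<le> fresh m c i"
    have "zrun_open m c (i - 1)" by (rule zrun_open_le[OF assms(1)]) (use assms in simp)
    from fresh_degree[OF this] fresh_degree[OF assms(1)]
    have "fresh m c i \<in> NN m" "vdeg m (fresh m c i) \<le> vdeg m (fresh m c j)"
      using assms(2) by (auto simp: mons_def)
    from vdeg_eq_imp_eq[OF le this] * show False by simp
  qed
qed

text \<open>A filling that never ended would produce an infinite antichain.\<close>

lemma ex_zrun_full: "\<exists>i. nmon m (c + i) \<le> zrun m c i"
proof (rule ccontr)
  assume "\<not> ?thesis"
  then have op: "zrun_open m c i" for i by (auto simp: zrun_open_def not_le)
  have "fresh m c i \<in> NN m" for i using fresh_degree[OF op, of i] by (simp add: mons_def)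
  from dickson[of "fresh m c", OF this] show False using fresh_incomparable(1)[OF op] by blast
qed

definition zlen :: nat where
  "zlen = (LEAST i. nmon m (c + i) \<le> zrun m c i)"

lemma zrun_open_iff: "zrun_open m c i \<longleftrightarrow> i \<le> zlen"
proof -
  have "nmon m (c + zlen) \<le> zrun m c zlen" unfolding zlen_def by (rule LeastI_ex[OF ex_zrun_full])
  moreover have "zrun m c j < nmon m (c + j)" if "j < zlen" for j
    using not_less_Least[OF that[unfolded zlen_def]] by simp
  ultimately show ?thesis unfolding zrun_open_def by (metis le_trans not_le)
qed

text \<open>Each step adds a single monomial to the minimal shadow of a set that is not full, so the
  full size is hit and never overshot.\<close>

lemma zrun_zlen: "zrun m c zlen = nmon m (c + zlen)"
  using LeastI_ex[OF ex_zrun_full] zrun_le[of zlen] zrun_open_iff[of zlen]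
  by (simp add: zlen_def le_antisym)

text \<open>Adding a monomial to a nonempty set enlarges the minimal shadow by less than \<open>m\<close>, so one of
  the \<open>m\<close> multiples of the new monomial is already in the shadow of the old ones.\<close>

lemma fresh_overlap:
  assumes "zrun_open m c i"
  shows "\<exists>a\<in>{1..m}. \<exists>b\<in>{1..m}. \<exists>j\<le>i. \<exists>\<xi>. fresh m c j \<le> \<xi> \<and> inc a (fresh m c (Suc i)) = inc b \<xi>
    \<and> fresh m c (Suc i) \<noteq> \<xi>"
proof -
  let ?u = "fresh m c (Suc i)" and ?z = "zrun m c i"
  let ?B = "lexset m (c + i) (?z - 1)"
  have z: "2 \<le> ?z" "?z \<le> nmon m (c + i)" using zrun_ge_2 zrun_le assms by auto
  obtain m' where m': "m = Suc m'" using m by (cases m) auto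
  have "shadow m ?B \<inter> shadow m {?u} \<noteq> {}"
  proof
    assume disj: "shadow m ?B \<inter> shadow m {?u} = {}"
    have "shadow m {?u} = (\<lambda>k. inc k ?u) ` {1..m}" by (auto simp: shadow_def)
    moreover have "inj_on (\<lambda>k. inc k ?u) {1..m}"
      by (rule inj_onI) (metis inc_apply n_not_Suc_n)
    ultimately have cu: "card (shadow m {?u}) = m" by (simp add: card_image)
    have "shadow m (lexset m (c + i) ?z) = shadow m ?B \<union> shadow m {?u}"
      using lexset_fresh(1)[OF assms] shadow_Un[of m ?B "{?u}"] by simp
    then have "card (shadow m (lexset m (c + i) ?z)) = card (shadow m ?B) + m"
      using disj cu by (simp add: card_Un_disjoint finite_shadow)
    moreover have "card (shadow m (lexset m (c + i) ?z)) = shad m (c + i) ?z"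
      "card (shadow m ?B) = shad m (c + i) (?z - 1)"
      using z shad_le[of _ m "c + i"] by (auto simp: shadow_lexset intro!: card_lexset)
    moreover have "shad m (c + i) (Suc (?z - 1)) \<le> shad m (c + i) (?z - 1) + m'"
      unfolding m' by (rule shad_Suc_less_add) (use z m' in auto)
    ultimately show False using z m' by simp
  qed
  then obtain \<zeta> where \<zeta>: "\<zeta> \<in> shadow m ?B" "\<zeta> \<in> shadow m {?u}" by blast
  from \<zeta>(1) obtain b \<xi> where b: "b \<in> {1..m}" "\<xi> \<in> ?B" "\<zeta> = inc b \<xi>"
    unfolding shadow_def by (elim UN_E imageE)
  from \<zeta>(2) obtain a where a: "a \<in> {1..m}" "\<zeta> = inc a ?u"
    unfolding shadow_def by (elim UN_E imageE) simp
  obtain j where j: "j \<le> i" "fresh m c j \<le> \<xi>"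
    using b(2) lexset_eq_fresh_upset[OF assms] by (auto simp: upset_def)
  have ne: "?u \<noteq> \<xi>" using lexset_fresh(2)[OF assms] b(2) by metis
  show ?thesis
    by (rule bexI[OF _ a(1)], rule bexI[OF _ b(1)], intro exI[of _ j] exI[of _ \<xi>] conjI)
       (use a b j ne in simp_all)
qed

end

text \<open>Macaulay's bound for several components: the least growth is obtained by filling the components
  one after the other.\<close>

definition growth :: "nat \<Rightarrow> nat \<Rightarrow> nat \<Rightarrow> nat" where
  "growth m q x = (x div nmon m q) * nmon m (Suc q) + shad m q (x mod nmon m q)"

lemma growth_eq:
  assumes "b \<le> nmon (Suc m) q"
  shows "growth (Suc m) q (j * nmon (Suc m) q + b) = j * nmon (Suc m) (Suc q) + shad (Suc m) q b"
proof (cases "b = nmon (Suc m) q")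
  case True
  then have "j * nmon (Suc m) q + b = Suc j * nmon (Suc m) q" by simp
  then show ?thesis using nmon_pos[of m q] shad_nmon[of "Suc m" q] True
    by (simp only: growth_def) simp
next
  case False
  then show ?thesis using assms nmon_pos[of m q] by (simp add: growth_def del: nmon.simps)
qed

lemma growth_0 [simp]: "growth m q 0 = 0"
  by (simp add: growth_def)

lemma growth_cases:
  obtains j b where "x = j * nmon (Suc m) q + b" "b < nmon (Suc m) q"
  using nmon_pos[of m q] by (metis div_mult_mod_eq mod_less_divisor)

lemma growth_Suc: "growth (Suc m) q x < growth (Suc m) q (Suc x)"
proof -
  obtain j b where x: "x = j * nmon (Suc m) q + b" "b < nmon (Suc m) q" by (rule growth_cases)
  have "growth (Suc m) q (Suc x) = j * nmon (Suc m) (Suc q) + shad (Suc m) q (Suc b)"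
    using growth_eq[of "Suc b" m q j] x by simp
  then show ?thesis using growth_eq[of b m q j] x shad_Suc_gt[OF x(2)] by simp
qed

lemma growth_add_ge: "growth (Suc m) q x + d \<le> growth (Suc m) q (x + d)"
proof (induction d)
  case (Suc d)
  then show ?case using growth_Suc[of m q "x + d"] by simp
qed simp

text \<open>If the added set overflows the component being filled, \<open>shad_add_overflow\<close>
  allows completing that component and moving the rest to the next one.\<close>

lemma growth_add_le:
  assumes "a \<le> nmon (Suc m) q"
  shows "growth (Suc m) q (x + a) \<le> growth (Suc m) q x + shad (Suc m) q a"
proof -
  let ?P = "nmon (Suc m) q"
  obtain j b where x: "x = j * ?P + b" "b < ?P" by (rule growth_cases)
  have gx: "growth (Suc m) q x = j * nmon (Suc m) (Suc q) + shad (Suc m) q b"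
    using growth_eq[of b m q j] x by simp
  show ?thesis
  proof (cases "b + a \<le> ?P")
    case True
    then show ?thesis
      using growth_eq[OF True, of j] gx x shad_add[OF True] by (simp add: add.assoc)
  next
    case False
    define d where "d = b + a - ?P"
    have d: "b + a = ?P + d" "d \<le> ?P" using False x assms by (auto simp: d_def)
    have "x + a = Suc j * ?P + d" using x d by simp
    then have "growth (Suc m) q (x + a) = Suc j * nmon (Suc m) (Suc q) + shad (Suc m) q d"
      using growth_eq[OF d(2), of "Suc j"] by simp
    moreover have "nmon (Suc m) (Suc q) + shad (Suc m) q d \<le> shad (Suc m) q b + shad (Suc m) q a"
      by (rule shad_add_overflow) (use x assms d in auto)
    ultimately show ?thesis using gx by (simp del: nmon.simps)
  qed
qed

lemma growth_sum_le:
  assumes "finite S" "\<And>l. l \<in> S \<Longrightarrow> a l \<le> nmon (Suc m) q"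
  shows "growth (Suc m) q (sum a S) \<le> (\<Sum>l\<in>S. shad (Suc m) q (a l))"
  using assms
proof (induction S)
  case (insert l S)
  then show ?case using growth_add_le[of "a l" m q "sum a S"] by (simp add: add.commute)
qed simp

section \<open>Comparison with the sequential lexicographic antichain\<close>

lemma finite_component [simp]: "finite (component \<alpha>s l)"
proof -
  have "component \<alpha>s l \<subseteq> fst ` set \<alpha>s" by (force simp: component_def)
  then show ?thesis by (rule finite_subset) simp
qed

lemma card_degree_le_Suc:
  assumes "finite E"
  shows "card {\<eta> \<in> E. vdeg m \<eta> \<le> Suc p} = card {\<eta> \<in> E. vdeg m \<eta> \<le> p} + card {\<eta> \<in> E. vdeg m \<eta> = Suc p}"
proof -
  have "{\<eta> \<in> E. vdeg m \<eta> \<le> Suc p} = {\<eta> \<in> E. vdeg m \<eta> \<le> p} \<union> {\<eta> \<in> E. vdeg m \<eta> = Suc p}"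
    by auto
  then show ?thesis using assms by (simp add: card_Un_disjoint disjoint_iff)
qed

text \<open>Minimal growth never shrinks a set, so earlier generators remain counted in degree
  \<open>p\<close>, and new generators come on top.\<close>

lemma card_degree_le_upset:
  assumes "antichain E" "E \<subseteq> NN (Suc m)" "finite E"
  shows "card {\<eta> \<in> E. vdeg (Suc m) \<eta> \<le> p} \<le> card (upset (Suc m) E p)"
proof (induction p)
  case 0
  then show ?case using card_degree_0_le[OF assms(2)] by simp
next
  case (Suc p)
  have "0 + card (upset (Suc m) E p) \<le> shad (Suc m) p (0 + card (upset (Suc m) E p))"
    using shad_add_le[of 0 "card (upset (Suc m) E p)" m p] card_le_nmon[OF upset_subset] by simp
  then show ?case
    using Suc card_upset_Suc(2)[OF assms(1,2), of p] card_degree_le_Suc[OF assms(3), of "Suc m" p]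
    by simp
qed

lemma card_pdeg_le:
  assumes "antichain_seq m n \<alpha>s"
  shows "card {\<alpha> \<in> set \<alpha>s. pdeg m \<alpha> \<le> p} = (\<Sum>l=1..n. card {\<eta> \<in> component \<alpha>s l. vdeg m \<eta> \<le> p})"
proof -
  let ?S = "SIGMA l:{1..n}. {\<eta> \<in> component \<alpha>s l. vdeg m \<eta> \<le> p}"
  have "{\<alpha> \<in> set \<alpha>s. pdeg m \<alpha> \<le> p} = prod.swap ` ?S"
  proof
    show "prod.swap ` ?S \<subseteq> {\<alpha> \<in> set \<alpha>s. pdeg m \<alpha> \<le> p}"
      by (auto simp: component_def pdeg_def)
    show "{\<alpha> \<in> set \<alpha>s. pdeg m \<alpha> \<le> p} \<subseteq> prod.swap ` ?S"
    proof
      fix \<alpha> assume "\<alpha> \<in> {\<alpha> \<in> set \<alpha>s. pdeg m \<alpha> \<le> p}"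
      moreover obtain \<eta> l where "\<alpha> = (\<eta>, l)" by (cases \<alpha>)
      ultimately have "\<eta> \<in> component \<alpha>s l" "vdeg m \<eta> \<le> p" "\<alpha> = prod.swap (l, \<eta>)"
        by (auto simp: component_def pdeg_def)
      moreover from this(1) have "l \<in> {1..n}" by (rule antichain_seq_component(3)[OF assms])
      ultimately show "\<alpha> \<in> prod.swap ` ?S" by (intro image_eqI[of _ _ "(l, \<eta>)"]) auto
    qed
  qed
  then have "card {\<alpha> \<in> set \<alpha>s. pdeg m \<alpha> \<le> p} = card ?S"
    by (simp add: card_image)
  also have "\<dots> = (\<Sum>l=1..n. card {\<eta> \<in> component \<alpha>s l. vdeg m \<eta> \<le> p})"
    by (rule card_SigmaI) auto
  finally show ?thesis .
qed

text \<open>The degree in which component \<open>j + 1\<close> is started: a component started in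
  degree \<open>c\<close> is full in degree \<open>c + zlen m c\<close>, and the next one starts one
  degree later. For \<open>2 \<le> m\<close> and \<open>1 \<le> r\<close>, \<open>cseq m r n\<close>
  will be the value of \<open>C_num r m n\<close>.\<close>

primrec cseq :: "nat \<Rightarrow> nat \<Rightarrow> nat \<Rightarrow> nat" where
  "cseq m r 0 = r"
| "cseq m r (Suc j) = Suc (cseq m r j + zlen m (cseq m r j))"

lemma cseq_ge: "r + j \<le> cseq m r j"
  by (induction j) auto

lemma cseq_mono: "i \<le> j \<Longrightarrow> cseq m r i \<le> cseq m r j"
  by (rule lift_Suc_mono_le[of "cseq m r"]) auto

lemma cseq_add: "cseq m r (i + j) = cseq m (cseq m r i) j"
  by (induction j) auto

text \<open>For \<open>cseq m r j \<le> p < cseq m r (Suc j)\<close> the sequential lexicographic antichain has \<open>thresh r j p\<close>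
  elements of degree at most \<open>p\<close>, and the ideals they generate have \<open>ideal_size m r j p\<close> elements of
  degree \<open>p\<close>: \<open>j\<close> components are full, and the next one is being filled.\<close>

definition thresh :: "nat \<Rightarrow> nat \<Rightarrow> nat \<Rightarrow> nat" where
  "thresh r j p = p - r + 2 + j"

definition ideal_size :: "nat \<Rightarrow> nat \<Rightarrow> nat \<Rightarrow> nat \<Rightarrow> nat" where
  "ideal_size m r j p = j * nmon m p + zrun m (cseq m r j) (p - cseq m r j)"

context
  fixes m r :: nat
  assumes m: "2 \<le> m" and r: "1 \<le> r"
begin

lemma cseq_ge_1: "1 \<le> cseq m r j"
  using cseq_ge[of r j m] r by simp

lemma ideal_size_step:
  assumes "cseq m r j \<le> p" "Suc p < cseq m r (Suc j)"
  shows "ideal_size m r j (Suc p) = growth m p (ideal_size m r j p) + 1"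
proof -
  let ?c = "cseq m r j"
  obtain m' where m': "m = Suc m'" using m by (cases m) auto
  define i where "i = p - ?c"
  have p: "p = ?c + i" using assms(1) by (simp add: i_def)
  have "zrun_open m ?c i" using zrun_open_iff[OF m cseq_ge_1] assms(2) p by simp
  then have "zrun m ?c i \<le> nmon m p" using zrun_le[OF m cseq_ge_1] p by simp
  then have "growth m p (ideal_size m r j p) = j * nmon m (Suc p) + shad m p (zrun m ?c i)"
    using growth_eq[of "zrun m ?c i" m' p j] m' by (simp add: ideal_size_def i_def)
  moreover have "Suc p - ?c = Suc i" using p by simp
  ultimately show ?thesis by (simp add: ideal_size_def p)
qed

lemma ideal_size_end:
  assumes "Suc p = cseq m r (Suc j)"
  shows "ideal_size m r j p = Suc j * nmon m p"
  using zrun_zlen[OF m cseq_ge_1, of j] assms by (simp add: ideal_size_def)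

lemma ideal_size_cross:
  assumes "Suc p = cseq m r (Suc j)"
  shows "ideal_size m r (Suc j) (Suc p) = growth m p (ideal_size m r j p) + 2"
proof -
  obtain m' where m': "m = Suc m'" using m by (cases m) auto
  have "growth m p (Suc j * nmon m p) = Suc j * nmon m (Suc p)"
    using growth_eq[of 0 m' p "Suc j"] m' by simp
  moreover have "ideal_size m r (Suc j) (Suc p) = Suc j * nmon m (Suc p) + zrun m (Suc p) 0"
    by (simp only: ideal_size_def assms[symmetric] diff_self_eq_0)
  ultimately show ?thesis unfolding ideal_size_end[OF assms] by simp
qed

text \<open>An excess in the number of elements must be matched by at least the same excess in size; this
  form is inductive because \<open>growth\<close> is strictly increasing.\<close>

definition ahead :: "(nat \<Rightarrow> nat) \<Rightarrow> (nat \<Rightarrow> nat) \<Rightarrow> nat \<Rightarrow> nat \<Rightarrow> bool" where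
  "ahead X N j p \<longleftrightarrow> thresh r j p \<le> N p \<and> ideal_size m r j p + N p \<le> X p + thresh r j p"

lemma ahead_step:
  assumes "ahead X N j p" "growth m p (X p) + N (Suc p) \<le> X (Suc p) + N p"
    and "ideal_size m r j' (Suc p) = growth m p (ideal_size m r j p) + d"
    and "thresh r j' (Suc p) = thresh r j p + d" "thresh r j' (Suc p) \<le> N (Suc p)"
  shows "ahead X N j' (Suc p)"
proof -
  obtain m' where m': "m = Suc m'" using m by (cases m) auto
  have *: "thresh r j p \<le> N p" "ideal_size m r j p + (N p - thresh r j p) \<le> X p"
    using assms(1) by (auto simp: ahead_def)
  have "growth m p (ideal_size m r j p) + (X p - ideal_size m r j p) \<le> growth m p (X p)"
    using growth_add_ge[of m' p "ideal_size m r j p" "X p - ideal_size m r j p"] * m' by simp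
  then show ?thesis using assms(2-) * unfolding ahead_def by linarith
qed

text \<open>Abstract because there are two competitors: \<open>N\<close> counts the elements of an
  antichain in \<open>length_le_cseq\<close>, and failures with a surcharge per component in
  \<open>D_cond_bounded\<close>. \<open>step\<close> and \<open>cross\<close> say that the
  competitor's count keeps up with the reference count.\<close>

lemma race:
  assumes start: "2 \<le> N r" "N r \<le> X r"
    and grow: "\<And>p. r \<le> p \<Longrightarrow> Suc p < cseq m r n \<Longrightarrow> growth m p (X p) + N (Suc p) \<le> X (Suc p) + N p"
    and step: "\<And>j p. j < n \<Longrightarrow> cseq m r j \<le> p \<Longrightarrow> Suc p < cseq m r (Suc j) \<Longrightarrow> ahead X N j p \<Longrightarrow>
      thresh r j (Suc p) \<le> N (Suc p)"
    and cross: "\<And>j p. Suc j < n \<Longrightarrow> Suc p = cseq m r (Suc j) \<Longrightarrow> ahead X N j p \<Longrightarrow>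
      thresh r (Suc j) (Suc p) \<le> N (Suc p)"
    and j: "j < n" "cseq m r j \<le> p" "p < cseq m r (Suc j)"
  shows "ahead X N j p"
  using j
proof (induction p arbitrary: j)
  case 0
  then show ?case using cseq_ge_1[of j] by simp
next
  case (Suc p)
  have le_n: "cseq m r (Suc j) \<le> cseq m r n" by (rule cseq_mono) (use Suc.prems in simp)
  consider "Suc p = r" | "r \<le> p" using Suc.prems(2) cseq_ge[of r j m] by linarith
  then show ?case
  proof cases
    case 1
    then have "j = 0" using Suc.prems(2) cseq_ge[of r j m] by linarith
    then show ?thesis using start 1 by (simp add: ahead_def thresh_def ideal_size_def)
  next
    case 2
    have grow': "growth m p (X p) + N (Suc p) \<le> X (Suc p) + N p"
      by (rule grow[OF 2]) (use Suc.prems le_n in simp)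
    show ?thesis
    proof (cases "cseq m r j \<le> p")
      case True
      have IH: "ahead X N j p" using Suc.IH[OF Suc.prems(1) True] Suc.prems(3) by simp
      show ?thesis
        by (rule ahead_step[OF IH grow' ideal_size_step[OF True Suc.prems(3)] _ step[OF Suc.prems(1) True Suc.prems(3) IH]])
           (use 2 in \<open>simp add: thresh_def\<close>)
    next
      case False
      then have p: "Suc p = cseq m r j" using Suc.prems(2) by simp
      have "j \<noteq> 0" using p 2 by (cases j) auto
      then obtain j' where j': "j = Suc j'" by (cases j) auto
      have IH: "ahead X N j' p"
        by (rule Suc.IH) (use Suc.prems(1) p j' in auto)
      note p' = p[unfolded j']
      show ?thesis
        unfolding j'
        by (rule ahead_step[OF IH grow' ideal_size_cross[OF p'] _ cross[OF Suc.prems(1)[unfolded j'] p' IH]])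
           (use 2 in \<open>simp add: thresh_def\<close>)
    qed
  qed
qed

lemma thresh_last:
  assumes "Suc p = cseq m r (Suc j)"
  shows "thresh r j p = cseq m r (Suc j) - r + Suc j"
  using assms cseq_ge[of r "Suc j" m] by (simp add: thresh_def)

lemma length_le_cseq:
  assumes seq: "antichain_seq m n \<alpha>s" and n: "1 \<le> n"
    and deg: "\<And>j p i. j < n \<Longrightarrow> cseq m r j \<le> p \<Longrightarrow> p < cseq m r (Suc j) \<Longrightarrow> i < length \<alpha>s \<Longrightarrow>
      i < thresh r j p \<Longrightarrow> pdeg m (\<alpha>s ! i) \<le> p"
  shows "length \<alpha>s \<le> cseq m r n - r + n"
proof (rule ccontr)
  assume long: "\<not> ?thesis"
  obtain m' where m': "m = Suc m'" using m by (cases m) auto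
  note E = antichain_seq_component[OF seq]
  define X where "X p = (\<Sum>l=1..n. card (upset m (component \<alpha>s l) p))" for p
  define N where "N p = card {\<alpha> \<in> set \<alpha>s. pdeg m \<alpha> \<le> p}" for p
  have N: "N p = (\<Sum>l=1..n. card {\<eta> \<in> component \<alpha>s l. vdeg m \<eta> \<le> p})" for p
    unfolding N_def by (rule card_pdeg_le[OF seq])
  have X_le: "X p \<le> n * nmon m p" for p
    using sum_bounded_above[of "{1..n}" "\<lambda>l. card (upset m (component \<alpha>s l) p)" "nmon m p"]
      card_le_nmon[OF upset_subset] by (simp add: X_def)
  have NX: "N p \<le> X p" for p
    unfolding N X_def
    by (rule sum_mono) (use card_degree_le_upset[OF E(2) _ finite_component] E(1) m' in simp)
  have grow: "growth m p (X p) + N (Suc p) \<le> X (Suc p) + N p" for p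
  proof -
    have "growth m p (X p) \<le> (\<Sum>l=1..n. shad m p (card (upset m (component \<alpha>s l) p)))"
      unfolding X_def m' by (rule growth_sum_le) (auto intro: card_le_nmon[OF upset_subset])
    moreover have "(\<Sum>l=1..n. shad m p (card (upset m (component \<alpha>s l) p))
          + card {\<eta> \<in> component \<alpha>s l. vdeg m \<eta> = Suc p}) \<le> X (Suc p)"
      unfolding X_def by (rule sum_mono, rule card_upset_Suc(2)[OF E(2,1)])
    moreover have "N (Suc p) = N p + (\<Sum>l=1..n. card {\<eta> \<in> component \<alpha>s l. vdeg m \<eta> = Suc p})"
      unfolding N by (simp add: card_degree_le_Suc sum.distrib)
    ultimately show ?thesis by (simp add: sum.distrib)
  qed
  have N_ge: "thresh r j p \<le> N p" if "j < n" "cseq m r j \<le> p" "p < cseq m r (Suc j)" for j p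
  proof -
    have "thresh r j p \<le> cseq m r (Suc j) - r + Suc j"
      using that cseq_ge[of r j m] by (simp add: thresh_def del: cseq.simps)
    also have "\<dots> \<le> cseq m r n - r + n" using cseq_mono[of "Suc j" n m r] that by simp
    finally have len: "thresh r j p \<le> length \<alpha>s" using long by simp
    have "card ((!) \<alpha>s ` {..<thresh r j p}) = thresh r j p"
      using len E(4) by (subst card_image) (auto simp: inj_on_def nth_eq_iff_index_eq)
    moreover have "(!) \<alpha>s ` {..<thresh r j p} \<subseteq> {\<alpha> \<in> set \<alpha>s. pdeg m \<alpha> \<le> p}"
      using len deg[OF that] by auto
    ultimately show ?thesis unfolding N_def by (metis card_mono finite_set finite_filter List.finite_set Collect_mem_eq finite_Collect_conjI)
  qed
  define p where "p = cseq m r n - 1"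
  have p: "Suc p = cseq m r (Suc (n - 1))" using cseq_ge_1[of n] n by (simp add: p_def)
  have cp: "cseq m r (n - 1) \<le> p" using p n by (cases n) auto
  have "ahead X N (n - 1) p"
  proof (rule race[of N X n])
    show "2 \<le> N r" using N_ge[of 0 r] n by (simp add: thresh_def)
    show "N r \<le> X r" by (rule NX)
    show "n - 1 < n" using n by simp
    show "cseq m r (n - 1) \<le> p" by (rule cp)
    show "p < cseq m r (Suc (n - 1))" using p by simp
  next
    fix j p' assume "Suc j < n" "Suc p' = cseq m r (Suc j)"
    then show "thresh r (Suc j) (Suc p') \<le> N (Suc p')" by (intro N_ge) auto
  qed (auto intro: grow N_ge)
  then have *: "thresh r (n - 1) p \<le> N p" "n * nmon m p + N p \<le> X p + thresh r (n - 1) p"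
    using ideal_size_end[OF p] n by (auto simp: ahead_def)
  have thr: "thresh r (n - 1) p = cseq m r n - r + n" using thresh_last[OF p] n by simp
  \<comment> \<open>The reference has all \<open>n\<close> components full in degree
    \<open>p\<close>, so \<open>X\<close> cannot exceed it and the count is capped by the threshold;
    a longer sequence has an element of higher degree.\<close>
  have "N p < card (set \<alpha>s)" using * X_le[of p] thr long distinct_card[OF E(4)] by linarith
  then have "{\<alpha> \<in> set \<alpha>s. pdeg m \<alpha> \<le> p} \<noteq> set \<alpha>s" unfolding N_def by auto
  then obtain \<alpha> where "\<alpha> \<in> set \<alpha>s" "\<not> pdeg m \<alpha> \<le> p" by auto
  moreover obtain \<eta> l where "\<alpha> = (\<eta>, l)" by (cases \<alpha>)
  ultimately have \<alpha>: "(\<eta>, l) \<in> set \<alpha>s" "p < vdeg m \<eta>" by (auto simp: pdeg_def)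
  then have \<eta>: "\<eta> \<in> component \<alpha>s l" by (simp add: component_def)
  have l: "l \<in> {1..n}" by (rule E(3)[OF \<eta>])
  have "X p = n * nmon m p" using * X_le[of p] by linarith
  have "card (upset m (component \<alpha>s l) p) = nmon m p"
  proof (rule ccontr)
    assume "\<not> ?thesis"
    then have "card (upset m (component \<alpha>s l) p) < nmon m p"
      using card_le_nmon[OF upset_subset, of m "component \<alpha>s l" p] by simp
    then have "X p < (\<Sum>l=1..n. nmon m p)"
      unfolding X_def using l card_le_nmon[OF upset_subset] by (intro sum_strict_mono_ex1) auto
    then show False using \<open>X p = n * nmon m p\<close> by simp
  qed
  \<comment> \<open>In a full component, an element of degree above \<open>p\<close> lies above some
    monomial of degree \<open>p\<close> and thus above another generator.\<close>
  then have full: "upset m (component \<alpha>s l) p = mons m p"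
    by (intro card_subset_eq) (simp_all add: upset_subset card_mons)
  have "\<exists>\<sigma>\<in>mons m p. (\<lambda>_. 0) \<le> \<sigma> \<and> \<sigma> \<le> \<eta>"
    by (rule ex_mons_between) (use \<alpha>(2) E(1) \<eta> in \<open>auto simp: le_fun_def vdeg_def\<close>)
  then obtain \<sigma> where \<sigma>: "\<sigma> \<in> mons m p" "\<sigma> \<le> \<eta>" by auto
  then obtain \<beta> where \<beta>: "\<beta> \<in> component \<alpha>s l" "\<beta> \<le> \<sigma>" using full by (auto simp: upset_def)
  have "\<beta> = \<eta>" using E(2)[of l] \<beta>(1) \<eta> order.trans[OF \<beta>(2) \<sigma>(2)] by (simp add: antichain_def)
  then have "\<eta> \<le> \<sigma>" using \<beta>(2) by simp
  from vdeg_mono[OF this, of m] show False using \<alpha>(2) \<sigma>(1) by (simp add: mons_def)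
qed

text \<open>A component \<open>l\<close> is counted in \<open>S p\<close> once it has caused a failure in some degree up to \<open>p\<close>. Each
  failure adds an element beyond the minimal growth, and the first failure of a component adds two.
  When the lexicographic antichain enters a new component, a competitor that is not strictly ahead
  has only full components, so that it has to start a new one as well.\<close>

lemma D_cond_bounded:
  assumes seq: "antichain_seq m n \<alpha>s" and n: "1 \<le> n"
  shows "\<exists>p. r \<le> p \<and> p \<le> cseq m r n \<and> D_cond m n \<alpha>s p"
proof (rule ccontr)
  assume "\<not> ?thesis"
  then have fail: "\<not> D_cond m n \<alpha>s p" if "r \<le> p" "p \<le> cseq m r n" for p
    using that by blast
  obtain m' where m': "m = Suc m'" using m by (cases m) auto
  note E = antichain_seq_component[OF seq]
  define a where "a l p = card (upset m (component \<alpha>s l) p)" for l p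
  have a_le: "a l p \<le> nmon m p" for l p
    unfolding a_def by (rule card_le_nmon[OF upset_subset])
  have shad_a: "shad m p (a l p) \<le> a l (Suc p)" for l p
    unfolding a_def using card_upset_Suc(2)[OF E(2,1), of p l] by simp
  have "\<exists>l. l \<in> {1..n} \<and> 2 \<le> a l p \<and> (\<forall>q. p = Suc q \<longrightarrow> shad m q (a l q) < a l p)"
    if p: "r \<le> p" "p \<le> cseq m r n" for p
  proof -
    obtain l \<eta> \<zeta> where l: "l \<in> {1..n}" "\<forall>q. p = Suc q \<longrightarrow> shad m q (a l q) < a l p"
      and ez: "{\<eta>, \<zeta>} \<subseteq> component \<alpha>s l" "\<eta> \<noteq> \<zeta>" "vdeg m \<eta> \<le> p" "vdeg m \<zeta> \<le> p"
      using not_D_cond_growth[OF seq fail[OF p]] unfolding a_def by blast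
    have "card {\<eta>, \<zeta>} \<le> card {\<eta> \<in> component \<alpha>s l. vdeg m \<eta> \<le> p}"
      by (rule card_mono) (use ez in auto)
    also have "\<dots> \<le> a l p"
      unfolding a_def m' by (rule card_degree_le_upset[OF E(2) _ finite_component]) (use E(1) m' in simp)
    finally show ?thesis using l ez(2) by auto
  qed
  then obtain l where l: "\<And>p. r \<le> p \<Longrightarrow> p \<le> cseq m r n \<Longrightarrow> l p \<in> {1..n}"
    "\<And>p. r \<le> p \<Longrightarrow> p \<le> cseq m r n \<Longrightarrow> 2 \<le> a (l p) p"
    "\<And>p. r \<le> Suc p \<Longrightarrow> Suc p \<le> cseq m r n \<Longrightarrow> shad m p (a (l (Suc p)) p) < a (l (Suc p)) (Suc p)"
    by metis
  define S where "S p = l ` {r..p}" for p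
  define X where "X p = (\<Sum>l\<in>S p. a l p)" for p
  \<comment> \<open>One unit for the failure in each of the degrees from \<open>r\<close> to
    \<open>p\<close>, and one more for each component involved.\<close>
  define N where "N p = p - r + 1 + card (S p)" for p
  have S_Suc: "S (Suc p) = insert (l (Suc p)) (S p)" if "r \<le> p" for p
    using that by (simp add: S_def atLeastAtMostSuc_conv)
  have fin: "finite (S p)" for p by (simp add: S_def)
  have S_sub: "S p \<subseteq> {1..n}" if "p \<le> cseq m r n" for p
    using l(1) that by (auto simp: S_def)
  have X_le: "X p \<le> card (S p) * nmon m p" for p
    using sum_bounded_above[of "S p" "\<lambda>l. a l p" "nmon m p"] a_le by (simp add: X_def)
  have N_Suc: "N (Suc p) = N p + (if l (Suc p) \<in> S p then 1 else 2)" if "r \<le> p" for p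
    using that fin by (simp add: N_def S_Suc insert_absorb)
  have grow: "growth m p (X p) + N (Suc p) \<le> X (Suc p) + N p"
    if p: "r \<le> p" "Suc p \<le> cseq m r n" for p
  proof -
    let ?l = "l (Suc p)"
    have G: "growth m p (X p) \<le> (\<Sum>l\<in>S p. shad m p (a l p))"
      unfolding X_def m' by (rule growth_sum_le[OF fin]) (use a_le m' in simp)
    show ?thesis
    proof (cases "?l \<in> S p")
      case True
      have "(\<Sum>l\<in>S p. shad m p (a l p)) < (\<Sum>l\<in>S p. a l (Suc p))"
        by (rule sum_strict_mono_ex1[OF fin]) (use shad_a l(3)[of p] p True in auto)
      then show ?thesis using G N_Suc[OF p(1)] True p by (simp add: X_def S_Suc insert_absorb)
    next
      case False
      have "(\<Sum>l\<in>S p. shad m p (a l p)) \<le> (\<Sum>l\<in>S p. a l (Suc p))"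
        by (rule sum_mono) (rule shad_a)
      moreover have "2 \<le> a ?l (Suc p)" using l(2) p by simp
      moreover have "X (Suc p) = a ?l (Suc p) + (\<Sum>l\<in>S p. a l (Suc p))"
        using False fin p by (simp add: X_def S_Suc)
      ultimately show ?thesis using G N_Suc[OF p(1)] False by simp
    qed
  qed
  \<comment> \<open>A full component grows to all monomials already by the minimal bound, which
    leaves no room for strict growth; the next failure must occur outside
    \<open>S p\<close>.\<close>
  have new: "l (Suc p) \<notin> S p" if "card (S p) * nmon m p \<le> X p" "r \<le> p" "Suc p \<le> cseq m r n" for p
  proof
    assume mem: "l (Suc p) \<in> S p"
    have "a (l (Suc p)) p = nmon m p"
    proof (rule ccontr)
      assume "\<not> ?thesis"
      then have "a (l (Suc p)) p < nmon m p" using a_le[of "l (Suc p)" p] by simp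
      then have "X p < (\<Sum>l\<in>S p. nmon m p)"
        unfolding X_def by (intro sum_strict_mono_ex1[OF fin]) (use mem a_le in auto)
      then show False using that(1) by simp
    qed
    then have "nmon m (Suc p) < a (l (Suc p)) (Suc p)"
      using l(3)[of p] that shad_nmon[of m p] by simp
    then show False using a_le[of "l (Suc p)" "Suc p"] by simp
  qed
  define p where "p = cseq m r n - 1"
  have p: "Suc p = cseq m r (Suc (n - 1))" using cseq_ge_1[of n] n by (simp add: p_def)
  have cp: "cseq m r (n - 1) \<le> p" using p n by (cases n) auto
  have Suc_p: "Suc p = cseq m r n" using p n by simp
  have "ahead X N (n - 1) p"
  proof (rule race[of N X n])
    have "S r = {l r}" by (simp add: S_def)
    then show "2 \<le> N r" "N r \<le> X r" using l(2)[of r] cseq_ge[of r n m] by (simp_all add: N_def X_def)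
    show "n - 1 < n" "cseq m r (n - 1) \<le> p" "p < cseq m r (Suc (n - 1))" using n cp p by auto
    show "growth m p' (X p') + N (Suc p') \<le> X (Suc p') + N p'" if "r \<le> p'" "Suc p' < cseq m r n" for p'
      by (rule grow) (use that in auto)
    show "thresh r j (Suc p') \<le> N (Suc p')" if "cseq m r j \<le> p'" "ahead X N j p'" for j p'
    proof -
      have "r \<le> p'" using that(1) cseq_ge[of r j m] by simp
      then show ?thesis using N_Suc[of p'] that(2) by (auto simp: ahead_def thresh_def Suc_diff_le)
    qed
    show "thresh r (Suc j) (Suc p') \<le> N (Suc p')"
      if j: "Suc j < n" "Suc p' = cseq m r (Suc j)" "ahead X N j p'" for j p'
    proof -
      have rp: "r \<le> p'" using j(2) cseq_ge[of r "Suc j" m] by simp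
      have le: "Suc p' \<le> cseq m r n" using j cseq_mono[of "Suc j" n m r] by simp
      have A: "thresh r j p' \<le> N p'" "Suc j * nmon m p' + N p' \<le> X p' + thresh r j p'"
        using j(3) ideal_size_end[OF j(2)] by (auto simp: ahead_def)
      have N_eq: "N p' = thresh r j p' + card (S p') - Suc j" by (simp add: N_def thresh_def)
      have ge: "Suc j \<le> card (S p')" using A(1) by (simp add: N_def thresh_def)
      have t: "thresh r (Suc j) (Suc p') = thresh r j p' + 2" using rp by (simp add: thresh_def)
      show ?thesis
      proof (cases "card (S p') = Suc j")
        case True
        then have "card (S p') * nmon m p' \<le> X p'" using A by (simp add: N_eq)
        then show ?thesis using new[OF _ rp le] N_Suc[OF rp] t A(1) by simp
      next
        case False
        then show ?thesis using ge N_eq t N_Suc[OF rp] by (auto split: if_splits)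
      qed
    qed
  qed
  then have A: "thresh r (n - 1) p \<le> N p" "n * nmon m p + N p \<le> X p + thresh r (n - 1) p"
    using ideal_size_end[OF p] n by (auto simp: ahead_def)
  have rp: "r \<le> p" using cp cseq_ge[of r "n - 1" m] by simp
  have "card (S p) \<ge> n" using A(1) n by (simp add: N_def thresh_def)
  moreover have sub: "S p \<subseteq> {1..n}" by (rule S_sub) (use Suc_p in simp)
  moreover have "card (S p) \<le> n" using card_mono[OF _ sub] by simp
  ultimately have card_S: "card (S p) = n" by simp
  then have S: "S p = {1..n}" "card (S p) = n" using card_subset_eq[OF _ sub] by simp_all
  \<comment> \<open>No excess remains, so all \<open>n\<close> components are full in degree
    \<open>cseq m r n - 1\<close>, and the failure assumed in degree \<open>cseq m r n\<close> has
    no component left.\<close>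
  have "thresh r (n - 1) p = N p" using S n by (simp add: N_def thresh_def)
  then have "card (S p) * nmon m p \<le> X p" using A S by simp
  then have "l (Suc p) \<notin> S p" by (rule new) (use rp Suc_p in auto)
  then show False using S l(1)[of "Suc p"] rp Suc_p by simp
qed

section \<open>The sequential lexicographic antichain and the values it attains\<close>

definition block :: "nat \<Rightarrow> nat \<Rightarrow> ((nat \<Rightarrow> nat) \<times> nat) list" where
  "block c l = map (\<lambda>i. (fresh m c i, l)) [0..<zlen m c + 2]"

primrec blocks :: "nat \<Rightarrow> ((nat \<Rightarrow> nat) \<times> nat) list" where
  "blocks 0 = []"
| "blocks (Suc n) = blocks n @ block (cseq m r n) (Suc n)"

text \<open>A block has two elements in its first degree and one in each later degree before the
  next start, so its length exceeds the number of its degrees by one.\<close>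

lemma length_blocks: "length (blocks n) = cseq m r n - r + n"
proof (induction n)
  case (Suc n)
  then show ?case using cseq_ge[of r n m] by (simp add: block_def)
qed simp

lemma fresh_deg:
  assumes "1 \<le> c" "i \<le> Suc (zlen m c)"
  shows "fresh m c i \<in> mons m (c + (i - 1))"
  by (rule fresh_degree[OF m assms(1)]) (use assms zrun_open_iff[OF m assms(1)] in auto)

lemma antichain_seq_blocks: "antichain_seq m n (blocks n)"
proof (induction n)
  case 0
  show ?case by (simp add: antichain_seq_def)
next
  case (Suc n)
  let ?c = "cseq m r n"
  note c = cseq_ge_1[of n]
  have inc: "\<not> fresh m ?c i \<le> fresh m ?c j \<and> \<not> fresh m ?c j \<le> fresh m ?c i"
    if "i < j" "j < zlen m ?c + 2" for i j
  proof -
    have "zrun_open m ?c (j - 1)" using that zrun_open_iff[OF m c] by auto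
    then show ?thesis using fresh_incomparable[OF m c _ that(1)] by blast
  qed
  let ?R = "\<lambda>\<alpha> \<beta>. \<not> ple \<alpha> \<beta> \<and> \<not> ple \<beta> \<alpha>"
  have "sorted_wrt ?R (block ?c (Suc n))"
    unfolding block_def sorted_wrt_iff_nth_less using inc by (auto simp: ple_def simp del: upt_Suc)
  moreover have sub: "set (block ?c (Suc n)) \<subseteq> NN m \<times> {Suc n}"
    using fresh_deg[OF c] by (auto simp: block_def mons_def simp del: upt_Suc)
  moreover have subs: "set (blocks n) \<subseteq> NN m \<times> {1..n}"
    using Suc unfolding antichain_seq_def NNn_def by simp
  moreover have "sorted_wrt ?R (blocks n)" using Suc by (simp add: antichain_seq_def)
  moreover have "?R \<alpha> \<beta>" if "\<alpha> \<in> set (blocks n)" "\<beta> \<in> set (block ?c (Suc n))" for \<alpha> \<beta>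
  proof -
    have "snd \<alpha> \<noteq> snd \<beta>" using subsetD[OF subs that(1)] subsetD[OF sub that(2)] by auto
    then show ?thesis by (simp add: ple_def)
  qed
  moreover have "NN m \<times> {1..n} \<union> NN m \<times> {Suc n} \<subseteq> NN m \<times> {1..Suc n}" by auto
  ultimately show ?case
    unfolding antichain_seq_def NNn_def sorted_wrt_append blocks.simps set_append by blast
qed

lemma blocks_nth:
  assumes "i < length (blocks n)"
  shows "\<exists>j t. j < n \<and> t \<le> Suc (zlen m (cseq m r j)) \<and> i = cseq m r j - r + j + t \<and>
    blocks n ! i = (fresh m (cseq m r j) t, Suc j)"
  using assms
proof (induction n)
  case (Suc n)
  show ?case
  proof (cases "i < length (blocks n)")
    case True
    then obtain j t where "j < n" "t \<le> Suc (zlen m (cseq m r j))" "i = cseq m r j - r + j + t"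
      "blocks n ! i = (fresh m (cseq m r j) t, Suc j)" using Suc.IH by blast
    with True show ?thesis by - (rule exI[of _ j], rule exI[of _ t], simp add: nth_append)
  next
    case False
    define t where "t = i - length (blocks n)"
    have "t < zlen m (cseq m r n) + 2" using Suc.prems False by (simp add: t_def block_def)
    moreover have "i = cseq m r n - r + n + t" using False length_blocks[of n] by (simp add: t_def)
    ultimately show ?thesis using False
      by - (rule exI[of _ n], rule exI[of _ t],
        simp add: nth_append block_def t_def[symmetric] length_blocks del: upt_Suc)
  qed
qed simp

lemma component_blocks:
  assumes "j < n" "t \<le> Suc (zlen m (cseq m r j))"
  shows "fresh m (cseq m r j) t \<in> component (blocks n) (Suc j)"
  using assms(1)
proof (induction n)
  case (Suc n)
  have "(fresh m (cseq m r n) t, Suc n) \<in> set (block (cseq m r n) (Suc n))" if "j = n"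
    using assms(2) that by (auto simp: block_def simp del: upt_Suc)
  then show ?case using Suc by (cases "j = n") (auto simp: component_def)
qed simp

text \<open>Every degree in this range contains a fresh element of index at least 1, and
  \<open>fresh_overlap\<close> provides the common multiple that \<open>not_D_condI\<close>
  needs.\<close>

lemma not_D_cond_blocks:
  assumes "r \<le> p" "p < cseq m r n"
  shows "\<not> D_cond m n (blocks n) p"
proof -
  have "\<exists>j<n. cseq m r j \<le> p \<and> p < cseq m r (Suc j)"
    using assms(2)
  proof (induction n)
    case (Suc n)
    then show ?case by (cases "p < cseq m r n") (auto simp: less_Suc_eq not_less)
  qed (use assms(1) in simp)
  then obtain j where j: "j < n" "cseq m r j \<le> p" "p < cseq m r (Suc j)" by blast
  let ?c = "cseq m r j"
  note c = cseq_ge_1[of j]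
  define i where "i = p - ?c"
  have i: "i \<le> zlen m ?c" "p = ?c + i" using j by (auto simp: i_def)
  have op: "zrun_open m ?c i" using i zrun_open_iff[OF m c] by simp
  obtain a b k \<xi> where ab: "a \<in> {1..m}" "b \<in> {1..m}" "k \<le> i" "fresh m ?c k \<le> \<xi>"
    "inc a (fresh m ?c (Suc i)) = inc b \<xi>" "fresh m ?c (Suc i) \<noteq> \<xi>"
    using fresh_overlap[OF m c op] by blast
  have deg: "vdeg m (fresh m ?c (Suc i)) = p"
    using fresh_deg[OF c, of "Suc i"] i by (simp add: mons_def)
  show ?thesis
    by (rule not_D_condI[OF antichain_seq_blocks component_blocks[OF j(1)] deg ab(1,2,5,6) component_blocks[OF j(1)] ab(4)])
       (use i ab(3) in auto)
qed

lemma C_num_eq_cseq: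
  assumes "1 \<le> n"
  shows "C_num r m n = cseq m r n"
proof -
  have le: "D_num r m n \<alpha>s \<le> cseq m r n" if seq: "antichain_seq m n \<alpha>s" for \<alpha>s
  proof -
    obtain p where p: "r \<le> p" "p \<le> cseq m r n" "D_cond m n \<alpha>s p"
      using D_cond_bounded[OF seq assms] by blast
    then have "D_num r m n \<alpha>s \<le> p" unfolding D_num_def by (intro Least_le) simp
    then show ?thesis using p(2) by simp
  qed
  have "\<exists>p. r \<le> p \<and> D_cond m n (blocks n) p"
    using D_cond_bounded[OF antichain_seq_blocks assms] by blast
  then have "r \<le> D_num r m n (blocks n) \<and> D_cond m n (blocks n) (D_num r m n (blocks n))"
    unfolding D_num_def by (rule LeastI_ex)
  then have "cseq m r n \<le> D_num r m n (blocks n)" using not_D_cond_blocks not_less by blast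
  then have eq: "D_num r m n (blocks n) = cseq m r n" using le[OF antichain_seq_blocks] by simp
  show ?thesis unfolding C_num_def
  proof (rule Max_eqI)
    show "finite {D_num r m n \<alpha>s |\<alpha>s. antichain_seq m n \<alpha>s}"
      by (rule finite_subset[of _ "{..cseq m r n}"]) (use le in auto)
    show "cseq m r n \<in> {D_num r m n \<alpha>s |\<alpha>s. antichain_seq m n \<alpha>s}"
      using eq antichain_seq_blocks by (intro CollectI exI[of _ "blocks n"]) simp
  qed (use le in auto)
qed

text \<open>Closed form on the positions of component \<open>j + 1\<close>. With
  \<open>c = cseq m r j\<close>, position \<open>c - r + j + 1 + t\<close> gets \<open>c\<close> for
  \<open>t = 0\<close> and \<open>i + r - j - 2 = c + t - 1\<close> afterwards, which are the
  degrees of the fresh monomials.\<close>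

lemma g_fun_eq:
  assumes "\<And>k. 1 \<le> k \<Longrightarrow> k < n \<Longrightarrow> L_num (g_fun r m k) m k = cseq m r k - r + k"
    and "j < n" "cseq m r j - r + j < i" "i \<le> cseq m r (Suc j) - r + Suc j"
  shows "g_fun r m n i = (if i = Suc (cseq m r j - r + j) then cseq m r j else i + r - j - 2)"
  using assms
proof (induction n)
  case (Suc n)
  show ?case
  proof (cases n)
    case 0
    then show ?thesis using Suc.prems by auto
  next
    case (Suc n')
    define L where "L = L_num (g_fun r m n) m n"
    have L: "L = cseq m r n - r + n" unfolding L_def by (rule Suc.prems(1)) (use Suc in auto)
    have rn: "L + r - n = cseq m r n" using cseq_ge[of r n m] L by simp
    have g: "g_fun r m (Suc n) i = (if i \<le> L then g_fun r m n i
        else if i = L + 1 then cseq m r n else i + cseq m r n - L - 2)"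
      using rn unfolding Suc L_def by (simp add: Let_def)
    show ?thesis
    proof (cases "j = n")
      case True
      then show ?thesis using g L Suc.prems(3) cseq_ge[of r n m] by auto
    next
      case False
      then have jn: "j < n" using Suc.prems by simp
      have "cseq m r (Suc j) - r + Suc j \<le> L"
        using cseq_mono[of "Suc j" n m r] jn unfolding L by simp
      then have "g_fun r m (Suc n) i = g_fun r m n i" using g Suc.prems(4) by simp
      then show ?thesis using Suc.IH[OF _ jn Suc.prems(3,4)] Suc.prems(1) by simp
    qed
  qed
qed simp

lemma L_num_eq_cseq:
  assumes "1 \<le> n"
  shows "L_num (g_fun r m n) m n = cseq m r n - r + n"
  using assms
proof (induction n rule: less_induct)
  case (less n)
  let ?L = "cseq m r n - r + n" and ?g = "g_fun r m n"
  note g = g_fun_eq[OF less.IH, where n = n]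
  have bounded: "length \<alpha>s \<le> ?L"
    if seq: "antichain_seq m n \<alpha>s" and deg: "\<forall>i\<in>{1..length \<alpha>s}. pdeg m (\<alpha>s ! (i - 1)) \<le> ?g i" for \<alpha>s
  proof (rule length_le_cseq[OF seq less.prems])
    fix j p i assume j: "j < n" "cseq m r j \<le> p" "p < cseq m r (Suc j)"
      and i: "i < length \<alpha>s" "i < thresh r j p"
    have rj: "r + j \<le> cseq m r j" by (rule cseq_ge)
    \<comment> \<open>Position \<open>Suc i\<close> may fall into the range of an earlier component;
      the bound there stays below the next starting degree and hence is at most
      \<open>p\<close>.\<close>
    have "\<exists>j'\<le>j. cseq m r j' - r + j' < Suc i \<and> Suc i \<le> cseq m r (Suc j') - r + Suc j'"
    proof -
      have "i < cseq m r (Suc j) - r + Suc j"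
        using i(2) j rj by (simp add: thresh_def del: cseq.simps)
      then show ?thesis
      proof (induction j)
        case 0
        then show ?case by auto
      next
        case (Suc j)
        show ?case
        proof (cases "i < cseq m r (Suc j) - r + Suc j")
          case True
          then show ?thesis using Suc.IH le_SucI by blast
        next
          case False
          then show ?thesis using Suc.prems
            by (intro exI[of _ "Suc j"]) (simp add: not_less del: cseq.simps)
        qed
      qed
    qed
    then obtain j' where j': "j' \<le> j" "cseq m r j' - r + j' < Suc i"
      "Suc i \<le> cseq m r (Suc j') - r + Suc j'" by blast
    have rj': "r + j' \<le> cseq m r j'" by (rule cseq_ge)
    have mono: "cseq m r j' \<le> cseq m r j" by (rule cseq_mono[OF j'(1)])
    have gi: "?g (Suc i) = (if Suc i = Suc (cseq m r j' - r + j') then cseq m r j' else Suc i + r - j' - 2)"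
      by (rule g) (use j' j in auto)
    have "?g (Suc i) \<le> p"
    proof (cases "Suc i = Suc (cseq m r j' - r + j') \<or> j' = j")
      case True
      then show ?thesis using gi mono j(2) i(2) rj by (auto simp: thresh_def)
    next
      case False
      then have "cseq m r (Suc j') \<le> cseq m r j" using j'(1) by (intro cseq_mono) simp
      then show ?thesis using gi False j'(3) j(2) rj' cseq_ge[of r "Suc j'" m] by simp
    qed
    moreover have "pdeg m (\<alpha>s ! i) \<le> ?g (Suc i)" using deg i(1) by (force dest: bspec[of _ _ "Suc i"])
    ultimately show "pdeg m (\<alpha>s ! i) \<le> p" by simp
  qed
  have deg: "pdeg m (blocks n ! (i - 1)) \<le> ?g i" if i: "i \<in> {1..length (blocks n)}" for i
  proof -
    have idx: "i - 1 < length (blocks n)" using i by auto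
    obtain j t where jt: "j < n" "t \<le> Suc (zlen m (cseq m r j))" "i - 1 = cseq m r j - r + j + t"
      "blocks n ! (i - 1) = (fresh m (cseq m r j) t, Suc j)"
      using blocks_nth[OF idx] by blast
    have rj: "r + j \<le> cseq m r j" by (rule cseq_ge)
    have "?g i = (if i = Suc (cseq m r j - r + j) then cseq m r j else i + r - j - 2)"
      by (rule g) (use jt i rj in auto)
    moreover have "pdeg m (blocks n ! (i - 1)) = cseq m r j + (t - 1)"
      using fresh_deg[OF cseq_ge_1 jt(2)] jt(4) by (simp add: pdeg_def mons_def)
    ultimately show ?thesis using jt(3) i rj by auto
  qed
  show ?case unfolding L_num_def
  proof (rule Max_eqI)
    show "finite {length \<alpha>s |\<alpha>s. antichain_seq m n \<alpha>s \<and>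
        (\<forall>i\<in>{1..length \<alpha>s}. pdeg m (\<alpha>s ! (i - 1)) \<le> ?g i)}"
      by (rule finite_subset[of _ "{..?L}"]) (use bounded in auto)
    show "?L \<in> {length \<alpha>s |\<alpha>s. antichain_seq m n \<alpha>s \<and>
        (\<forall>i\<in>{1..length \<alpha>s}. pdeg m (\<alpha>s ! (i - 1)) \<le> ?g i)}"
      using antichain_seq_blocks deg length_blocks[of n] by (intro CollectI exI[of _ "blocks n"]) simp
  qed (use bounded in auto)
qed

end

section \<open>Two variables, and the degenerate parameters\<close>

lemma cseq_2: "1 \<le> r \<Longrightarrow> cseq 2 r n = 2 ^ n * r"
proof (induction n)
  case (Suc n)
  have "zlen 2 c = c - 1" if c: "1 \<le> c" for c
  proof -
    have nm: "nmon 2 q = Suc q" for q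
      by (induction q) (simp_all add: numeral_2_eq_2 nmon_one)
    have shad2: "1 \<le> a \<Longrightarrow> a \<le> Suc q \<Longrightarrow> shad 2 q a = Suc a" for a q
    proof (induction q)
      case (Suc q)
      show ?case
      proof (cases "a \<le> Suc q")
        case True
        then show ?thesis using Suc shad_Suc_indep[of a 2 q] nm[of q] by simp
      next
        case False
        then have "a = nmon 2 (Suc q)" using Suc.prems nm by simp
        then show ?thesis using shad_nmon[of 2 "Suc q"] nm by simp
      qed
    qed (simp add: numeral_2_eq_2)
    \<comment> \<open>A nonempty segment gains one monomial through its shadow and one fresh
      monomial. The size \<open>2 + 2 * i\<close> reaches the \<open>c + i + 1\<close> monomials of
      degree \<open>c + i\<close> at \<open>i = c - 1\<close>, so the next start is
      \<open>2 * c\<close>.\<close>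
    have z: "zrun 2 c i = 2 + 2 * i" if "i < c" for i
      using that by (induction i) (simp_all add: shad2)
    show ?thesis unfolding zlen_def[OF order.refl c]
    proof (rule Least_equality)
      show "nmon 2 (c + (c - 1)) \<le> zrun 2 c (c - 1)" using z[of "c - 1"] c nm by simp
      show "c - 1 \<le> i" if "nmon 2 (c + i) \<le> zrun 2 c i" for i
        using z[of i] nm[of "c + i"] that by (cases "i < c") auto
    qed
  qed
  from this[of "2 ^ n * r"] show ?case using Suc by simp
qed simp

text \<open>The cases excluded so far; for \<open>m = 1\<close> or \<open>r = 0\<close> there are fewer than two monomials of degree \<open>r\<close>.\<close>

lemma C_num_trivial:
  assumes "m = 1 \<or> r = 0"
  shows "C_num r m n = r"
proof -
  have "D_cond m n \<alpha>s r" if seq: "antichain_seq m n \<alpha>s" for \<alpha>s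
  proof (cases "m = 1")
    case True
    then show ?thesis unfolding D_cond_def by auto
  next
    case False
    then have r: "r = 0" using assms by simp
    show ?thesis
    proof (rule ccontr)
      assume "\<not> ?thesis"
      from not_D_cond_growth[OF seq this] obtain l \<eta> \<zeta> where
        ez: "{\<eta>, \<zeta>} \<subseteq> component \<alpha>s l" "\<eta> \<noteq> \<zeta>" "vdeg m \<eta> \<le> r" "vdeg m \<zeta> \<le> r" by blast
      then have "\<eta> \<in> mons m 0" "\<zeta> \<in> mons m 0"
        using antichain_seq_component(1)[OF seq, of l] r by (auto simp: mons_def)
      then show False using ez(2) by (simp add: mons_0)
    qed
  qed
  then have D: "D_num r m n \<alpha>s = r" if "antichain_seq m n \<alpha>s" for \<alpha>s
    unfolding D_num_def using that by (intro Least_equality) auto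
  have "antichain_seq m n []" by (simp add: antichain_seq_def)
  with D[OF this] have "r \<in> {D_num r m n \<alpha>s |\<alpha>s. antichain_seq m n \<alpha>s}" by force
  then have "{D_num r m n \<alpha>s |\<alpha>s. antichain_seq m n \<alpha>s} = {r}" using D by auto
  then show ?thesis by (simp add: C_num_def)
qed

text \<open>Among \<open>n + 1\<close> elements two share a component, and there they are
  comparable: for \<open>m = 1\<close> the order is total, and for \<open>r = 0\<close> the earlier
  one is zero because \<open>g_n\<close> vanishes on the first \<open>n\<close> positions. The zero
  tuples of the \<open>n\<close> components attain the bound.\<close>

lemma L_num_trivial:
  assumes "m = 1 \<or> r = 0" "1 \<le> n"
  shows "L_num (g_fun r m n) m n = n"
  using assms(2)
proof (induction n rule: less_induct)
  case (less n)
  let ?g = "g_fun r m n"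
  have g0: "g_fun 0 m k i = 0" if "r = 0" "1 \<le> k" "k \<le> n" "i \<le> k" for k i
    using that(2-)
  proof (induction k)
    case (Suc k)
    show ?case
    proof (cases k)
      case 0
      then show ?thesis using Suc.prems by simp
    next
      case (Suc k')
      have L: "L_num (g_fun 0 m k) m k = k" using less.IH[of k] Suc Suc.prems \<open>r = 0\<close> by simp
      show ?thesis using Suc.IH Suc.prems L unfolding Suc by (auto simp: Let_def)
    qed
  qed simp
  have bounded: "length \<alpha>s \<le> n"
    if seq: "antichain_seq m n \<alpha>s" and deg: "\<forall>i\<in>{1..length \<alpha>s}. pdeg m (\<alpha>s ! (i - 1)) \<le> ?g i" for \<alpha>s
  proof (rule ccontr)
    assume "\<not> ?thesis"
    then have len: "n < length \<alpha>s" by simp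
    have snd: "snd (\<alpha>s ! i) \<in> {1..n}" "fst (\<alpha>s ! i) \<in> NN m" if "i < length \<alpha>s" for i
      using seq nth_mem[OF that] by (auto simp: antichain_seq_def NNn_def)
    have "\<not> inj_on (\<lambda>i. snd (\<alpha>s ! i)) {..n}"
    proof
      assume "inj_on (\<lambda>i. snd (\<alpha>s ! i)) {..n}"
      then have "card {..n} \<le> card {1..n}"
        by (rule card_inj_on_le) (use snd len in auto)
      then show False by simp
    qed
    then obtain i j where ij: "i < j" "j \<le> n" "snd (\<alpha>s ! i) = snd (\<alpha>s ! j)"
      unfolding inj_on_def by (metis atMost_iff nat_neq_iff)
    have "\<not> ple (\<alpha>s ! i) (\<alpha>s ! j)" "\<not> ple (\<alpha>s ! j) (\<alpha>s ! i)"
      using seq ij len sorted_wrt_nth_less[of _ \<alpha>s i j] by (auto simp: antichain_seq_def)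
    then have nle: "\<not> fst (\<alpha>s ! i) \<le> fst (\<alpha>s ! j)" "\<not> fst (\<alpha>s ! j) \<le> fst (\<alpha>s ! i)"
      using ij(3) by (auto simp: ple_def)
    have NN: "fst (\<alpha>s ! i) \<in> NN m" "fst (\<alpha>s ! j) \<in> NN m" using snd ij len by auto
    show False
    proof (cases "m = 1")
      case True
      have "\<xi> \<le> \<eta>" if "\<xi> 1 \<le> \<eta> 1" "\<xi> \<in> NN m" "\<eta> \<in> NN m" for \<xi> \<eta>
        unfolding le_fun_def
      proof
        fix x show "\<xi> x \<le> \<eta> x" using that True by (cases "x = 1") (auto simp: NN_def)
      qed
      then show False using nle NN by (meson nat_le_linear)
    next
      case False
      then have r: "r = 0" using assms(1) by simp
      have "pdeg m (\<alpha>s ! i) \<le> ?g (Suc i)" using deg ij len by (force dest: bspec[of _ _ "Suc i"])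
      then have "vdeg m (fst (\<alpha>s ! i)) = 0"
        using g0[of n "Suc i"] r ij less.prems by (simp add: pdeg_def)
      then have "fst (\<alpha>s ! i) \<in> mons m 0" using NN by (simp add: mons_def)
      then show False using nle(1) by (simp add: mons_0 le_fun_def)
    qed
  qed
  define zs where "zs = map (\<lambda>l. ((\<lambda>_. 0) :: nat \<Rightarrow> nat, Suc l)) [0..<n]"
  have zs: "antichain_seq m n zs" "length zs = n"
    by (auto simp: zs_def antichain_seq_def NNn_def NN_def sorted_wrt_iff_nth_less ple_def)
  have "pdeg m (zs ! (i - 1)) = 0" if "i \<in> {1..length zs}" for i
    using that by (auto simp: zs_def pdeg_def vdeg_def)
  then have zdeg: "\<forall>i\<in>{1..length zs}. pdeg m (zs ! (i - 1)) \<le> ?g i" by simp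
  show ?case unfolding L_num_def
  proof (rule Max_eqI)
    show "finite {length \<alpha>s |\<alpha>s. antichain_seq m n \<alpha>s \<and>
        (\<forall>i\<in>{1..length \<alpha>s}. pdeg m (\<alpha>s ! (i - 1)) \<le> ?g i)}"
      by (rule finite_subset[of _ "{..n}"]) (use bounded in auto)
    show "n \<in> {length \<alpha>s |\<alpha>s. antichain_seq m n \<alpha>s \<and>
        (\<forall>i\<in>{1..length \<alpha>s}. pdeg m (\<alpha>s ! (i - 1)) \<le> ?g i)}"
      using zs zdeg by (intro CollectI exI[of _ zs]) simp
  qed (use bounded in auto)
qed

theorem theorem38:
  fixes m n :: nat
  assumes "1 \<le> m" and "1 \<le> n"
  shows "(\<forall>r. int (C_num r m n) = int (L_num (g_fun r m n) m n) + int r - int n) \<and>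
         (2 \<le> n \<longrightarrow> (\<forall>r. C_num r m n = C_num (C_num r m (n - 1)) m 1)) \<and>
         (\<forall>r. C_num r 2 n = 2 ^ n * r)"
proof (intro conjI impI allI)
  fix r
  show "int (C_num r m n) = int (L_num (g_fun r m n) m n) + int r - int n"
  proof (cases "m = 1 \<or> r = 0")
    case True
    then show ?thesis using C_num_trivial L_num_trivial[OF True assms(2)] by simp
  next
    case False
    then have mr: "2 \<le> m" "1 \<le> r" using assms(1) by auto
    show ?thesis
      using C_num_eq_cseq[OF mr assms(2)] L_num_eq_cseq[OF mr assms(2)] cseq_ge[of r n m] by simp
  qed
next
  fix r assume n: "2 \<le> n"
  show "C_num r m n = C_num (C_num r m (n - 1)) m 1"
  proof (cases "m = 1 \<or> r = 0")
    case True
    then show ?thesis using C_num_trivial by simp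
  next
    case False
    then have mr: "2 \<le> m" "1 \<le> r" using assms(1) by auto
    have "C_num r m (n - 1) = cseq m r (n - 1)" by (rule C_num_eq_cseq[OF mr]) (use n in simp)
    moreover have "C_num (cseq m r (n - 1)) m 1 = cseq m (cseq m r (n - 1)) 1"
      by (rule C_num_eq_cseq[OF mr(1) cseq_ge_1[OF mr]]) simp
    ultimately show ?thesis
      using C_num_eq_cseq[OF mr assms(2)] cseq_add[of m r "n - 1" 1] n by simp
  qed
next
  fix r
  show "C_num r 2 n = 2 ^ n * r"
  proof (cases "r = 0")
    case True
    then show ?thesis using C_num_trivial by simp
  next
    case False
    then show ?thesis using C_num_eq_cseq[OF _ _ assms(2), of 2 r] cseq_2[of r n] by simp
  qed
qed

end
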